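(* Let $T\in(0,\infty)$, $\alpha>0$, $\nu:=\alpha-1/2$, and let $(X^{(\alpha)}_t)_{t\in[0,T]}$ be the $\alpha$-Wiener bridge on $[0,T]$. Then there exists some constant $c>0$ such that $$\mathsf{P}\left(\int_0^T(X^{(\alpha)}_t)^2\,dt<\varepsilon\right)=(c+o(1))\,\varepsilon^{1/4-\nu/2}\,e^{-T^2/(8\varepsilon)}\qquad\text{as }\varepsilon\downarrow 0.$$
   Context: Let $(B_t)_{t\ge 0}$ be a standard Wiener process. For $\alpha>0$ and $T\in(0,\infty)$ the $\alpha$-Wiener bridge on $[0,T]$ is the process $X_t^{(\alpha)}=\int_0^t\big(\frac{T-t}{T-s}\big)^\alpha\,dB_s$, $t\in[0,T)$, i.e. the unique strong solution of $dX_t^{(\alpha)}=-\frac{\alpha}{T-t}X_t^{(\alpha)}\,dt+dB_t$, $X_0^{(\alpha)}=0$, extended by $X_T^{(\alpha)}=0$ (the extension is almost surely continuous on $[0,T]$). The constant $c$ does not depend on $\varepsilon$ (it may depend on $\alpha$ and $T$). *)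

theory Defs
  imports "HOL-Probability.Probability" "HOL-Library.Landau_Symbols"
begin

text \<open>Time is modelled by the type of reals; only the values at times \<open>t \<ge> 0\<close> matter.\<close>

locale wiener_process = prob_space M for M :: "'a measure" +
  fixes B :: "real \<Rightarrow> 'a \<Rightarrow> real"
  assumes measurable: "\<And>t. 0 \<le> t \<Longrightarrow> B t \<in> borel_measurable M"
    and start: "AE \<omega> in M. B 0 \<omega> = 0"
    and indep_increments:
      "\<And>(u :: nat \<Rightarrow> real) n. \<lbrakk>0 \<le> u 0; \<And>i. i < n \<Longrightarrow> u i \<le> u (Suc i)\<rbrakk> \<Longrightarrow>
         indep_vars (\<lambda>_. borel) (\<lambda>i \<omega>. B (u (Suc i)) \<omega> - B (u i) \<omega>) {..<n}"
    and normal_increments: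
      "\<And>s t. \<lbrakk>0 \<le> s; s < t\<rbrakk> \<Longrightarrow>
         distributed M lborel (\<lambda>\<omega>. B t \<omega> - B s \<omega>) (normal_density 0 (sqrt (t - s)))"
    and continuous_paths: "AE \<omega> in M. continuous_on {0..} (\<lambda>t. B t \<omega>)"

definition step_fun :: "nat \<Rightarrow> (nat \<Rightarrow> real) \<Rightarrow> (nat \<Rightarrow> real) \<Rightarrow> real \<Rightarrow> real" where
  "step_fun n u c s = (\<Sum>i<n. c i * indicator {u i<..u (Suc i)} s)"

definition step_integral ::
  "(real \<Rightarrow> 'a \<Rightarrow> real) \<Rightarrow> nat \<Rightarrow> (nat \<Rightarrow> real) \<Rightarrow> (nat \<Rightarrow> real) \<Rightarrow> 'a \<Rightarrow> real" where
  "step_integral B n u c \<omega> = (\<Sum>i<n. c i * (B (u (Suc i)) \<omega> - B (u i) \<omega>))"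

text \<open>
  The Ito integral of a deterministic integrand: \<open>Y\<close> is a version of \<open>\<integral>\<^sub>a\<^sup>b f(s) dB\<^sub>s\<close> if it is the
  \<open>L\<^sup>2(M)\<close>-limit of the integrals of step functions that converge to \<open>f\<close> in \<open>L\<^sup>2([a,b])\<close>.
  By the isometry the limit does not depend, up to null sets, on the approximating sequence.
\<close>

definition has_wiener_integral ::
  "'a measure \<Rightarrow> (real \<Rightarrow> 'a \<Rightarrow> real) \<Rightarrow> (real \<Rightarrow> real) \<Rightarrow> real \<Rightarrow> real \<Rightarrow> ('a \<Rightarrow> real) \<Rightarrow> bool" where
  "has_wiener_integral M B f a b Y \<longleftrightarrow>
     set_borel_measurable lborel {a..b} f \<and> Y \<in> borel_measurable M \<and>
     (\<exists>(n :: nat \<Rightarrow> nat) (u :: nat \<Rightarrow> nat \<Rightarrow> real) (c :: nat \<Rightarrow> nat \<Rightarrow> real).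
        (\<forall>k. u k 0 = a \<and> u k (n k) = b \<and> (\<forall>i<n k. u k i \<le> u k (Suc i))) \<and>
        (\<lambda>k. \<integral>\<^sup>+s\<in>{a..b}. ennreal ((f s - step_fun (n k) (u k) (c k) s)\<^sup>2) \<partial>lborel)
          \<longlonglongrightarrow> 0 \<and>
        (\<lambda>k. \<integral>\<^sup>+\<omega>. ennreal ((Y \<omega> - step_integral B (n k) (u k) (c k) \<omega>)\<^sup>2) \<partial>M)
          \<longlonglongrightarrow> 0)"

text \<open>
  Each single integral is determined only up to a null set; as usual, \<open>X\<close> is the version of the
  process with almost surely continuous paths. Continuity at \<open>T\<close> is a consequence and is
  therefore not part of the definition.
\<close>

locale alpha_wiener_bridge = wiener_process M B
  for M :: "'a measure" and B :: "real \<Rightarrow> 'a \<Rightarrow> real" +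
  fixes \<alpha> T :: real and X :: "real \<Rightarrow> 'a \<Rightarrow> real"
  assumes integral_representation:
      "\<And>t. \<lbrakk>0 \<le> t; t < T\<rbrakk> \<Longrightarrow>
         has_wiener_integral M B (\<lambda>s. ((T - t) / (T - s)) powr \<alpha>) 0 t (X t)"
    and end_value: "\<And>\<omega>. \<omega> \<in> space M \<Longrightarrow> X T \<omega> = 0"
    and continuous_bridge_paths: "AE \<omega> in M. continuous_on {0..<T} (\<lambda>t. X t \<omega>)"

text \<open>
  The probability is taken in the completion of \<open>M\<close>: since paths are continuous only almost surely,
  the event need not belong to \<open>sets M\<close> (and \<open>measure M\<close> would then be \<open>0\<close> by convention), but it
  differs from an event of \<open>M\<close> by a subset of a null set. The path integral takes values in
  \<open>[0,\<infinity>]\<close>, so a divergent integral is \<open>\<infinity>\<close>, not \<open>0\<close>.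
\<close>

definition small_ball_prob :: "'a measure \<Rightarrow> (real \<Rightarrow> 'a \<Rightarrow> real) \<Rightarrow> real \<Rightarrow> real \<Rightarrow> real" where
  "small_ball_prob M X T \<epsilon> =
     measure (completion M)
       {\<omega> \<in> space M. (\<integral>\<^sup>+t\<in>{0..T}. ennreal ((X t \<omega>)\<^sup>2) \<partial>lborel) < ennreal \<epsilon>}"

end

theory Submission
  imports Defs "HOL-Complex_Analysis.Complex_Analysis" "HOL-Real_Asymp.Real_Asymp"
begin

text \<open>
  The process \<open>(T - t) powr (- \<alpha>) * X t\<close> has orthogonal Gaussian increments, so the Laplace
  transform of a Riemann sum of \<open>X\<^sup>2\<close> can be computed by integrating out the increments one at a
  time, backwards in time. This is a discrete Riccati recursion; its limit is linearised by an
  equation of Bessel type, and the Laplace transform \<open>L l\<close> of the quadratic functional satisfies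
  \<open>(L l)\<^sup>2 * K (T * sqrt (8 * l)) = K 0\<close>, where
  \<open>K x = exp (x / 2) * (\<integral>u\<in>{0..1}. exp (- x * u) * (u * (1 - u)) powr (\<alpha> - 1))\<close>.
  The identity extends to the right half-plane, where the integral representation gives the behaviour
  of \<open>K\<close>, hence of \<open>L\<close>, uniformly at infinity. The distribution function is recovered by Laplace
  inversion along the vertical line through the saddle point, and dominated convergence on that line
  yields the exact asymptotics.
\<close>

subsection \<open>Laplace transforms\<close>

text \<open>The square in the identity for \<open>L\<close> comes from the factors
  \<open>1 / sqrt (1 + 2 * b * v)\<close> of the Gaussian integrals. Left squared, the identity
  continues analytically without a choice of branch. The integrand of the rescaled process is
  singular at \<open>T\<close>, so the computation stops at \<tau> < T with an extra terminal
  weight, whose effect vanishes as \<tau> tends to \<open>T\<close>. The recursion is not solved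
  approximately: the continuous Riccati solution is imposed at the grid points, and the weights for
  which it solves the discrete recursion exactly are compared with those of a Riemann sum. Since
  \<open>K x\<close> behaves like \<open>Gamma \<alpha> * exp (x / 2) * x powr (- \<alpha>)\<close>,
  \<open>L l\<close> decays like
  \<open>exp (- T * sqrt (8 * l) / 4) * l powr (\<alpha> / 4)\<close>. The exponent
  \<open>l * \<epsilon> - T * sqrt (8 * l) / 4\<close> is critical at
  \<open>l = T\<^sup>2 / (8 * \<epsilon>\<^sup>2)\<close> with value \<open>- N\<close>, where
  \<open>N = T\<^sup>2 / (8 * \<epsilon>)\<close>. The power of \<open>L\<close> gives
  \<open>N powr (\<alpha> / 2)\<close> and the width of the peak gives \<open>1 / sqrt N\<close>,
  which together account for \<open>\<epsilon> powr ((1 - \<alpha>) / 2)\<close>.\<close>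

definition laplace :: "(real \<Rightarrow> real) \<Rightarrow> complex \<Rightarrow> complex" where
  "laplace f z = (\<integral>u. exp (- z * of_real u) * of_real (f u) \<partial>lborel)"

lemma borel_measurable_of_integrable_exp:
  fixes f :: "real \<Rightarrow> real"
  assumes "integrable lborel (\<lambda>u. exp (- s * u) * f u)"
  shows "f \<in> borel_measurable borel"
proof -
  have "(\<lambda>u. exp (s * u) * (exp (- s * u) * f u)) \<in> borel_measurable borel"
    using borel_measurable_integrable[OF assms] by measurable
  also have "(\<lambda>u. exp (s * u) * (exp (- s * u) * f u)) = f"
    by (auto simp: fun_eq_iff exp_minus)
  finally show ?thesis .
qed

lemma integrable_laplace:
  fixes f :: "real \<Rightarrow> real"
  assumes int: "integrable lborel (\<lambda>u. exp (- Re z * u) * f u)"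
  shows "integrable lborel (\<lambda>u. exp (- z * complex_of_real u) * complex_of_real (f u))"
proof -
  have m: "f \<in> borel_measurable borel"
    using int by (rule borel_measurable_of_integrable_exp)
  show ?thesis
    by (rule Bochner_Integration.integrable_bound[OF int])
       (use m in \<open>auto simp: norm_mult norm_exp_eq_Re\<close>)
qed

text \<open>Mean value inequality for \<open>exp\<close> on the disc of radius
  \<open>norm h * u\<close>. It supplies the domination of the difference quotients of
  \<open>laplace\<close>.\<close>

lemma norm_exp_quotient_le:
  fixes h :: complex
  assumes "u \<ge> 0"
  shows "norm (exp (- h * of_real u) - 1) \<le> norm h * u * exp (norm h * u)"
proof -
  have "norm (exp (- h * of_real u) - exp 0) \<le> exp (norm h * u) * norm (- h * of_real u - 0)"
  proof (rule field_differentiable_bound[where S = "cball 0 (norm h * u)" and f' = exp])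
    show "norm (exp z) \<le> exp (norm h * u)" if "z \<in> cball 0 (norm h * u)" for z :: complex
      using that order_trans[OF norm_exp, of z "exp (norm h * u)"] by auto
    show "(exp has_field_derivative exp z) (at z within cball 0 (norm h * u))" for z :: complex
      by (auto intro!: derivative_eq_intros)
  qed (use assms in \<open>auto simp: norm_mult\<close>)
  thus ?thesis using assms by (simp add: norm_mult mult_ac)
qed

lemma laplace_has_field_derivative:
  fixes f :: "real \<Rightarrow> real"
  assumes neg: "\<And>u. u < 0 \<Longrightarrow> f u = 0"
    and int: "\<And>\<sigma>. \<sigma> > c \<Longrightarrow> integrable lborel (\<lambda>u. exp (- \<sigma> * u) * f u)"
    and z: "Re z > c"
  shows "(laplace f has_field_derivative laplace (\<lambda>u. - u * f u) z) (at z)"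
proof -
  have m [measurable]: "f \<in> borel_measurable borel"
    by (rule borel_measurable_of_integrable_exp[OF int[of "c+1"]]) simp
  \<comment> \<open>The gap above \<open>c\<close> is split in three: one \<delta> absorbs the
    growth \<open>exp (norm h * u)\<close>, one absorbs the factor \<open>u\<close> through
    \<open>u \<le> exp (\<delta> * u) / \<delta>\<close>, and the last keeps the abscissa of the
    dominating function above \<open>c\<close>.\<close>
  define \<delta> where "\<delta> = (Re z - c) / 3"
  have \<delta>: "\<delta> > 0" using z by (simp add: \<delta>_def)
  have "((\<lambda>h. (laplace f (z + h) - laplace f z) / h) \<longlongrightarrow> laplace (\<lambda>u. - u * f u) z) (at 0)"
    unfolding tendsto_at_iff_sequentially o_def
  proof safe
    fix X :: "nat \<Rightarrow> complex"
    assume X: "\<forall>i. X i \<in> UNIV - {0}" "X \<longlonglongrightarrow> 0"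
    from X(2) have "eventually (\<lambda>i. norm (X i) < \<delta>) sequentially"
      using \<delta> by (auto simp: tendsto_iff dist_norm)
    then obtain N where N: "\<And>i. i \<ge> N \<Longrightarrow> norm (X i) < \<delta>"
      by (auto simp: eventually_sequentially)
    \<comment> \<open>The shift makes the bound on the increments valid for every index, as the
      domination requires.\<close>
    define h where "h i = X (i + N)" for i
    have h: "h i \<noteq> 0" "norm (h i) < \<delta>" for i using X N by (auto simp: h_def)
    have hlim: "h \<longlonglongrightarrow> 0" unfolding h_def using X(2) by (rule LIMSEQ_ignore_initial_segment)
    have "(\<lambda>i. \<integral>u. exp (- z * of_real u) * of_real (f u) * ((exp (- h i * of_real u) - 1) / h i) \<partial>lborel)
        \<longlonglongrightarrow> (\<integral>u. exp (- z * of_real u) * of_real (f u) * (- of_real u) \<partial>lborel)"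
    proof (rule integral_dominated_convergence[where w = "\<lambda>u. norm (exp (- (Re z - 2 * \<delta>) * u) * f u) / \<delta>"])
      show "integrable lborel (\<lambda>u. norm (exp (- (Re z - 2 * \<delta>) * u) * f u) / \<delta>)"
        using \<delta> z by (intro integrable_divide_zero integrable_norm int) (simp add: \<delta>_def field_simps)
      show "AE u in lborel. (\<lambda>i. exp (- z * of_real u) * of_real (f u) * ((exp (- h i * of_real u) - 1) / h i))
          \<longlonglongrightarrow> exp (- z * of_real u) * of_real (f u) * (- of_real u)"
      proof (intro AE_I2 tendsto_mult tendsto_const)
        fix u :: real
        have "((\<lambda>w. exp (- w * complex_of_real u)) has_field_derivative - of_real u) (at 0)"
          by (auto intro!: derivative_eq_intros)
        hence "((\<lambda>w. (exp (- w * complex_of_real u) - 1) / w) \<longlongrightarrow> - of_real u) (at 0)"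
          by (simp add: has_field_derivative_iff)
        thus "(\<lambda>i. (exp (- h i * of_real u) - 1) / h i) \<longlonglongrightarrow> - complex_of_real u"
          using h(1) hlim unfolding tendsto_at_iff_sequentially o_def by auto
      qed
      show "AE u in lborel. norm (exp (- z * of_real u) * of_real (f u) * ((exp (- h i * of_real u) - 1) / h i))
          \<le> norm (exp (- (Re z - 2 * \<delta>) * u) * f u) / \<delta>" for i
      proof (rule AE_I2)
        fix u :: real
        show "norm (exp (- z * of_real u) * of_real (f u) * ((exp (- h i * of_real u) - 1) / h i))
          \<le> norm (exp (- (Re z - 2 * \<delta>) * u) * f u) / \<delta>"
        proof (cases "u < 0")
          case False
          have "norm ((exp (- h i * of_real u) - 1) / h i) \<le> u * exp (norm (h i) * u)"
            using norm_exp_quotient_le[of u "h i"] h(1)[of i] False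
            by (simp add: norm_divide divide_simps mult_ac)
          also have "\<dots> \<le> (exp (\<delta> * u) / \<delta>) * exp (\<delta> * u)"
          proof (intro mult_mono)
            have "\<delta> * u \<le> exp (\<delta> * u)" using exp_ge_add_one_self[of "\<delta> * u"] by linarith
            thus "u \<le> exp (\<delta> * u) / \<delta>" using \<delta> by (simp add: field_simps)
          qed (use False h(2)[of i] \<delta> in \<open>auto intro!: mult_right_mono\<close>)
          also have "\<dots> = exp (2 * \<delta> * u) / \<delta>" by (simp flip: exp_add)
          finally have "norm ((exp (- h i * of_real u) - 1) / h i) \<le> exp (2 * \<delta> * u) / \<delta>" .
          hence "exp (- Re z * u) * \<bar>f u\<bar> * norm ((exp (- h i * of_real u) - 1) / h i)
            \<le> exp (- Re z * u) * \<bar>f u\<bar> * (exp (2 * \<delta> * u) / \<delta>)"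
            by (intro mult_left_mono) auto
          also have "\<dots> = (exp (- Re z * u) * exp (2 * \<delta> * u)) * \<bar>f u\<bar> / \<delta>" by simp
          also have "exp (- Re z * u) * exp (2 * \<delta> * u) = exp (- (Re z - 2 * \<delta>) * u)"
            by (simp add: algebra_simps flip: exp_add)
          finally show ?thesis by (simp add: norm_mult norm_divide norm_exp_eq_Re abs_mult)
        qed (simp add: neg)
      qed
    qed auto
    moreover have "(\<integral>u. exp (- z * of_real u) * of_real (f u) * ((exp (- h i * of_real u) - 1) / h i) \<partial>lborel)
        = (laplace f (z + h i) - laplace f z) / h i" for i
    proof -
      have "Re (z + h i) > c"
        using h(2)[of i] abs_Re_le_cmod[of "h i"] z by (simp add: \<delta>_def)
      hence "laplace f (z + h i) - laplace f z
         = (\<integral>u. exp (- (z + h i) * of_real u) * of_real (f u) - exp (- z * of_real u) * of_real (f u) \<partial>lborel)"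
        unfolding laplace_def using z
        by (intro Bochner_Integration.integral_diff[symmetric] integrable_laplace int)
      also have "\<dots> = (\<integral>u. exp (- z * of_real u) * of_real (f u) * (exp (- h i * of_real u) - 1) \<partial>lborel)"
        by (intro Bochner_Integration.integral_cong) (auto simp: algebra_simps simp flip: exp_add)
      finally show ?thesis by (simp flip: integral_divide_zero)
    qed
    ultimately have "(\<lambda>i. (laplace f (z + h i) - laplace f z) / h i)
        \<longlonglongrightarrow> (\<integral>u. exp (- z * of_real u) * of_real (f u) * (- of_real u) \<partial>lborel)"
      by (simp only:)
    hence "(\<lambda>i. (laplace f (z + X (i + N)) - laplace f z) / X (i + N)) \<longlonglongrightarrow> laplace (\<lambda>u. - u * f u) z"
      by (simp add: laplace_def h_def mult_ac)
    thus "(\<lambda>i. (laplace f (z + X i) - laplace f z) / X i) \<longlonglongrightarrow> laplace (\<lambda>u. - u * f u) z"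
      by (rule LIMSEQ_offset)
  qed
  thus ?thesis by (simp add: DERIV_def)
qed

lemma holomorphic_laplace:
  fixes f :: "real \<Rightarrow> real"
  assumes "\<And>u. u < 0 \<Longrightarrow> f u = 0"
    and "\<And>\<sigma>. \<sigma> > c \<Longrightarrow> integrable lborel (\<lambda>u. exp (- \<sigma> * u) * f u)"
  shows "laplace f holomorphic_on {z. Re z > c}"
  by (rule holomorphic_onI, rule field_differentiable_at_within)
     (use laplace_has_field_derivative[OF assms] in \<open>auto simp: field_differentiable_def\<close>)

lemma laplace_of_real:
  "laplace f (of_real x) = of_real (\<integral>u. exp (- x * u) * f u \<partial>lborel)"
proof -
  have "laplace f (of_real x) = (\<integral>u. of_real (exp (- x * u) * f u) \<partial>lborel)"
    unfolding laplace_def by (intro Bochner_Integration.integral_cong) (auto simp: exp_of_real[symmetric])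
  also have "\<dots> = of_real (\<integral>u. exp (- x * u) * f u \<partial>lborel)" by (rule integral_complex_of_real)
  finally show ?thesis .
qed

subsection \<open>A confluent hypergeometric function\<close>

lemma laplace_has_real_derivative:
  fixes f :: "real \<Rightarrow> real"
  assumes "\<And>u. u < 0 \<Longrightarrow> f u = 0"
    and "\<And>\<sigma>. \<sigma> > c \<Longrightarrow> integrable lborel (\<lambda>u. exp (- \<sigma> * u) * f u)"
    and "x > c"
  shows "((\<lambda>x. \<integral>u. exp (- x * u) * f u \<partial>lborel) has_real_derivative
           (\<integral>u. exp (- x * u) * (- u * f u) \<partial>lborel)) (at x)"
proof -
  have "((\<lambda>x. laplace f (of_real x)) has_vector_derivative laplace (\<lambda>u. - u * f u) (of_real x)) (at x)"
    by (rule has_vector_derivative_real_field, rule laplace_has_field_derivative[OF assms(1,2)])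
       (use assms(3) in auto)
  hence "((\<lambda>x. Re (laplace f (of_real x))) has_vector_derivative Re (laplace (\<lambda>u. - u * f u) (of_real x))) (at x)"
    by (rule bounded_linear.has_vector_derivative[OF bounded_linear_Re])
  thus ?thesis
    unfolding laplace_of_real has_real_derivative_iff_has_vector_derivative by simp
qed

definition beta_weight :: "real \<Rightarrow> real \<Rightarrow> real" where
  "beta_weight a u = indicator {0..1} u * (u powr (a - 1) * (1 - u) powr (a - 1))"

lemma beta_weight_nonneg: "beta_weight a u \<ge> 0"
  by (auto simp: beta_weight_def)

lemma beta_weight_eq_0: "u \<notin> {0..1} \<Longrightarrow> beta_weight a u = 0"
  by (auto simp: beta_weight_def)

lemma beta_weight_measurable [measurable]: "beta_weight a \<in> borel_measurable borel"
  unfolding beta_weight_def by measurable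

lemma integrable_beta_weight:
  assumes "a > 0"
  shows "integrable lborel (\<lambda>u. exp (- s * u) * (u ^ k * beta_weight a u))"
proof (rule Bochner_Integration.integrable_bound)
  show "integrable lborel (\<lambda>u. exp \<bar>s\<bar> * beta_weight a u)"
    using integrable_Beta[OF assms assms] unfolding beta_weight_def set_integrable_def
    by (intro integrable_mult_right) simp
  show "AE u in lborel. norm (exp (- s * u) * (u ^ k * beta_weight a u)) \<le> norm (exp \<bar>s\<bar> * beta_weight a u)"
  proof (rule AE_I2)
    fix u :: real
    show "norm (exp (- s * u) * (u ^ k * beta_weight a u)) \<le> norm (exp \<bar>s\<bar> * beta_weight a u)"
    proof (cases "u \<in> {0..1}")
      case True
      have "- s * u \<le> \<bar>s\<bar> * 1"
        using True by (intro order_trans[OF _ mult_mono[OF order_refl, of u 1 "\<bar>s\<bar>"]])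
          (auto simp: mult_right_mono abs_real_def)
      moreover have "u ^ k \<le> 1" using True by (intro power_le_one) auto
      ultimately have "exp (- s * u) * u ^ k \<le> exp \<bar>s\<bar> * 1"
        using True by (intro mult_mono) auto
      from mult_right_mono[OF this beta_weight_nonneg[of a u]] show ?thesis
        using True beta_weight_nonneg[of a u] by (simp add: abs_mult mult_ac)
    qed (simp add: beta_weight_eq_0)
  qed
qed measurable

text \<open>Up to the sign \<open>(- 1) ^ k\<close>, the k-th derivative of the Laplace transform of
  \<open>beta_weight a\<close>.\<close>

definition beta_moment :: "real \<Rightarrow> nat \<Rightarrow> real \<Rightarrow> real" where
  "beta_moment a k x = (\<integral>u. exp (- x * u) * (u ^ k * beta_weight a u) \<partial>lborel)"

lemma beta_moment_has_derivative [derivative_intros]: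
  assumes "a > 0"
  shows "(beta_moment a k has_real_derivative - beta_moment a (Suc k) x) (at x)"
proof -
  have "((\<lambda>x. \<integral>u. exp (- x * u) * (u ^ k * beta_weight a u) \<partial>lborel) has_real_derivative
           (\<integral>u. exp (- x * u) * (- u * (u ^ k * beta_weight a u)) \<partial>lborel)) (at x)"
    by (rule laplace_has_real_derivative[where c = "x - 1"])
       (use integrable_beta_weight[OF assms] in \<open>auto simp: beta_weight_eq_0\<close>)
  also have "(\<integral>u. exp (- x * u) * (- u * (u ^ k * beta_weight a u)) \<partial>lborel) = - beta_moment a (Suc k) x"
    by (simp add: beta_moment_def mult_ac)
  finally show ?thesis by (simp add: beta_moment_def[abs_def])
qed

text \<open>Integrate the derivative of \<open>exp (- x * u) * (u * (1 - u)) powr a\<close> over the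
  unit interval; the boundary terms vanish because \<open>a > 0\<close>. For
  \<open>m = beta_moment a 0\<close> the result is Kummer's equation
  \<open>x * m'' + (2 * a + x) * m' + a * m = 0\<close>.\<close>

lemma beta_moment_Kummer:
  assumes a: "a > 0"
  shows "x * (beta_moment a 1 x - beta_moment a 2 x) = a * (beta_moment a 0 x - 2 * beta_moment a 1 x)"
proof -
  define g where "g u = a * (exp (- x * u) * (u ^ 0 * beta_weight a u) - 2 * (exp (- x * u) * (u ^ 1 * beta_weight a u)))
      - x * (exp (- x * u) * (u ^ 1 * beta_weight a u) - exp (- x * u) * (u ^ 2 * beta_weight a u))" for u
  have int: "integrable lborel g"
    unfolding g_def using integrable_beta_weight[OF a]
    by (intro Bochner_Integration.integrable_diff integrable_mult_right) blast+
  have "(g has_integral exp (- x * 1) * (1 powr a * (1 - 1) powr a) - exp (- x * 0) * (0 powr a * (1 - 0) powr a)) {0..1}"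
  \<comment> \<open>For \<open>a < 1\<close> the primitive is not differentiable at the end points;
    continuity there suffices.\<close>
  proof (rule fundamental_theorem_of_calculus_interior)
    show "continuous_on {0..1} (\<lambda>u. exp (- x * u) * (u powr a * (1 - u) powr a))"
      using a by (intro continuous_intros continuous_on_powr') auto
    fix u :: real assume u: "u \<in> {0<..<1}"
    have "((\<lambda>u. exp (- x * u) * (u powr a * (1 - u) powr a)) has_real_derivative
       - x * exp (- x * u) * (u powr a * (1 - u) powr a) +
       exp (- x * u) * (a * u powr (a - 1) * (1 - u) powr a - u powr a * (a * (1 - u) powr (a - 1)))) (at u)"
      using u by (auto intro!: derivative_eq_intros simp: algebra_simps)
    also have "u powr a = u * u powr (a - 1)" using u by (simp add: powr_diff)
    also have "(1 - u) powr a = (1 - u) * (1 - u) powr (a - 1)" using u by (simp add: powr_diff)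
    finally show "((\<lambda>u. exp (- x * u) * (u powr a * (1 - u) powr a)) has_vector_derivative g u) (at u)"
      using u unfolding has_real_derivative_iff_has_vector_derivative[symmetric]
      by (elim DERIV_cong) (simp add: g_def beta_weight_def algebra_simps power2_eq_square)
  qed simp
  hence "(g has_integral 0) {0..1}" by simp
  moreover have "g u = 0" if "u \<notin> {0..1}" for u using that by (simp add: g_def beta_weight_eq_0)
  ultimately have "(g has_integral 0) UNIV"
    by (subst has_integral_on_superset[of g 0 "{0..1}"]) auto
  with has_integral_integral_lborel[OF int] have "integral\<^sup>L lborel g = 0"
    by (rule has_integral_unique)
  moreover have "integral\<^sup>L lborel g = a * (beta_moment a 0 x - 2 * beta_moment a 1 x)
      - x * (beta_moment a 1 x - beta_moment a 2 x)"
    unfolding g_def beta_moment_def using integrable_beta_weight[OF a]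
    by (simp only: Bochner_Integration.integral_diff integrable_mult_right integral_mult_right_zero
          Bochner_Integration.integrable_diff)
  ultimately show ?thesis by simp
qed

lemma beta_weight_integral_pos:
  assumes a: "a > 0" and p: "\<And>u. u \<in> {0<..<1} \<Longrightarrow> p u > 0"
    and int: "integrable lborel (\<lambda>u. p u * beta_weight a u)"
  shows "(\<integral>u. p u * beta_weight a u \<partial>lborel) > 0"
proof -
  have nn: "AE u in lborel. 0 \<le> p u * beta_weight a u"
  proof -
    have "AE u in lborel. u \<notin> {0, 1::real}"
      by (intro AE_not_in finite_imp_null_set_lborel) auto
    thus ?thesis
    proof eventually_elim
      case (elim u)
      show ?case
      proof (cases "u \<in> {0<..<1}")
        case True
        show ?thesis using p[OF True] beta_weight_nonneg[of a u] by simp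
      next
        case False
        hence "u \<notin> {0..1}" using elim by auto
        thus ?thesis by (simp add: beta_weight_eq_0)
      qed
    qed
  qed
  have "(\<integral>u. p u * beta_weight a u \<partial>lborel) \<noteq> 0"
  proof
    assume "(\<integral>u. p u * beta_weight a u \<partial>lborel) = 0"
    hence "AE u in lborel. p u * beta_weight a u = 0"
      using integral_nonneg_eq_0_iff_AE[OF int nn] by simp
    hence "AE u in lborel. u \<notin> {0<..<1::real}"
    proof eventually_elim
      case (elim u)
      show ?case
      proof
        assume u: "u \<in> {0<..<1}"
        hence "beta_weight a u > 0" by (auto simp: beta_weight_def)
        with p[OF u] elim show False by simp
      qed
    qed
    hence "emeasure lborel {0<..<1::real} = 0"
      by (subst (asm) AE_iff_measurable[where N = "{0<..<1::real}"]) auto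
    thus False by simp
  qed
  moreover have "(\<integral>u. p u * beta_weight a u \<partial>lborel) \<ge> 0"
    using nn by (rule integral_nonneg_AE)
  ultimately show ?thesis by simp
qed

text \<open>
  Up to a constant factor, \<open>kummer a x\<close> is \<open>x powr (1/2 - a) * I (x/2)\<close> with the modified Bessel
  function \<open>I\<close> of order \<open>a - 1/2\<close>.
\<close>

definition kummer :: "real \<Rightarrow> real \<Rightarrow> real" where
  "kummer a x = exp (x / 2) * beta_moment a 0 x"

definition kummer' :: "real \<Rightarrow> real \<Rightarrow> real" where
  "kummer' a x = exp (x / 2) * (beta_moment a 0 x / 2 - beta_moment a 1 x)"

lemma kummer_pos:
  assumes "a > 0"
  shows "kummer a x > 0"
  using beta_weight_integral_pos[OF assms, of "\<lambda>u. exp (- x * u)"] integrable_beta_weight[OF assms, of x 0]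
  by (simp add: kummer_def beta_moment_def)

text \<open>Kummer's equation trades a difference of no evident sign for
  \<open>beta_moment a 1 x - beta_moment a 2 x\<close>, the integral of \<open>u * (1 - u)\<close>
  against a positive weight. This gives both the positivity for \<open>x > 0\<close> and the zero at
  the origin.\<close>

lemma kummer'_eq:
  assumes "a > 0"
  shows "kummer' a x = x * exp (x / 2) * (beta_moment a 1 x - beta_moment a 2 x) / (2 * a)"
proof -
  have "beta_moment a 0 x / 2 - beta_moment a 1 x = x * (beta_moment a 1 x - beta_moment a 2 x) / (2 * a)"
    using beta_moment_Kummer[OF assms, of x] assms by (simp add: field_simps)
  thus ?thesis by (simp add: kummer'_def)
qed

lemma kummer'_pos:
  assumes "a > 0" "x > 0"
  shows "kummer' a x > 0"
proof -
  have eq: "exp (- x * u) * (u ^ 1 * beta_weight a u) - exp (- x * u) * (u ^ 2 * beta_weight a u)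
      = (exp (- x * u) * (u * (1 - u))) * beta_weight a u" for u
    by (simp add: algebra_simps power2_eq_square)
  have "beta_moment a 1 x - beta_moment a 2 x
      = (\<integral>u. exp (- x * u) * (u ^ 1 * beta_weight a u) - exp (- x * u) * (u ^ 2 * beta_weight a u) \<partial>lborel)"
    unfolding beta_moment_def
    by (intro Bochner_Integration.integral_diff[symmetric] integrable_beta_weight assms)
  also have "\<dots> > 0"
    using Bochner_Integration.integrable_diff[OF integrable_beta_weight[OF assms(1), of x 1]
        integrable_beta_weight[OF assms(1), of x 2]]
    unfolding eq by (intro beta_weight_integral_pos assms) auto
  finally show ?thesis using assms by (simp add: kummer'_eq)
qed

lemma kummer'_0: "a > 0 \<Longrightarrow> kummer' a 0 = 0"
  by (simp add: kummer'_eq)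

lemma kummer_has_derivative:
  assumes "a > 0"
  shows "(kummer a has_real_derivative kummer' a x) (at x)"
  unfolding kummer_def[abs_def] kummer'_def using assms
  by (auto intro!: derivative_eq_intros simp: algebra_simps)

lemma kummer'_has_derivative:
  assumes "a > 0"
  shows "(kummer' a has_real_derivative
           exp (x / 2) * (beta_moment a 0 x / 4 - beta_moment a 1 x + beta_moment a 2 x)) (at x)"
  unfolding kummer'_def[abs_def] using assms
  by (auto intro!: derivative_eq_intros simp: field_simps numeral_2_eq_2)

text \<open>The self-adjoint form of \<open>y'' + (2 * a / x) * y' = y / 4\<close>. In this form it
  becomes the linear system behind the Riccati equation of the bridge, with
  \<open>x powr (2 * a)\<close> as the weight.\<close>

lemma kummer_ODE:
  assumes a: "a > 0" and x: "x > 0"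
  shows "((\<lambda>x. x powr (2 * a) * kummer' a x) has_real_derivative x powr (2 * a) * kummer a x / 4) (at x)"
proof -
  define e m where "e = exp (x / 2)" and "m k = beta_moment a k x" for k
  have "((\<lambda>x. x powr (2 * a) * kummer' a x) has_real_derivative
      (2 * a * x powr (2 * a - 1)) * kummer' a x + x powr (2 * a) * (e * (m 0 / 4 - m 1 + m 2))) (at x)"
    using x a by (auto intro!: derivative_eq_intros kummer'_has_derivative simp: e_def m_def)
  also have "x powr (2 * a - 1) = x powr (2 * a) / x" using x by (simp add: powr_diff)
  also have "kummer' a x = x * e * (m 1 - m 2) / (2 * a)"
    using kummer'_eq[OF a] by (simp add: e_def m_def)
  also have "2 * a * (x powr (2 * a) / x) * (x * e * (m 1 - m 2) / (2 * a))
       + x powr (2 * a) * (e * (m 0 / 4 - m 1 + m 2)) = x powr (2 * a) * (e * m 0) / 4"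
    using x a by (simp add: field_simps)
  also have "e * m 0 = kummer a x" by (simp add: kummer_def e_def m_def)
  finally show ?thesis .
qed

subsection \<open>Asymptotics in a sector\<close>

definition gamma_weight :: "real \<Rightarrow> real \<Rightarrow> real" where
  "gamma_weight a u = indicator {0<..} u * u powr (a - 1)"

lemma gamma_weight_measurable [measurable]: "gamma_weight a \<in> borel_measurable borel"
  unfolding gamma_weight_def by measurable

lemma gamma_weight_nonneg: "gamma_weight a u \<ge> 0"
  by (auto simp: gamma_weight_def)

lemma has_bochner_integral_gamma_weight_1:
  assumes "a > 0"
  shows "has_bochner_integral lborel (\<lambda>u. exp (- u) * gamma_weight a u) (Gamma a)"
proof (rule has_bochner_integral_nn_integral)
  have "(\<integral>\<^sup>+u. ennreal (exp (- u) * gamma_weight a u) \<partial>lborel)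
      = (\<integral>\<^sup>+u. ennreal (indicator {0..} u * u powr (a - 1) / exp u) \<partial>lborel)"
    by (intro nn_integral_cong arg_cong[where f = ennreal])
       (auto simp: gamma_weight_def indicator_def exp_minus field_simps)
  also have "\<dots> = ennreal (Gamma a)"
    using Gamma_conv_nn_integral_real[OF assms] by simp
  finally show "(\<integral>\<^sup>+u. ennreal (exp (- u) * gamma_weight a u) \<partial>lborel) = ennreal (Gamma a)" .
qed (use assms in \<open>auto simp: gamma_weight_nonneg Gamma_real_pos less_imp_le\<close>)

lemma has_bochner_integral_gamma_weight:
  assumes "a > 0" "x > 0"
  shows "has_bochner_integral lborel (\<lambda>u. exp (- x * u) * gamma_weight a u) (Gamma a * x powr (- a))"
proof -
  \<comment> \<open>The form \<open>0 + x * u\<close> matches the affine change of variable applied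
    below.\<close>
  have eq: "exp (- x * u) * gamma_weight a u = x powr (1 - a) * (exp (- (0 + x * u)) * gamma_weight a (0 + x * u))" for u
    using assms by (auto simp: gamma_weight_def powr_mult indicator_def zero_less_mult_iff powr_diff powr_minus field_simps)
  from has_bochner_integral_gamma_weight_1[OF assms(1)]
  have 1: "integrable lborel (\<lambda>u. exp (- u) * gamma_weight a u)"
    "(\<integral>u. exp (- u) * gamma_weight a u \<partial>lborel) = Gamma a"
    by (auto simp: has_bochner_integral_iff)
  have "integrable lborel (\<lambda>u. exp (- (0 + x * u)) * gamma_weight a (0 + x * u))"
    using lborel_integrable_real_affine[OF 1(1), of x 0] assms by simp
  moreover have "(\<integral>u. exp (- (0 + x * u)) * gamma_weight a (0 + x * u) \<partial>lborel) = Gamma a / x"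
    using lborel_integral_real_affine[of x "\<lambda>u. exp (- u) * gamma_weight a u" 0] assms 1(2)
    by (simp add: field_simps)
  ultimately have "has_bochner_integral lborel (\<lambda>u. exp (- x * u) * gamma_weight a u) (x powr (1 - a) * (Gamma a / x))"
    unfolding eq has_bochner_integral_iff by simp
  thus ?thesis using assms by (simp add: powr_diff powr_minus field_simps)
qed

lemma connected_right_halfplane: "connected {z. Re z > c}"
  by (intro convex_connected convex_halfspace_Re_gt)

lemma open_right_halfplane: "open {z. Re z > c}"
  by (rule open_halfspace_Re_gt)

text \<open>Identity theorem: the positive real axis accumulates at the interior point 1.\<close>

lemma holomorphic_eq_on_right_halfplane:
  assumes "f holomorphic_on {z. Re z > 0}" "g holomorphic_on {z. Re z > 0}"
    and "\<And>x::real. x > 0 \<Longrightarrow> f (of_real x) = g (of_real x)"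
    and "Re w > 0"
  shows "f w = g w"
proof -
  have lim: "(1::complex) islimpt (of_real ` {0<..})"
    unfolding islimpt_approachable
  proof safe
    fix e :: real assume e: "e > 0"
    show "\<exists>x'\<in>complex_of_real ` {0<..}. x' \<noteq> 1 \<and> dist x' 1 < e"
      by (rule bexI[of _ "of_real (1 + e / 2)"], use e in \<open>auto simp: dist_norm simp del: of_real_add intro!: imageI\<close>)
         (use e in \<open>auto simp: norm_divide\<close>)
  qed
  have "f w - g w = 0"
    by (rule analytic_continuation[where f = "\<lambda>w. f w - g w", OF _ open_right_halfplane connected_right_halfplane _ _ lim])
       (use assms in \<open>auto intro!: holomorphic_intros\<close>)
  thus ?thesis by simp
qed

lemma laplace_gamma_weight:
  assumes a: "a > 0" and z: "Re z > 0"
  shows "laplace (gamma_weight a) z = of_real (Gamma a) * z powr (- of_real a)"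
proof (rule holomorphic_eq_on_right_halfplane[OF _ _ _ z])
  show "laplace (gamma_weight a) holomorphic_on {z. Re z > 0}"
    by (rule holomorphic_laplace)
       (use has_bochner_integral_gamma_weight[OF a] in \<open>auto simp: has_bochner_integral_iff gamma_weight_def\<close>)
  show "(\<lambda>z. of_real (Gamma a) * z powr (- of_real a)) holomorphic_on {z. Re z > 0}"
    by (auto intro!: holomorphic_intros simp: complex_nonpos_Reals_iff)
  show "laplace (gamma_weight a) (of_real x) = of_real (Gamma a) * of_real x powr (- of_real a)" if "x > 0" for x
    using has_bochner_integral_gamma_weight[OF a that] that
    by (simp add: laplace_of_real has_bochner_integral_iff powr_of_real flip: of_real_minus)
qed

lemma norm_powr_sector_le:
  assumes "norm z \<le> 2 * Re z" "a \<ge> 0" "Re z > 0"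
  shows "norm (z powr of_real a) \<le> 2 powr a * Re z powr a"
proof -
  have "norm (z powr of_real a) = norm z powr a"
    using assms by (subst norm_powr_real_powr') auto
  also have "\<dots> \<le> (2 * Re z) powr a" using assms by (intro powr_mono2) auto
  finally show ?thesis using assms by (simp add: powr_mult)
qed

text \<open>Watson's lemma, uniform in the sector \<open>norm z \<le> 2 * Re z\<close>. Near 0 the
  beta weight differs by a small multiple of the gamma weight from the gamma weight itself, whose
  transform is an exact power; the rest of the line contributes an exponentially small term.\<close>

lemma laplace_beta_weight_asymp:
  assumes a: "a > 0" and \<delta>: "\<delta> > 0"
  shows "\<exists>R\<ge>1. \<forall>z. Re z > R \<longrightarrow> norm z \<le> 2 * Re z \<longrightarrow>
    norm (laplace (beta_weight a) z * z powr of_real a - of_real (Gamma a)) < \<delta>"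
proof -
  define d where "d u = beta_weight a u - gamma_weight a u" for u
  \<comment> \<open>Chosen so that the part near 0 contributes \<open>\<delta> / 2\<close> after
    multiplication by \<open>2 powr a * Re z powr a\<close>, the sector bound for
    \<open>norm (z powr a)\<close>.\<close>
  define \<eta> where "\<eta> = \<delta> / (2 * 2 powr a * Gamma a)"
  have G: "Gamma a > 0" using a by (rule Gamma_real_pos)
  have \<eta>: "\<eta> > 0" using \<delta> G by (simp add: \<eta>_def)
  have "((\<lambda>u. (1 - u) powr (a - 1)) \<longlongrightarrow> (1 - 0) powr (a - 1)) (at_right (0::real))"
    by (intro tendsto_intros) auto
  hence "eventually (\<lambda>u. dist ((1 - u) powr (a - 1)) 1 < \<eta>) (at_right (0::real))"
    using \<eta> by (auto simp: tendsto_iff)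
  then obtain b where b: "b > 0" "\<And>u. 0 < u \<Longrightarrow> u < b \<Longrightarrow> \<bar>(1 - u) powr (a - 1) - 1\<bar> < \<eta>"
    by (auto simp: eventually_at_right_field dist_real_def)
  define u0 where "u0 = min b 1"
  have u0: "u0 > 0" using b by (auto simp: u0_def)
  have d1: "\<bar>d u\<bar> \<le> \<eta> * gamma_weight a u" if "u < u0" for u
  proof (cases "u > 0")
    case True
    hence u: "u \<in> {0..1}" "u > 0" "u < b" using that by (auto simp: u0_def)
    have "d u = u powr (a - 1) * ((1 - u) powr (a - 1) - 1)"
      using u by (simp add: d_def beta_weight_def gamma_weight_def algebra_simps)
    hence "\<bar>d u\<bar> = u powr (a - 1) * \<bar>(1 - u) powr (a - 1) - 1\<bar>" by (simp add: abs_mult)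
    also have "\<dots> \<le> u powr (a - 1) * \<eta>" using b(2)[of u] u by (intro mult_left_mono) auto
    finally show ?thesis using u by (simp add: gamma_weight_def mult.commute)
  next
    case False
    hence "d u = 0" by (cases "u = 0") (auto simp: d_def beta_weight_def gamma_weight_def)
    thus ?thesis using \<eta> gamma_weight_nonneg by simp
  qed
  have gint: "integrable lborel (\<lambda>u. exp (- \<rho> * u) * gamma_weight a u)" if "\<rho> > 0" for \<rho>
    using has_bochner_integral_gamma_weight[OF a that] by (simp add: has_bochner_integral_iff)
  have bint: "integrable lborel (\<lambda>u. exp (- \<rho> * u) * beta_weight a u)" for \<rho>
    using integrable_beta_weight[OF a, of \<rho> 0] by simp
  have dint: "integrable lborel (\<lambda>u. exp (- \<rho> * u) * d u)" if "\<rho> > 0" for \<rho>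
    using Bochner_Integration.integrable_diff[OF bint[of \<rho>] gint[OF that]] by (simp add: d_def algebra_simps)
  \<comment> \<open>One unit of the real part stays in this integral for convergence; the remaining
    \<open>Re z - 1\<close> gives the decay beyond \<open>u0\<close>.\<close>
  define D where "D = (\<integral>u. \<bar>exp (- 1 * u) * d u\<bar> \<partial>lborel)"
  have D: "D \<ge> 0" by (simp add: D_def)
  have main: "norm (laplace (beta_weight a) z * z powr of_real a - of_real (Gamma a))
     \<le> \<delta> / 2 + 2 powr a * D * (Re z powr a * exp (- (Re z - 1) * u0))"
    if z: "Re z > 1" "norm z \<le> 2 * Re z" for z
  proof -
    define \<rho> where "\<rho> = Re z"
    have \<rho>: "\<rho> > 1" using z by (simp add: \<rho>_def)
    have z0: "z \<noteq> 0" using z by auto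
    have "laplace (beta_weight a) z - laplace (gamma_weight a) z = laplace d z"
      unfolding laplace_def d_def
      using z(1) integrable_laplace[OF gint[of "Re z"]] integrable_laplace[OF bint[of "Re z"]]
      by (subst Bochner_Integration.integral_diff[symmetric]) (simp_all add: algebra_simps)
    hence eq: "laplace (beta_weight a) z * z powr of_real a - of_real (Gamma a) = laplace d z * z powr of_real a"
      using laplace_gamma_weight[OF a, of z] z z0 by (simp add: powr_minus field_simps)
    have "norm (laplace d z) \<le> (\<integral>u. norm (exp (- z * of_real u) * complex_of_real (d u)) \<partial>lborel)"
      unfolding laplace_def by (rule integral_norm_bound)
    also have "\<dots> = (\<integral>u. \<bar>exp (- \<rho> * u) * d u\<bar> \<partial>lborel)"
      by (simp add: norm_mult norm_exp_eq_Re abs_mult \<rho>_def)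
    also have "\<dots> \<le> (\<integral>u. \<eta> * (exp (- \<rho> * u) * gamma_weight a u) + exp (- (\<rho> - 1) * u0) * \<bar>exp (- 1 * u) * d u\<bar> \<partial>lborel)"
    proof (intro integral_mono Bochner_Integration.integrable_add integrable_mult_right integrable_abs dint gint)
      fix u :: real
      show "\<bar>exp (- \<rho> * u) * d u\<bar> \<le> \<eta> * (exp (- \<rho> * u) * gamma_weight a u) + exp (- (\<rho> - 1) * u0) * \<bar>exp (- 1 * u) * d u\<bar>"
      proof (cases "u < u0")
        case True
        have "\<bar>exp (- \<rho> * u) * d u\<bar> \<le> exp (- \<rho> * u) * (\<eta> * gamma_weight a u)"
          using d1[OF True] by (simp add: abs_mult)
        thus ?thesis by (simp add: mult_ac add_increasing2)
      next
        case False
        have "exp (- \<rho> * u) = exp (- (\<rho> - 1) * u) * exp (- 1 * u)" by (simp add: algebra_simps flip: exp_add)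
        also have "\<dots> \<le> exp (- (\<rho> - 1) * u0) * exp (- 1 * u)"
          using False \<rho> by (intro mult_right_mono) (auto simp: mult_left_mono)
        finally have "exp (- \<rho> * u) * \<bar>d u\<bar> \<le> exp (- (\<rho> - 1) * u0) * exp (- 1 * u) * \<bar>d u\<bar>"
          by (rule mult_right_mono) simp
        moreover have "0 \<le> \<eta> * (exp (- \<rho> * u) * gamma_weight a u)"
          using \<eta> gamma_weight_nonneg[of a u] by simp
        ultimately show ?thesis by (simp add: abs_mult mult_ac)
      qed
    qed (use \<rho> in auto)
    also have "\<dots> = \<eta> * (Gamma a * \<rho> powr (- a)) + exp (- (\<rho> - 1) * u0) * D"
      using has_bochner_integral_gamma_weight[OF a, of \<rho>] \<rho> dint[of 1]
      by (subst Bochner_Integration.integral_add)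
         (auto intro!: integrable_mult_right integrable_abs simp: has_bochner_integral_iff D_def)
    finally have n: "norm (laplace d z) \<le> \<eta> * (Gamma a * \<rho> powr (- a)) + exp (- (\<rho> - 1) * u0) * D" .
    have "norm (laplace d z * z powr of_real a) \<le>
        (\<eta> * (Gamma a * \<rho> powr (- a)) + exp (- (\<rho> - 1) * u0) * D) * (2 powr a * \<rho> powr a)"
      unfolding norm_mult \<rho>_def using z a n D \<eta> G
      by (intro mult_mono norm_powr_sector_le) (auto simp: \<rho>_def)
    also have "\<dots> = \<delta> / 2 + 2 powr a * D * (\<rho> powr a * exp (- (\<rho> - 1) * u0))"
      using \<rho> G by (simp add: \<eta>_def powr_minus field_simps)
    finally show ?thesis unfolding eq \<rho>_def .
  qed
  have "((\<lambda>\<rho>. 2 powr a * D * (\<rho> powr a * exp (- (\<rho> - 1) * u0))) \<longlongrightarrow> 2 powr a * D * 0) at_top"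
    using u0 by (intro tendsto_mult tendsto_const) real_asymp
  hence "eventually (\<lambda>\<rho>. 2 powr a * D * (\<rho> powr a * exp (- (\<rho> - 1) * u0)) < \<delta> / 2) at_top"
    by (rule order_tendstoD) (use \<delta> in simp)
  then obtain R where R: "\<And>\<rho>. \<rho> \<ge> R \<Longrightarrow> 2 powr a * D * (\<rho> powr a * exp (- (\<rho> - 1) * u0)) < \<delta> / 2"
    by (auto simp: eventually_at_top_linorder)
  show ?thesis
  proof (intro exI[of _ "max 1 R"] conjI allI impI)
    fix z assume z: "Re z > max 1 R" "norm z \<le> 2 * Re z"
    show "norm (laplace (beta_weight a) z * z powr of_real a - of_real (Gamma a)) < \<delta>"
      using main[of z] R[of "Re z"] z by simp
  qed simp
qed

subsection \<open>The complex Laplace transform of the distribution function\<close>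

text \<open>All that the analytic part needs to know about the probability. \<open>F\<close> is left
  continuous because it will be the probability of a strict inequality.\<close>

locale small_ball_laplace =
  fixes a T :: real and F :: "real \<Rightarrow> real"
  assumes a: "a > 0" and T: "T > 0"
    and F_mono: "mono F" and F_nonneg: "\<And>u. F u \<ge> 0" and F_le_1: "\<And>u. F u \<le> 1"
    and F_nonpos_arg: "\<And>u. u \<le> 0 \<Longrightarrow> F u = 0"
    and F_left_cont: "\<And>u. continuous (at_left u) F"
    and F_laplace: "\<And>l. l > 0 \<Longrightarrow>
      (l * (\<integral>u. exp (- l * u) * F u \<partial>lborel))\<^sup>2 * kummer a (T * sqrt (8 * l)) = kummer a 0"
begin

lemma F_measurable [measurable]: "F \<in> borel_measurable borel"
  using F_mono by (rule borel_measurable_mono)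

lemma integrable_F:
  assumes "s > 0"
  shows "integrable lborel (\<lambda>u. exp (- s * u) * F u)"
proof (rule Bochner_Integration.integrable_bound)
  show "integrable lborel (\<lambda>u. exp (- s * u) * gamma_weight 1 u)"
    using has_bochner_integral_gamma_weight[of 1 s] assms by (simp add: has_bochner_integral_iff)
  show "AE u in lborel. norm (exp (- s * u) * F u) \<le> norm (exp (- s * u) * gamma_weight 1 u)"
    using F_nonneg F_le_1 F_nonpos_arg by (intro AE_I2) (auto simp: gamma_weight_def indicator_def)
qed measurable

lemma holomorphic_laplace_F: "laplace F holomorphic_on {z. Re z > 0}"
  by (rule holomorphic_laplace) (use integrable_F F_nonpos_arg in auto)

definition kummer_arg :: "complex \<Rightarrow> complex" where
  "kummer_arg l = of_real T * csqrt (8 * l)"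

lemma holomorphic_kummer_arg: "kummer_arg holomorphic_on {z. Re z > 0}"
  unfolding kummer_arg_def by (auto intro!: holomorphic_intros simp: complex_nonpos_Reals_iff)

lemma kummer_arg_of_real: "l \<ge> 0 \<Longrightarrow> kummer_arg (of_real l) = of_real (T * sqrt (8 * l))"
  using csqrt_of_real_nonneg[of "complex_of_real (8 * l)"] by (simp add: kummer_arg_def)

lemma norm_kummer_arg: "norm (kummer_arg l) = T * sqrt (8 * norm l)"
  using T by (simp add: kummer_arg_def norm_mult)

text \<open>The square root halves arguments, so the right half-plane is mapped into a sector where
  the norm is at most \<open>sqrt 2\<close> times the real part; the cruder factor 2 is enough. The
  last bound pushes the image to the right uniformly as \<open>Re l\<close> grows.\<close>

lemma Re_kummer_arg:
  assumes "Re l > 0"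
  shows "Re (kummer_arg l) > 0" "norm (kummer_arg l) \<le> 2 * Re (kummer_arg l)" "Re (kummer_arg l) \<ge> T * sqrt (Re l)"
proof -
  have *: "Re (kummer_arg l) \<ge> T * (sqrt (8 * norm l) / 2)"
  proof -
    have "sqrt (8 * norm l) / 2 = sqrt (8 * norm l / 4)"
      using real_sqrt_divide[of "8 * norm l" 4] by simp
    also have "\<dots> \<le> sqrt ((norm (8 * l) + Re (8 * l)) / 2)"
      using assms by (intro real_sqrt_le_mono) (auto simp: norm_mult)
    finally show ?thesis using T by (simp add: kummer_arg_def)
  qed
  have "norm l > 0" using assms by auto
  thus "Re (kummer_arg l) > 0" using * T by (intro less_le_trans[OF _ *]) auto
  show "norm (kummer_arg l) \<le> 2 * Re (kummer_arg l)" using * by (simp add: norm_kummer_arg)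
  have "sqrt (Re l) \<le> sqrt (8 * norm l / 4)"
    using complex_Re_le_cmod[of l] assms by (intro real_sqrt_le_mono) auto
  also have "\<dots> = sqrt (8 * norm l) / 2"
    using real_sqrt_divide[of "8 * norm l" 4] by simp
  finally have "T * sqrt (Re l) \<le> T * (sqrt (8 * norm l) / 2)" using T by (intro mult_left_mono) auto
  with * show "Re (kummer_arg l) \<ge> T * sqrt (Re l)" by linarith
qed

lemma laplace_F_square:
  assumes l: "Re l > 0"
  shows "(l * laplace F l)\<^sup>2 * (exp (kummer_arg l / 2) * laplace (beta_weight a) (kummer_arg l)) = of_real (kummer a 0)"
proof (rule holomorphic_eq_on_right_halfplane[OF _ _ _ l])
  have "laplace (beta_weight a) holomorphic_on {z. Re z > 0}"
    by (rule holomorphic_laplace)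
       (use integrable_beta_weight[OF a, of _ 0] in \<open>auto simp: beta_weight_eq_0\<close>)
  hence "(laplace (beta_weight a) \<circ> kummer_arg) holomorphic_on {z. Re z > 0}"
    using Re_kummer_arg(1) by (intro holomorphic_on_compose_gen[OF holomorphic_kummer_arg]) auto
  thus "(\<lambda>l. (l * laplace F l)\<^sup>2 * (exp (kummer_arg l / 2) * laplace (beta_weight a) (kummer_arg l))) holomorphic_on {z. Re z > 0}"
    by (auto intro!: holomorphic_intros holomorphic_laplace_F holomorphic_kummer_arg simp: o_def)
  show "(of_real l * laplace F (of_real l))\<^sup>2 *
      (exp (kummer_arg (of_real l) / 2) * laplace (beta_weight a) (kummer_arg (of_real l))) = of_real (kummer a 0)"
    if "l > 0" for l :: real
  proof -
    have "exp (kummer_arg (of_real l) / 2) * laplace (beta_weight a) (kummer_arg (of_real l)) = of_real (kummer a (T * sqrt (8 * l)))"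
    proof -
      have "exp (complex_of_real (T * sqrt (8 * l)) / 2) = of_real (exp (T * sqrt (8 * l) / 2))"
        by (simp flip: exp_of_real)
      thus ?thesis
        using that by (simp add: kummer_arg_of_real laplace_of_real kummer_def beta_moment_def del: of_real_mult)
           simp
    qed
    moreover have "of_real l * laplace F (of_real l) = of_real (l * (\<integral>u. exp (- l * u) * F u \<partial>lborel))"
      by (simp add: laplace_of_real)
    ultimately have "(of_real l * laplace F (of_real l))\<^sup>2 *
      (exp (kummer_arg (of_real l) / 2) * laplace (beta_weight a) (kummer_arg (of_real l))) =
      of_real ((l * (\<integral>u. exp (- l * u) * F u \<partial>lborel))\<^sup>2 * kummer a (T * sqrt (8 * l)))"
      by (simp only: of_real_mult of_real_power)
    thus ?thesis by (simp only: F_laplace[OF that])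
  qed
qed auto

text \<open>As \<open>kummer a x\<close> behaves like
  \<open>Gamma a * exp (x / 2) * x powr (- a)\<close>, the square root of
  \<open>kummer a 0 / kummer a x\<close> behaves like
  \<open>1 / C * exp (- x / 4) * x powr (a / 2)\<close>.\<close>

definition C :: real where "C = sqrt (Gamma a / kummer a 0)"

lemma C_pos: "C > 0"
  using a by (simp add: C_def Gamma_real_pos kummer_pos)

text \<open>The quotient of \<open>l * laplace F l\<close> by its expected leading term.\<close>

definition G :: "complex \<Rightarrow> complex" where
  "G l = of_real C * (l * laplace F l) * exp (kummer_arg l / 4) * kummer_arg l powr of_real (- a / 2)"

lemma continuous_on_G: "continuous_on {z. Re z > 0} G"
proof -
  have nonpos: "kummer_arg l \<notin> \<real>\<^sub>\<le>\<^sub>0" if "Re l > 0" for l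
    using Re_kummer_arg(1)[OF that] by (simp add: complex_nonpos_Reals_iff)
  have "G holomorphic_on {z. Re z > 0}"
    unfolding G_def
    by (intro holomorphic_intros holomorphic_laplace_F holomorphic_kummer_arg) (use nonpos in auto)
  thus ?thesis by (rule holomorphic_on_imp_continuous_on)
qed

lemma laplace_F_eq:
  assumes "Re l > 0"
  shows "l * laplace F l = of_real (1 / C) * exp (- kummer_arg l / 4) * kummer_arg l powr of_real (a / 2) * G l"
proof -
  have z: "kummer_arg l \<noteq> 0" using Re_kummer_arg(1)[OF assms] by auto
  have e: "exp (- kummer_arg l / 4) * exp (kummer_arg l / 4) = 1" by (simp flip: exp_add)
  have p: "kummer_arg l powr of_real (a / 2) * kummer_arg l powr of_real (- a / 2) = 1"
    using z by (simp flip: powr_add)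
  have c: "complex_of_real (1 / C) * of_real C = 1" using C_pos by simp
  have "of_real (1 / C) * exp (- kummer_arg l / 4) * kummer_arg l powr of_real (a / 2) * G l =
     (complex_of_real (1 / C) * of_real C) * (exp (- kummer_arg l / 4) * exp (kummer_arg l / 4)) *
     (kummer_arg l powr of_real (a / 2) * kummer_arg l powr of_real (- a / 2)) * (l * laplace F l)"
    unfolding G_def by (simp only: mult_ac)
  thus ?thesis unfolding e p c by simp
qed

text \<open>All exponential and power factors cancel, so the sector asymptotics of the beta weight
  apply directly to the square of \<open>G\<close>.\<close>

lemma G_square:
  assumes "Re l > 0"
  shows "(G l)\<^sup>2 * (laplace (beta_weight a) (kummer_arg l) * kummer_arg l powr of_real a) = of_real (Gamma a)"
proof -
  define z where "z = kummer_arg l"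
  have z0: "z \<noteq> 0" using Re_kummer_arg(1)[OF assms] by (auto simp: z_def)
  have e: "(exp (z / 4))\<^sup>2 = exp (z / 2)"
    by (simp add: power2_eq_square flip: exp_add)
  have p: "(z powr of_real (- a / 2))\<^sup>2 * z powr of_real a = 1"
    using z0 by (simp add: power2_eq_square flip: powr_add)
  have "kummer a 0 * C\<^sup>2 = Gamma a"
    using kummer_pos[OF a, of 0] Gamma_real_pos[OF a] by (simp add: C_def del: Gamma_real_pos)
  hence c: "of_real (kummer a 0) * (of_real C)\<^sup>2 = complex_of_real (Gamma a)"
    by (simp flip: of_real_power of_real_mult)
  have "(G l)\<^sup>2 * (laplace (beta_weight a) z * z powr of_real a) =
      (of_real C)\<^sup>2 * ((l * laplace F l)\<^sup>2 * ((exp (z / 4))\<^sup>2 * laplace (beta_weight a) z)) *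
      ((z powr of_real (- a / 2))\<^sup>2 * z powr of_real a)"
    unfolding G_def z_def[symmetric] power_mult_distrib by (simp only: mult_ac)
  also have "\<dots> = of_real (Gamma a)"
    using laplace_F_square[OF assms] c unfolding e p z_def[symmetric] by (simp add: mult.commute)
  finally show ?thesis by (simp add: z_def)
qed

text \<open>This decides which of the two square roots \<open>G\<close> is.\<close>

lemma G_of_real_pos:
  assumes "l > 0"
  shows "Im (G (of_real l)) = 0" "Re (G (of_real l)) > 0"
proof -
  define I where "I = (\<integral>u. exp (- l * u) * F u \<partial>lborel)"
  have "I \<ge> 0" unfolding I_def using F_nonneg by (intro integral_nonneg_AE) auto
  moreover have "I \<noteq> 0"
    using F_laplace[OF assms] kummer_pos[OF a, of 0] by (auto simp: I_def)
  ultimately have I: "I > 0" by simp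
  define x where "x = T * sqrt (8 * l)"
  have x: "x > 0" using assms T by (simp add: x_def)
  have "kummer_arg (of_real l) = of_real x" using assms by (simp add: kummer_arg_of_real x_def del: of_real_mult)
  moreover have "exp (complex_of_real x / 4) = of_real (exp (x / 4))"
    by (simp flip: exp_of_real)
  moreover have "complex_of_real x powr of_real (- a / 2) = of_real (x powr (- a / 2))"
    using x by (intro powr_of_real) auto
  ultimately have "G (of_real l) = of_real (C * (l * I) * exp (x / 4) * x powr (- a / 2))"
    unfolding G_def laplace_of_real I_def[symmetric] by (simp only: of_real_mult)
  thus "Im (G (of_real l)) = 0" "Re (G (of_real l)) > 0"
    using C_pos I assms x by auto
qed

text \<open>
  The square of \<open>G\<close> tends to 1, and on a half-plane where it stays near 1 the function \<open>Re \<circ> G\<close>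
  has no zero, so it keeps the sign it has on the real axis.
\<close>

lemma G_tendsto_1:
  assumes \<delta>: "\<delta> > 0"
  shows "\<exists>R>0. \<forall>l. Re l > R \<longrightarrow> norm (G l - 1) < \<delta>"
proof -
  define \<delta>' where "\<delta>' = min \<delta> (1 / 2)"
  have \<delta>': "\<delta>' > 0" "\<delta>' \<le> 1 / 2" "\<delta>' \<le> \<delta>" using \<delta> by (auto simp: \<delta>'_def)
  have Ga: "Gamma a > 0" using a by (rule Gamma_real_pos)
  \<comment> \<open>If \<open>q\<close> is within \<kappa> of \<open>Gamma a\<close>, then
    \<open>norm q \<ge> Gamma a / 2\<close> because \<open>\<delta>' \<le> 1 / 2\<close>, and
    dividing by \<open>q\<close> bounds \<open>(G l)\<^sup>2 - 1\<close> by
    \<open>\<delta>'\<close>.\<close>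
  define \<kappa> where "\<kappa> = Gamma a * \<delta>' / 2"
  have \<kappa>: "\<kappa> > 0" using \<delta>' Ga by (simp add: \<kappa>_def)
  from laplace_beta_weight_asymp[OF a \<kappa>]
  obtain R where R: "R \<ge> 1" and R2: "\<forall>z. Re z > R \<longrightarrow> norm z \<le> 2 * Re z \<longrightarrow>
     norm (laplace (beta_weight a) z * z powr of_real a - of_real (Gamma a)) < \<kappa>"
    by blast
  define R' where "R' = (R / T)\<^sup>2"
  have R': "R' > 0" using R T by (simp add: R'_def)
  have sq: "norm ((G l)\<^sup>2 - 1) < \<delta>'" if l: "Re l > R'" for l
  proof -
    have l0: "Re l > 0" using l R' by simp
    define q where "q = laplace (beta_weight a) (kummer_arg l) * kummer_arg l powr of_real a"
    have "R / T < sqrt (Re l)"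
      using l R T by (intro real_less_rsqrt) (auto simp: R'_def)
    hence "R < T * sqrt (Re l)" using T by (simp add: field_simps)
    hence "Re (kummer_arg l) > R" using Re_kummer_arg(3)[OF l0] by linarith
    hence q: "norm (q - of_real (Gamma a)) < \<kappa>"
      unfolding q_def using Re_kummer_arg(2)[OF l0] by (intro R2[rule_format]) auto
    have "norm (complex_of_real (Gamma a)) \<le> norm q + norm (q - of_real (Gamma a))"
      by (metis norm_minus_commute norm_triangle_sub)
    hence "norm q \<ge> Gamma a - \<kappa>" using q Ga by simp
    moreover have "Gamma a * \<delta>' \<le> Gamma a * (1 / 2)" using \<delta>' Ga by (intro mult_left_mono) auto
    ultimately have nq: "norm q \<ge> Gamma a / 2" using \<kappa>_def Ga by linarith
    hence q0: "q \<noteq> 0" using Ga by auto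
    have "(G l)\<^sup>2 * q = of_real (Gamma a)" using G_square[OF l0] by (simp add: q_def)
    hence "((G l)\<^sup>2 - 1) * q = of_real (Gamma a) - q" by (simp add: algebra_simps)
    hence "norm ((G l)\<^sup>2 - 1) * norm q = norm (q - of_real (Gamma a))"
      by (metis norm_minus_commute norm_mult)
    hence "norm ((G l)\<^sup>2 - 1) * norm q < \<delta>' * (Gamma a / 2)"
      using q by (simp add: \<kappa>_def mult_ac)
    also have "\<dots> \<le> \<delta>' * norm q" using nq \<delta>' by (intro mult_left_mono) auto
    finally show ?thesis using q0 by simp
  qed
  have re: "Re (G l) \<noteq> 0" if l: "Re l > R'" for l
  proof
    assume "Re (G l) = 0"
    hence "Re ((G l)\<^sup>2 - 1) \<le> - 1" by (simp add: power2_eq_square)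
    hence "norm ((G l)\<^sup>2 - 1) \<ge> 1" using abs_Re_le_cmod[of "(G l)\<^sup>2 - 1"] by linarith
    thus False using sq[OF l] \<delta>' by simp
  qed
  have conn: "connected ((\<lambda>l. Re (G l)) ` {l. Re l > R'})"
    by (intro connected_continuous_image connected_right_halfplane continuous_intros
        continuous_on_subset[OF continuous_on_G]) (use R' in auto)
  have pos: "Re (G l) > 0" if l: "Re l > R'" for l
  proof (rule ccontr)
    assume "\<not> Re (G l) > 0"
    moreover have "Re (G (of_real (R' + 1))) > 0" using R' by (intro G_of_real_pos) auto
    moreover have "{Re (G l)..Re (G (of_real (R' + 1)))} \<subseteq> (\<lambda>l. Re (G l)) ` {l. Re l > R'}"
      by (rule connected_contains_Icc[OF conn]) (use l in \<open>auto intro!: imageI\<close>)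
    ultimately have "0 \<in> (\<lambda>l. Re (G l)) ` {l. Re l > R'}" by (auto simp: not_less subset_eq)
    thus False using re by auto
  qed
  show ?thesis
  proof (intro exI[of _ R'] conjI allI impI R')
    fix l assume l: "Re l > R'"
    have "1 \<le> norm (G l + 1)" using pos[OF l] abs_Re_le_cmod[of "G l + 1"] by simp
    hence "norm (G l - 1) * 1 \<le> norm (G l - 1) * norm (G l + 1)" by (intro mult_left_mono) auto
    also have "\<dots> = norm ((G l - 1) * (G l + 1))" by (rule norm_mult[symmetric])
    also have "\<dots> = norm ((G l)\<^sup>2 - 1)" by (simp add: power2_eq_square algebra_simps)
    also have "\<dots> < \<delta>" using sq[OF l] \<delta>' by simp
    finally show "norm (G l - 1) < \<delta>" by simp
  qed
qed

end

subsection \<open>Laplace inversion\<close>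

text \<open>Levy's inversion theorem yields limits of integrals over symmetric intervals; for an
  integrable integrand they are ordinary integrals.\<close>

lemma tendsto_integral_symmetric:
  fixes f :: "real \<Rightarrow> complex"
  assumes "integrable lborel f"
  shows "(\<lambda>n. CLBINT t=-(real n)..real n. f t) \<longlonglongrightarrow> (CLBINT t. f t)"
proof -
  have "(\<lambda>n. CLBINT t. indicator ({-(real n)..real n} :: real set) t *\<^sub>R f t) \<longlonglongrightarrow> (CLBINT t. f t)"
  proof (rule integral_dominated_convergence[where w = "\<lambda>t. norm (f t)"])
    show "AE t in lborel. (\<lambda>n. indicator ({-(real n)..real n} :: real set) t *\<^sub>R f t) \<longlonglongrightarrow> f t"
    proof (rule AE_I2, rule tendsto_eventually)
      fix t :: real
      have "eventually (\<lambda>n. real n \<ge> \<bar>t\<bar>) sequentially" by real_asymp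
      thus "eventually (\<lambda>n. indicator ({-(real n)..real n} :: real set) t *\<^sub>R f t = f t) sequentially"
        by eventually_elim (auto simp: indicator_def)
    qed
    show "AE t in lborel. norm (indicator ({-(real n)..real n} :: real set) t *\<^sub>R f t) \<le> norm (f t)" for n
      by (auto simp: indicator_def)
  qed (use assms in auto)
  moreover have "(CLBINT t=-(real n)..real n. f t) = (CLBINT t. indicator ({-(real n)..real n} :: real set) t *\<^sub>R f t)" for n
    by (simp add: interval_integral_Icc set_lebesgue_integral_def)
  ultimately show ?thesis by simp
qed

text \<open>The kernel of Levy's formula for the interval of length \<open>1 / real (Suc n)\<close>
  ending at \<open>b\<close>, divided by that length. The limit is a derivative at 0.\<close>

lemma tendsto_iexp_quotient:
  fixes t b :: real
  assumes "t \<noteq> 0"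
  shows "(\<lambda>n. real (Suc n) * ((iexp (-(t * (b - 1 / real (Suc n)))) - iexp (-(t * b))) / (\<i> * t))) \<longlonglongrightarrow> iexp (-(t * b))"
proof -
  have "((\<lambda>z. exp (\<i> * of_real t * (z - of_real b))) has_field_derivative
      (\<i> * of_real t) * exp (\<i> * of_real t * (0 - of_real b))) (at 0)"
    by (auto intro!: derivative_eq_intros)
  hence "((\<lambda>h. (exp (\<i> * of_real t * (h - of_real b)) - exp (\<i> * of_real t * (0 - of_real b))) / h)
      \<longlongrightarrow> (\<i> * of_real t) * exp (\<i> * of_real t * (0 - of_real b))) (at 0)"
    unfolding has_field_derivative_iff by simp
  moreover have "(\<lambda>n. complex_of_real (1 / real (Suc n))) \<longlonglongrightarrow> 0"
    using tendsto_of_real[OF LIMSEQ_Suc[OF lim_1_over_n[where 'a = real]], where 'a = complex]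
    by (simp only: of_real_0)
  ultimately have "(\<lambda>n. (exp (\<i> * of_real t * (of_real (1 / real (Suc n)) - of_real b)) - exp (\<i> * of_real t * (0 - of_real b))) / of_real (1 / real (Suc n)))
      \<longlonglongrightarrow> (\<i> * of_real t) * exp (\<i> * of_real t * (0 - of_real b))"
    unfolding tendsto_at_iff_sequentially o_def
    by (elim allE[of _ "\<lambda>n. of_real (1 / real (Suc n))"]) (simp del: of_real_divide of_nat_Suc)
  hence "(\<lambda>n. (exp (\<i> * of_real t * (of_real (1 / real (Suc n)) - of_real b)) - exp (\<i> * of_real t * (0 - of_real b))) / of_real (1 / real (Suc n)) / (\<i> * t))
      \<longlonglongrightarrow> (\<i> * of_real t) * exp (\<i> * of_real t * (0 - of_real b)) / (\<i> * t)"
    by (intro tendsto_divide tendsto_const) (use assms in auto)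
  moreover have "iexp (-(t * (b - h))) = exp (\<i> * of_real t * (of_real h - of_real b))" for h
    by (simp add: algebra_simps)
  moreover have "iexp (-(t * b)) = exp (\<i> * of_real t * (0 - of_real b))"
    by (simp add: algebra_simps)
  ultimately have "(\<lambda>n. (iexp (-(t * (b - 1 / real (Suc n)))) - iexp (-(t * b))) / of_real (1 / real (Suc n)) / (\<i> * t))
      \<longlonglongrightarrow> (\<i> * of_real t) * iexp (-(t * b)) / (\<i> * t)"
    by (simp only:)
  moreover have "A / of_real (1 / real (Suc n)) / c = real (Suc n) * (A / c)" for A c :: complex and n
    by (simp add: field_simps del: of_nat_Suc)
  moreover have "(\<i> * of_real t) * c / (\<i> * t) = c" for c :: complex
    using assms by simp
  ultimately show ?thesis by (simp only:)
qed

text \<open>On an interval of length \<open>h\<close> ending at \<open>b\<close>, monotonicity traps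
  the integrand between \<open>exp (- s * b) * F (b - h)\<close> and
  \<open>exp (- s * (b - h)) * F b\<close>, and left continuity closes the gap. The limit is thus
  identified at every \<open>b\<close>, not only at almost every one.\<close>

lemma left_quotient_tendsto:
  fixes F :: "real \<Rightarrow> real"
  assumes mono: "mono F" and nonneg: "\<And>u. F u \<ge> 0" and cont: "continuous (at_left b) F" and s: "s \<ge> 0"
    and int: "\<And>a. a < b \<Longrightarrow> integrable lborel (\<lambda>u. indicator {a<..b} u * (exp (- s * u) * F u))"
  shows "(\<lambda>n. real (Suc n) * (\<integral>u. indicator {b - 1 / real (Suc n)<..b} u * (exp (- s * u) * F u) \<partial>lborel))
           \<longlonglongrightarrow> exp (- s * b) * F b"
proof (rule real_tendsto_sandwich)
  define h where "h n = 1 / real (Suc n)" for n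
  have h: "h n > 0" for n by (simp add: h_def)
  have hlim: "h \<longlonglongrightarrow> 0" unfolding h_def using LIMSEQ_Suc[OF lim_1_over_n] by simp
  have bounds: "h n * (exp (- s * b) * F (b - h n)) \<le> (\<integral>u. indicator {b - h n<..b} u * (exp (- s * u) * F u) \<partial>lborel)"
    "(\<integral>u. indicator {b - h n<..b} u * (exp (- s * u) * F u) \<partial>lborel) \<le> h n * (exp (- s * (b - h n)) * F b)" for n
  proof -
    have c: "integrable lborel (\<lambda>u. indicator {b - h n<..b} u * c)"
      "(\<integral>u. indicator {b - h n<..b} u * c \<partial>lborel) = h n * c" for c :: real
      using h[of n] by auto
    have "(\<integral>u. indicator {b - h n<..b} u * (exp (- s * b) * F (b - h n)) \<partial>lborel)
      \<le> (\<integral>u. indicator {b - h n<..b} u * (exp (- s * u) * F u) \<partial>lborel)"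
    proof (intro integral_mono c int)
      fix u show "indicator {b - h n<..b} u * (exp (- s * b) * F (b - h n)) \<le> indicator {b - h n<..b} u * (exp (- s * u) * F u)"
        using nonneg s by (auto simp: indicator_def intro!: mult_mono monoD[OF mono] mult_left_mono)
    qed (use h in simp)
    thus "h n * (exp (- s * b) * F (b - h n)) \<le> (\<integral>u. indicator {b - h n<..b} u * (exp (- s * u) * F u) \<partial>lborel)"
      unfolding c .
    have "(\<integral>u. indicator {b - h n<..b} u * (exp (- s * u) * F u) \<partial>lborel)
      \<le> (\<integral>u. indicator {b - h n<..b} u * (exp (- s * (b - h n)) * F b) \<partial>lborel)"
    proof (intro integral_mono c int)
      fix u show "indicator {b - h n<..b} u * (exp (- s * u) * F u) \<le> indicator {b - h n<..b} u * (exp (- s * (b - h n)) * F b)"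
        using nonneg s by (auto simp: indicator_def intro!: mult_mono monoD[OF mono] mult_left_mono)
    qed (use h in simp)
    thus "(\<integral>u. indicator {b - h n<..b} u * (exp (- s * u) * F u) \<partial>lborel) \<le> h n * (exp (- s * (b - h n)) * F b)"
      unfolding c .
  qed
  have hh: "real (Suc n) * (h n * x) = x" for n x by (simp add: h_def del: of_nat_Suc)
  show "eventually (\<lambda>n. exp (- s * b) * F (b - h n) \<le>
      real (Suc n) * (\<integral>u. indicator {b - 1 / real (Suc n)<..b} u * (exp (- s * u) * F u) \<partial>lborel)) sequentially"
    unfolding h_def[symmetric]
    by (intro always_eventually allI, rule order_trans[OF eq_refl mult_left_mono[OF bounds(1) of_nat_0_le_iff] ])
       (simp only: hh order_refl)
  show "eventually (\<lambda>n. real (Suc n) * (\<integral>u. indicator {b - 1 / real (Suc n)<..b} u * (exp (- s * u) * F u) \<partial>lborel) \<le>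
      exp (- s * (b - h n)) * F b) sequentially"
    unfolding h_def[symmetric]
    by (intro always_eventually allI, rule order_trans[OF mult_left_mono[OF bounds(2) of_nat_0_le_iff] eq_refl])
       (simp only: hh order_refl)
  have "filterlim (\<lambda>n. b - h n) (at_left b) sequentially"
    unfolding filterlim_at using h hlim
    by (auto intro!: tendsto_eq_intros always_eventually simp: less_imp_neq[THEN not_sym])
  hence "(\<lambda>n. F (b - h n)) \<longlonglongrightarrow> F b"
    by (rule filterlim_compose[OF cont[unfolded continuous_within]])
  thus "(\<lambda>n. exp (- s * b) * F (b - h n)) \<longlonglongrightarrow> exp (- s * b) * F b" by (intro tendsto_intros)
  have "(\<lambda>n. exp (- s * (b - h n)) * F b) \<longlonglongrightarrow> exp (- s * (b - 0)) * F b"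
    by (intro tendsto_intros hlim)
  thus "(\<lambda>n. exp (- s * (b - h n)) * F b) \<longlonglongrightarrow> exp (- s * b) * F b" by simp
qed

context small_ball_laplace
begin

text \<open>The tilted function \<open>exp (- s * u) * F u / I\<close> is a probability density
  whose characteristic function at \<open>t\<close> is \<open>laplace F (s - \<i> * t) / I\<close>.
  Levy's formula on short intervals ending at \<open>b\<close>, divided by their length, recovers
  the density at \<open>b\<close>; dominated convergence applies because the divided kernel is
  bounded by 1.\<close>

lemma F_inversion:
  assumes s: "s > 0"
    and int: "integrable lborel (\<lambda>t. exp ((of_real s - \<i> * of_real t) * of_real b) * laplace F (of_real s - \<i> * of_real t))"
  shows "F b = 1 / (2 * pi) * (\<integral>t. exp ((of_real s - \<i> * of_real t) * of_real b) * laplace F (of_real s - \<i> * of_real t) \<partial>lborel)"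
proof -
  define I where "I = (\<integral>u. exp (- s * u) * F u \<partial>lborel)"
  have "I \<ge> 0" unfolding I_def using F_nonneg by (intro integral_nonneg_AE) auto
  moreover have "I \<noteq> 0"
    using F_laplace[OF s] kummer_pos[OF a, of 0] by (auto simp: I_def)
  ultimately have I: "I > 0" by simp
  define p where "p u = exp (- s * u) * F u / I" for u
  define M where "M = density lborel (\<lambda>u. ennreal (p u))"
  have p0: "p u \<ge> 0" for u using I F_nonneg by (simp add: p_def)
  have pm [measurable]: "p \<in> borel_measurable borel" unfolding p_def by measurable
  have pint: "integrable lborel p" unfolding p_def using integrable_F[OF s] by simp
  have p1: "(\<integral>u. p u \<partial>lborel) = 1" unfolding p_def using I by (simp add: I_def)
  interpret M: real_distribution M
  proof -
    have "emeasure M (space M) = 1"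
      using nn_integral_eq_integral[OF pint] p0 p1 by (simp add: M_def emeasure_density)
    hence "prob_space M" by (rule prob_spaceI)
    thus "real_distribution M" by (simp add: real_distribution_def real_distribution_axioms_def M_def)
  qed
  have meas: "measure M {x<..b} = (\<integral>u. indicator {x<..b} u * (exp (- s * u) * F u) \<partial>lborel) / I" for x
  proof -
    have "measure M {x<..b} = (\<integral>u. indicator {x<..b} u \<partial>M)" by (simp add: M_def)
    also have "\<dots> = (\<integral>u. p u *\<^sub>R indicator {x<..b} u \<partial>lborel)"
      unfolding M_def using p0 by (intro integral_density) auto
    also have "\<dots> = (\<integral>u. indicator {x<..b} u * (exp (- s * u) * F u) / I \<partial>lborel)"
      by (simp add: p_def mult_ac)
    finally show ?thesis by simp
  qed
  have atom: "measure M {x} = 0" for x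
  proof -
    have "emeasure M {x} = (\<integral>\<^sup>+u. ennreal (p u) * indicator {x} u \<partial>lborel)"
      unfolding M_def by (subst emeasure_density) auto
    also have "\<dots> = 0"
    proof (subst nn_integral_0_iff_AE)
      have "AE u in lborel. u \<notin> {x}" by (intro AE_not_in finite_imp_null_set_lborel) auto
      thus "AE u in lborel. ennreal (p u) * indicator {x} u = 0" by eventually_elim auto
    qed auto
    finally show ?thesis by (simp add: measure_def)
  qed
  have char: "char M t = laplace F (of_real s - \<i> * of_real t) / of_real I" for t
  proof -
    have "char M t = (\<integral>u. p u *\<^sub>R iexp (t * u) \<partial>lborel)"
      unfolding char_def M_def using p0 by (intro integral_density) auto
    also have "\<dots> = (\<integral>u. exp (- (of_real s - \<i> * of_real t) * of_real u) * of_real (F u) / of_real I \<partial>lborel)"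
      by (intro Bochner_Integration.integral_cong)
         (auto simp: p_def scaleR_conv_of_real exp_of_real[symmetric] algebra_simps exp_add exp_diff exp_minus divide_simps)
    finally show ?thesis by (simp add: laplace_def)
  qed
  have phi_eq: "iexp (-(t * b)) * char M t = exp ((of_real s - \<i> * of_real t) * of_real b) * laplace F (of_real s - \<i> * of_real t) / of_real (exp (s * b) * I)" for t
    unfolding char by (simp add: exp_of_real[symmetric] algebra_simps exp_diff exp_minus divide_simps)
  have phi: "integrable lborel (\<lambda>t. iexp (-(t * b)) * char M t)"
    unfolding phi_eq using int by (rule integrable_divide_zero)
  define Q where "Q n t = (iexp (-(t * (b - 1 / real (Suc n)))) - iexp (-(t * b))) / (\<i> * t)" for n t
  have Q: "norm (Q n t) \<le> 1 / real (Suc n)" for n t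
  \<comment> \<open>At \<open>t = 0\<close> the quotient is 0 by the convention for division by
    zero.\<close>
  proof (cases "t = 0")
    case False
    have "norm (Q n t) = norm ((iexp ((-t) * b) - iexp ((-t) * (b - 1 / real (Suc n)))) / (\<i> * complex_of_real (- t)))"
      unfolding Q_def by (simp add: norm_divide norm_minus_commute)
    also have "\<dots> \<le> b - (b - 1 / real (Suc n))"
      using False by (intro Levy_Inversion_aux2) auto
    finally show ?thesis by simp
  qed (simp add: Q_def)
  have charm [measurable]: "char M \<in> borel_measurable borel" by simp
  have nphi: "integrable lborel (\<lambda>t. norm (char M t))"
  proof -
    have "norm (iexp (-(t * b)) * char M t) = norm (char M t)" for t by (simp add: norm_mult)
    with integrable_norm[OF phi] show ?thesis by simp
  qed
  have Qint: "integrable lborel (\<lambda>t. Q n t * char M t)" for n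
  proof (rule Bochner_Integration.integrable_bound[OF integrable_mult_right[OF nphi, of "1 / real (Suc n)"]])
    show "AE t in lborel. norm (Q n t * char M t) \<le> norm (1 / real (Suc n) * norm (char M t))"
      using mult_right_mono[OF Q[of n] norm_ge_zero, of _ "char M _"]
      by (intro AE_I2) (simp add: norm_mult)
  qed (unfold Q_def, measurable)
  have inv: "of_real (measure M {b - 1 / real (Suc n)<..b}) = 1 / (2 * pi) * (CLBINT t. Q n t * char M t)" for n
  proof (rule LIMSEQ_unique)
    show "(\<lambda>T. 1 / (2 * pi) * (CLBINT t=-(real T)..real T. Q n t * char M t))
      \<longlonglongrightarrow> of_real (measure M {b - 1 / real (Suc n)<..b})"
      using M.Levy_Inversion[OF _ atom atom, of "b - 1 / real (Suc n)" b]
      by (simp add: Q_def del: of_nat_Suc)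
    show "(\<lambda>T. 1 / (2 * pi) * (CLBINT t=-(real T)..real T. Q n t * char M t))
      \<longlonglongrightarrow> 1 / (2 * pi) * (CLBINT t. Q n t * char M t)"
      by (intro tendsto_mult tendsto_const tendsto_integral_symmetric Qint)
  qed
  have "(\<lambda>n. CLBINT t. real (Suc n) * Q n t * char M t) \<longlonglongrightarrow> (CLBINT t. iexp (-(t * b)) * char M t)"
  proof (rule integral_dominated_convergence[OF _ _ nphi])
    have "AE t in lborel. t \<notin> {0::real}" by (intro AE_not_in finite_imp_null_set_lborel) auto
    thus "AE t in lborel. (\<lambda>n. real (Suc n) * Q n t * char M t) \<longlonglongrightarrow> iexp (-(t * b)) * char M t"
    proof eventually_elim
      case (elim t)
      show ?case unfolding Q_def using elim by (intro tendsto_mult tendsto_const tendsto_iexp_quotient) auto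
    qed
    show "AE t in lborel. norm (real (Suc n) * Q n t * char M t) \<le> norm (char M t)" for n
    proof (rule AE_I2)
      fix t
      have "real (Suc n) * norm (Q n t) \<le> real (Suc n) * (1 / real (Suc n))"
        using Q[of n t] by (intro mult_left_mono) auto
      hence "real (Suc n) * norm (Q n t) \<le> 1" by simp
      from mult_right_mono[OF this, of "norm (char M t)"]
      show "norm (real (Suc n) * Q n t * char M t) \<le> norm (char M t)"
        by (simp add: norm_mult del: of_nat_Suc)
    qed
  qed (unfold Q_def, measurable)
  hence "(\<lambda>n. 1 / (2 * pi) * (CLBINT t. real (Suc n) * Q n t * char M t)) \<longlonglongrightarrow>
      1 / (2 * pi) * (CLBINT t. iexp (-(t * b)) * char M t)"
    by (intro tendsto_mult tendsto_const)
  moreover have "1 / (2 * pi) * (CLBINT t. real (Suc n) * Q n t * char M t) =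
      of_real (real (Suc n) * measure M {b - 1 / real (Suc n)<..b})" for n
    unfolding of_real_mult inv by (simp add: mult.assoc del: of_nat_Suc)
  ultimately have lim1: "(\<lambda>n. complex_of_real (real (Suc n) * measure M {b - 1 / real (Suc n)<..b})) \<longlonglongrightarrow>
      1 / (2 * pi) * (CLBINT t. iexp (-(t * b)) * char M t)"
    by (simp only:)
  have "(\<lambda>n. real (Suc n) * measure M {b - 1 / real (Suc n)<..b}) \<longlonglongrightarrow> exp (- s * b) * F b / I"
  proof -
    have "(\<lambda>n. real (Suc n) * (\<integral>u. indicator {b - 1 / real (Suc n)<..b} u * (exp (- s * u) * F u) \<partial>lborel) / I)
        \<longlonglongrightarrow> exp (- s * b) * F b / I"
    proof (intro tendsto_divide tendsto_const left_quotient_tendsto F_mono F_nonneg F_left_cont)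
      show "integrable lborel (\<lambda>u. indicator {x<..b} u * (exp (- s * u) * F u))" for x
        by (rule Bochner_Integration.integrable_bound[OF integrable_F[OF s]]) (auto simp: indicator_def)
    qed (use s I in auto)
    thus ?thesis unfolding meas by simp
  qed
  hence "(\<lambda>n. complex_of_real (real (Suc n) * measure M {b - 1 / real (Suc n)<..b})) \<longlonglongrightarrow> of_real (exp (- s * b) * F b / I)"
    by (rule tendsto_of_real)
  from LIMSEQ_unique[OF this lim1]
  have "of_real (exp (- s * b) * F b / I) = 1 / (2 * pi) * (CLBINT t. iexp (-(t * b)) * char M t)" .
  also have "\<dots> = 1 / (2 * pi) * ((\<integral>t. exp ((of_real s - \<i> * of_real t) * of_real b) * laplace F (of_real s - \<i> * of_real t) \<partial>lborel) / of_real (exp (s * b) * I))"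
    unfolding phi_eq by simp
  finally show ?thesis
    using I by (simp add: exp_minus field_simps)
qed

end

subsection \<open>The saddle point\<close>

text \<open>A bound free of \<open>N\<close>. The subtracted quotient in the exponent behaves like
  \<open>t\<^sup>2 / 4\<close> near 0 and like \<open>sqrt \<bar>t\<bar>\<close> far out, which
  still beats the power.\<close>

definition majorant :: "real \<Rightarrow> real \<Rightarrow> real" where
  "majorant a t = (1 + \<bar>t\<bar>) powr a * exp (- (t\<^sup>2 / ((2 + \<bar>t\<bar>) * (2 + sqrt \<bar>t\<bar>))))"

lemma majorant_measurable [measurable]: "majorant a \<in> borel_measurable borel"
  unfolding majorant_def by measurable

lemma integrable_majorant:
  assumes a: "a > 0"
  shows "integrable lborel (majorant a)"
proof -
  define g where "g t = (1 + t\<^sup>2) * majorant a t" for t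
  have "((\<lambda>t. (1 + t\<^sup>2) * ((1 + t) powr a * exp (- (t\<^sup>2 / ((2 + t) * (2 + sqrt t)))))) \<longlongrightarrow> 0) at_top"
    using a by real_asymp
  hence "eventually (\<lambda>t. (1 + t\<^sup>2) * ((1 + t) powr a * exp (- (t\<^sup>2 / ((2 + t) * (2 + sqrt t))))) < 1) at_top"
    by (rule order_tendstoD) simp
  then obtain R where R: "\<And>t. t \<ge> R \<Longrightarrow> (1 + t\<^sup>2) * ((1 + t) powr a * exp (- (t\<^sup>2 / ((2 + t) * (2 + sqrt t))))) < 1"
    by (auto simp: eventually_at_top_linorder)
  have "continuous_on {-\<bar>R\<bar>..\<bar>R\<bar>} g"
    unfolding g_def majorant_def
    by (intro continuous_intros) (auto simp: add_nonneg_eq_0_iff)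
  hence "compact (g ` {-\<bar>R\<bar>..\<bar>R\<bar>})" by (intro compact_continuous_image) auto
  hence "bounded (g ` {-\<bar>R\<bar>..\<bar>R\<bar>})" by (rule compact_imp_bounded)
  then obtain K where K: "\<And>t. t \<in> {-\<bar>R\<bar>..\<bar>R\<bar>} \<Longrightarrow> \<bar>g t\<bar> \<le> K"
    unfolding bounded_iff by (metis (no_types, lifting) image_eqI real_norm_def)
  have bnd: "g t \<le> max K 1" for t
  proof (cases "t \<in> {-\<bar>R\<bar>..\<bar>R\<bar>}")
    case True thus ?thesis using K[OF True] by auto
  next
    case False
    hence "\<bar>t\<bar> \<ge> R" by auto
    from R[OF this] show ?thesis by (simp add: g_def majorant_def)
  qed
  show ?thesis
  proof (rule Bochner_Integration.integrable_bound)
    show "integrable lborel (\<lambda>t::real. max K 1 * inverse (1 + t\<^sup>2))"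
      using integrable_inverse_1_plus_square
      by (intro integrable_mult_right) (simp add: set_integrable_def)
    show "AE t in lborel. norm (majorant a t) \<le> norm (max K 1 * inverse (1 + t\<^sup>2))"
    proof (rule AE_I2)
      fix t :: real
      have t: "1 + t\<^sup>2 > 0" by (simp add: add_pos_nonneg)
      have "majorant a t \<ge> 0" by (simp add: majorant_def)
      moreover have "majorant a t \<le> max K 1 * inverse (1 + t\<^sup>2)"
        using bnd[of t] t unfolding g_def by (simp add: field_simps)
      ultimately show "norm (majorant a t) \<le> norm (max K 1 * inverse (1 + t\<^sup>2))"
        by (metis abs_of_nonneg order_trans real_norm_def)
    qed
  qed measurable
qed

text \<open>The vertical line through a real point \<open>s\<close> is
  \<open>l = s * w\<^sup>2\<close> with this root \<open>w\<close>; \<open>1 / sqrt N\<close> is the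
  width of the Gaussian peak relative to \<open>s\<close>.\<close>

definition saddle_root :: "real \<Rightarrow> real \<Rightarrow> complex" where
  "saddle_root N t = csqrt (1 - \<i> * of_real (t / sqrt N))"

lemma saddle_root_square: "(saddle_root N t)\<^sup>2 = 1 - \<i> * of_real (t / sqrt N)"
  by (simp add: saddle_root_def)

lemma norm_saddle_root_ge_1: "norm (saddle_root N t) \<ge> 1"
proof -
  have "1 \<le> norm (1 - \<i> * of_real (t / sqrt N))"
    using abs_Re_le_cmod[of "1 - \<i> * of_real (t / sqrt N)"] by simp
  thus ?thesis unfolding saddle_root_def by simp
qed

lemma Re_saddle_root_pos: "Re (saddle_root N t) > 0"
proof -
  have "cmod (1 - \<i> * of_real (t / sqrt N)) + 1 > 0" by (simp add: add_nonneg_pos)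
  thus ?thesis unfolding saddle_root_def by simp
qed

lemma norm_saddle_root_le:
  assumes "N \<ge> 1"
  shows "norm (saddle_root N t) \<le> 1 + \<bar>t\<bar>"
proof -
  have "\<bar>t / sqrt N\<bar> \<le> \<bar>t\<bar>" using assms by (auto simp: abs_divide divide_le_eq mult_le_cancel_left1)
  hence "norm (1 - \<i> * of_real (t / sqrt N)) \<le> 1 + \<bar>t\<bar>"
    using norm_triangle_ineq4[of 1 "\<i> * of_real (t / sqrt N)"]
    by (simp only: norm_mult norm_ii norm_of_real norm_one)
  also have "\<dots> \<le> (1 + \<bar>t\<bar>)\<^sup>2" by (simp add: power2_eq_square algebra_simps)
  finally show ?thesis unfolding saddle_root_def norm_csqrt by (intro real_le_lsqrt) auto
qed

text \<open>Since \<open>w\<^sup>2\<close> has real part 1, \<open>(w - 1)\<^sup>2\<close> has real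
  part \<open>2 - 2 * u\<close> with \<open>u = Re w\<close>, and
  \<open>y\<^sup>2 = 2 * (u - 1) * (u + 1) * (r + 1)\<close> expresses \<open>u - 1\<close> as a
  quotient. Replacing \<open>\<bar>y\<bar>\<close> by \<open>\<bar>t\<bar>\<close> in the
  denominator, possible for \<open>N \<ge> 1\<close>, removes \<open>N\<close>.\<close>

lemma norm_exp_saddle_root_le:
  assumes N: "N \<ge> 1"
  shows "norm (exp (of_real N * (saddle_root N t - 1)\<^sup>2)) \<le> exp (- (t\<^sup>2 / ((2 + \<bar>t\<bar>) * (2 + sqrt \<bar>t\<bar>))))"
proof -
  define y where "y = t / sqrt N"
  define w where "w = saddle_root N t"
  define u where "u = Re w"
  define r where "r = sqrt (1 + y\<^sup>2)"
  have y: "\<bar>y\<bar> \<le> \<bar>t\<bar>" "N * y\<^sup>2 = t\<^sup>2"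
    using N by (auto simp: y_def abs_divide divide_le_eq mult_le_cancel_left1 power_divide)
  have "cmod (1 - \<i> * of_real y) = r"
    by (simp add: r_def cmod_def)
  hence u2: "u\<^sup>2 = (r + 1) / 2" "u \<ge> 0"
    using Re_saddle_root_pos[of N t] by (simp_all add: u_def w_def saddle_root_def y_def)
  have r: "r \<ge> 1" "r\<^sup>2 = 1 + y\<^sup>2" "r \<le> 1 + \<bar>y\<bar>"
    by (simp_all add: r_def real_le_lsqrt power2_eq_square algebra_simps)
  have re: "Re ((w - 1)\<^sup>2) = 2 - 2 * u"
  proof -
    have "Re (w\<^sup>2) = 1" by (simp add: w_def saddle_root_square)
    thus ?thesis by (simp add: u_def power2_eq_square algebra_simps)
  qed
  have u1: "u \<ge> 1"
  proof (rule power2_le_imp_le)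
    show "1\<^sup>2 \<le> u\<^sup>2" using r u2 by simp
  qed fact
  have "u \<le> 1 + sqrt \<bar>y\<bar>"
  proof (rule power2_le_imp_le)
    have "u\<^sup>2 \<le> 1 + \<bar>y\<bar>" using u2 r by (simp add: field_simps)
    also have "\<dots> \<le> (1 + sqrt \<bar>y\<bar>)\<^sup>2" by (simp add: power2_eq_square algebra_simps)
    finally show "u\<^sup>2 \<le> (1 + sqrt \<bar>y\<bar>)\<^sup>2" .
  qed auto
  also have "sqrt \<bar>y\<bar> \<le> sqrt \<bar>t\<bar>" using y by simp
  finally have u3: "u + 1 \<le> 2 + sqrt \<bar>t\<bar>" by simp
  have "y\<^sup>2 = (r - 1) * (r + 1)" using r(2) by (simp add: power2_eq_square algebra_simps)
  also have "r - 1 = 2 * (u\<^sup>2 - 1)" using u2 by simp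
  also have "\<dots> = 2 * (u - 1) * (u + 1)" by (simp add: power2_eq_square algebra_simps)
  finally have "y\<^sup>2 = (2 * (u - 1)) * ((r + 1) * (u + 1))" by (simp add: mult_ac)
  also have "\<dots> \<le> (2 * (u - 1)) * ((2 + \<bar>t\<bar>) * (2 + sqrt \<bar>t\<bar>))"
    using u1 u3 r y by (intro mult_left_mono mult_mono) auto
  finally have "N * y\<^sup>2 \<le> N * ((2 * (u - 1)) * ((2 + \<bar>t\<bar>) * (2 + sqrt \<bar>t\<bar>)))"
    using N by (intro mult_left_mono) auto
  hence "t\<^sup>2 \<le> (N * (2 * u - 2)) * ((2 + \<bar>t\<bar>) * (2 + sqrt \<bar>t\<bar>))"
    unfolding y(2) by (simp add: algebra_simps)
  hence "t\<^sup>2 / ((2 + \<bar>t\<bar>) * (2 + sqrt \<bar>t\<bar>)) \<le> N * (2 * u - 2)"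
    by (subst pos_divide_le_eq) (auto intro!: mult_pos_pos add_pos_nonneg)
  thus ?thesis
  proof -
    have "norm (exp (of_real N * (w - 1)\<^sup>2)) = exp (N * (2 - 2 * u))"
      using re by (simp add: norm_exp_eq_Re)
    moreover have "N * (2 - 2 * u) = - (N * (2 * u - 2))" by (simp add: algebra_simps)
    moreover assume "t\<^sup>2 / ((2 + \<bar>t\<bar>) * (2 + sqrt \<bar>t\<bar>)) \<le> N * (2 * u - 2)"
    ultimately show ?thesis by (simp add: w_def)
  qed
qed

lemma saddle_root_tendsto: "((\<lambda>N. saddle_root N t) \<longlongrightarrow> 1) at_top"
proof -
  have "((\<lambda>N. t / sqrt N) \<longlongrightarrow> 0) at_top" by real_asymp
  hence "((\<lambda>N. 1 - \<i> * of_real (t / sqrt N)) \<longlongrightarrow> 1 - \<i> * of_real 0) at_top"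
    by (intro tendsto_intros)
  moreover have "isCont csqrt 1"
    by (intro continuous_at_csqrt) (auto simp: complex_nonpos_Reals_iff)
  ultimately have "((\<lambda>N. csqrt (1 - \<i> * of_real (t / sqrt N))) \<longlongrightarrow> csqrt 1) at_top"
    by (intro isCont_tendsto_compose[of 1 csqrt]) auto
  thus ?thesis by (simp add: saddle_root_def)
qed

text \<open>Multiplication by \<open>(w + 1)\<^sup>2\<close> turns
  \<open>N * (w - 1)\<^sup>2\<close> into \<open>N * (w\<^sup>2 - 1)\<^sup>2 = - t\<^sup>2\<close>,
  and \<open>w + 1\<close> tends to 2.\<close>

lemma exp_saddle_root_tendsto:
  "((\<lambda>N. exp (of_real N * (saddle_root N t - 1)\<^sup>2)) \<longlongrightarrow> of_real (exp (- (t\<^sup>2 / 4)))) at_top"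
proof -
  have "((\<lambda>N. - (of_real t)\<^sup>2 / (saddle_root N t + 1)\<^sup>2) \<longlongrightarrow> - (of_real t)\<^sup>2 / (1 + 1)\<^sup>2) at_top"
    by (intro tendsto_intros saddle_root_tendsto) auto
  moreover have "eventually (\<lambda>N. - (of_real t)\<^sup>2 / (saddle_root N t + 1)\<^sup>2 = of_real N * (saddle_root N t - 1)\<^sup>2) at_top"
    using eventually_gt_at_top[of "0::real"]
  proof eventually_elim
    case (elim N)
    have "saddle_root N t + 1 \<noteq> 0"
      using Re_saddle_root_pos[of N t] by (auto simp: complex_eq_iff)
    moreover have "of_real N * (saddle_root N t - 1)\<^sup>2 * (saddle_root N t + 1)\<^sup>2 = - (of_real t)\<^sup>2"
    proof -
      have "of_real N * (saddle_root N t - 1)\<^sup>2 * (saddle_root N t + 1)\<^sup>2 = of_real N * ((saddle_root N t)\<^sup>2 - 1)\<^sup>2"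
        by (simp add: power2_eq_square algebra_simps)
      also have "\<dots> = of_real N * (- \<i> * of_real (t / sqrt N))\<^sup>2" by (simp add: saddle_root_square)
      also have "\<dots> = - of_real (N * (t / sqrt N)\<^sup>2)"
        by (simp only: power_mult_distrib of_real_mult of_real_power) simp
      also have "N * (t / sqrt N)\<^sup>2 = t\<^sup>2" using elim by (simp add: power_divide)
      finally show ?thesis by simp
    qed
    ultimately show ?case by (metis nonzero_eq_divide_eq power_not_zero)
  qed
  ultimately have "((\<lambda>N. of_real N * (saddle_root N t - 1)\<^sup>2) \<longlongrightarrow> - (of_real t)\<^sup>2 / (1 + 1)\<^sup>2) at_top"
    by (rule Lim_transform_eventually)
  hence "((\<lambda>N. exp (of_real N * (saddle_root N t - 1)\<^sup>2)) \<longlongrightarrow> exp (- (of_real t)\<^sup>2 / (1 + 1)\<^sup>2)) at_top"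
    by (rule tendsto_exp)
  thus ?thesis by (simp add: exp_of_real[symmetric])
qed

lemma csqrt_scale:
  assumes "x > 0" "Re w > 0"
  shows "csqrt (of_real x * w\<^sup>2) = of_real (sqrt x) * w"
proof (rule csqrt_unique)
  show "(of_real (sqrt x) * w)\<^sup>2 = of_real x * w\<^sup>2"
    using assms by (simp add: power_mult_distrib flip: of_real_power)
qed (use assms in auto)

section \<open>Dominated convergence on the line through the saddle point\<close>

context small_ball_laplace
begin

text \<open>\<open>N\<close> is the exponent \<open>T\<^sup>2 / (8 * \<epsilon>)\<close> of the
  final estimate; at this abscissa \<open>kummer_arg\<close> equals \<open>8 * N\<close>.\<close>

definition saddle_abscissa :: "real \<Rightarrow> real" where
  "saddle_abscissa N = 8 * N\<^sup>2 / T\<^sup>2"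

definition saddle_point :: "real \<Rightarrow> real \<Rightarrow> complex" where
  "saddle_point N t = of_real (saddle_abscissa N) * (saddle_root N t)\<^sup>2"

text \<open>The inversion integrand without its scalar factors. The exponent
  \<open>a / 2 - 2\<close> combines \<open>a / 2\<close> from the power of \<open>kummer_arg\<close>
  with \<open>- 2\<close> from the division by \<open>l\<close>.\<close>

definition saddle_fun :: "real \<Rightarrow> real \<Rightarrow> complex" where
  "saddle_fun N t = exp (of_real N * (saddle_root N t - 1)\<^sup>2) * saddle_root N t powr of_real (a / 2 - 2) *
     G (saddle_point N t)"

lemma Re_saddle: "N > 0 \<Longrightarrow> Re (saddle_point N t) = saddle_abscissa N"
  by (simp add: saddle_point_def saddle_root_square)

lemma saddle_abscissa_pos: "N > 0 \<Longrightarrow> saddle_abscissa N > 0"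
  using T by (simp add: saddle_abscissa_def)

text \<open>The abscissa \<open>saddle_abscissa N\<close> is the critical point of \<open>\<lambda>l. exp (l * \<epsilon> - kummer_arg l / 4)\<close> for \<open>\<epsilon> = T\<^sup>2 / (8 * N)\<close>.\<close>

lemma inversion_integrand_eq:
  fixes N t :: real
  assumes N: "N > 0"
  defines "l \<equiv> saddle_point N t"
  shows "exp (l * of_real (T\<^sup>2 / (8 * N))) * laplace F l =
    of_real (exp (- N) * (8 * N) powr (a / 2) / (C * saddle_abscissa N)) * saddle_fun N t"
proof -
  define w where "w = saddle_root N t"
  define s where "s = saddle_abscissa N"
  have s: "s > 0" using saddle_abscissa_pos[OF N] by (simp add: s_def)
  have w: "Re w > 0" "w \<noteq> 0" using Re_saddle_root_pos[of N t] by (auto simp: w_def)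
  have l: "l = of_real s * w\<^sup>2" by (simp add: l_def w_def s_def saddle_point_def)
  have Rel: "Re l > 0" using Re_saddle[OF N] s by (simp add: l_def s_def)
  have l0: "l \<noteq> 0" using Rel by auto
  have z: "kummer_arg l = of_real (8 * N) * w"
  proof -
    have "csqrt (8 * l) = of_real (sqrt (8 * s)) * w"
      using csqrt_scale[of "8 * s" w] s w by (simp add: l mult_ac)
    moreover have "sqrt (8 * s) = 8 * N / T"
      using N T by (intro real_sqrt_unique) (auto simp: s_def saddle_abscissa_def power_divide power_mult_distrib)
    ultimately show ?thesis using T by (simp add: kummer_arg_def)
  qed
  have "l * laplace F l = of_real (1 / C) * exp (- kummer_arg l / 4) * kummer_arg l powr of_real (a / 2) * G l"
    by (rule laplace_F_eq[OF Rel])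
  also have "kummer_arg l powr of_real (a / 2) = of_real ((8 * N) powr (a / 2)) * w powr of_real (a / 2)"
    unfolding z using N
    by (subst powr_times_real_left) (auto simp: powr_of_real[symmetric] simp del: of_real_divide)
  also have "- kummer_arg l / 4 = - (2 * of_real N * w)" by (simp add: z)
  finally have "laplace F l = of_real (1 / C) * exp (- (2 * of_real N * w)) * (of_real ((8 * N) powr (a / 2)) * w powr of_real (a / 2)) * G l / l"
    using l0 by (metis nonzero_mult_div_cancel_left)
  also have "w powr of_real (a / 2) = w powr of_real (a / 2 - 2) * w\<^sup>2"
    using w by (simp add: powr_diff power2_eq_square flip: powr_nat)
  finally have L: "laplace F l = of_real ((8 * N) powr (a / 2) / (C * s)) * exp (- (2 * of_real N * w)) * w powr of_real (a / 2 - 2) * G l"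
    using w s by (simp add: l field_simps)
  have "s * (T\<^sup>2 / (8 * N)) = N" using N T by (simp add: s_def saddle_abscissa_def field_simps power2_eq_square)
  hence "l * of_real (T\<^sup>2 / (8 * N)) = of_real N * w\<^sup>2"
    unfolding l by (metis (no_types, opaque_lifting) mult.commute mult.left_commute of_real_mult)
  \<comment> \<open>Completing the square,
    \<open>N * w\<^sup>2 - 2 * N * w = N * (w - 1)\<^sup>2 - N\<close>, is the source of the factor
    \<open>exp (- N)\<close>.\<close>
  hence "exp (l * of_real (T\<^sup>2 / (8 * N))) * exp (- (2 * of_real N * w)) = exp (of_real N * (w - 1)\<^sup>2 - of_real N)"
    by (simp add: power2_eq_square algebra_simps flip: exp_add)
  also have "\<dots> = of_real (exp (- N)) * exp (of_real N * (w - 1)\<^sup>2)"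
    by (simp add: exp_diff exp_minus field_simps flip: exp_of_real)
  finally have E: "exp (l * of_real (T\<^sup>2 / (8 * N))) * exp (- (2 * of_real N * w)) = of_real (exp (- N)) * exp (of_real N * (w - 1)\<^sup>2)" .
  have "exp (l * of_real (T\<^sup>2 / (8 * N))) * laplace F l =
     (exp (l * of_real (T\<^sup>2 / (8 * N))) * exp (- (2 * of_real N * w))) * of_real ((8 * N) powr (a / 2) / (C * s)) * w powr of_real (a / 2 - 2) * G l"
    unfolding L by (simp only: mult_ac)
  also have "\<dots> = of_real (exp (- N) * ((8 * N) powr (a / 2) / (C * s))) * saddle_fun N t"
    unfolding E saddle_fun_def w_def[symmetric] s_def[symmetric] l_def[symmetric] of_real_mult by (simp only: mult_ac)
  finally show ?thesis by (simp add: s_def)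
qed

lemma saddle_fun_measurable: "N > 0 \<Longrightarrow> saddle_fun N \<in> borel_measurable borel"
proof (rule borel_measurable_continuous_onI)
  assume N: "N > 0"
  have saddle_root: "continuous_on UNIV (saddle_root N)"
    unfolding saddle_root_def by (intro continuous_intros continuous_on_compose2[OF continuous_on_csqrt]) (use N in \<open>auto simp: complex_nonpos_Reals_iff\<close>)
  have nz: "saddle_root N t \<noteq> 0" for t using Re_saddle_root_pos[of N t] by auto
  show "continuous_on UNIV (saddle_fun N)"
    unfolding saddle_fun_def saddle_point_def
  proof (intro continuous_intros saddle_root continuous_on_compose2[OF continuous_on_G])
    show "UNIV \<subseteq> {t. 0 \<le> Re (saddle_root N t) \<or> Im (saddle_root N t) \<noteq> 0}"
      using Re_saddle_root_pos[of N] by (auto simp: less_imp_le)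
    show "(\<lambda>t. of_real (saddle_abscissa N) * (saddle_root N t)\<^sup>2) ` UNIV \<subseteq> {z. 0 < Re z}"
      using saddle_abscissa_pos[OF N] Re_saddle[OF N, unfolded saddle_point_def]
      by (auto simp only: image_subset_iff mem_Collect_eq)
  qed (use nz in auto)
qed

lemma norm_saddle_fun_le:
  assumes "N \<ge> 1" "norm (G (saddle_point N t)) \<le> 2"
  shows "norm (saddle_fun N t) \<le> 2 * majorant a t"
proof -
  have w: "Re (saddle_root N t) > 0" "norm (saddle_root N t) \<ge> 1" "norm (saddle_root N t) \<le> 1 + \<bar>t\<bar>"
    using Re_saddle_root_pos norm_saddle_root_ge_1 norm_saddle_root_le[OF assms(1)] by auto
  have "norm (saddle_root N t powr of_real (a / 2 - 2)) = norm (saddle_root N t) powr (a / 2 - 2)"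
    using w by (subst norm_powr_real_powr') auto
  \<comment> \<open>The base is at least 1, so the possibly negative exponent may be raised to
    \<open>a\<close>; only then is monotonicity in the base available.\<close>
  also have "\<dots> \<le> norm (saddle_root N t) powr a" using w a by (intro powr_mono) auto
  also have "\<dots> \<le> (1 + \<bar>t\<bar>) powr a" using w a by (intro powr_mono2) auto
  finally have "norm (saddle_fun N t) \<le> exp (- (t\<^sup>2 / ((2 + \<bar>t\<bar>) * (2 + sqrt \<bar>t\<bar>)))) * (1 + \<bar>t\<bar>) powr a * 2"
    unfolding saddle_fun_def norm_mult using assms
    by (intro mult_mono norm_exp_saddle_root_le) auto
  thus ?thesis by (simp add: majorant_def mult_ac)
qed

lemma eventually_G_saddle:
  assumes "\<delta> > 0"
  shows "eventually (\<lambda>N. \<forall>t. norm (G (saddle_point N t) - 1) < \<delta>) at_top"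
proof -
  from G_tendsto_1[OF assms] obtain R where R: "R > 0" "\<forall>l. Re l > R \<longrightarrow> norm (G l - 1) < \<delta>"
    by blast
  have "filterlim saddle_abscissa at_top at_top"
    unfolding saddle_abscissa_def using T by real_asymp
  hence "eventually (\<lambda>N. saddle_abscissa N > R) at_top"
    by (simp add: filterlim_at_top_dense)
  thus ?thesis using eventually_gt_at_top[of "0::real"]
  proof eventually_elim
    case (elim N)
    show ?case by (intro allI R(2)[rule_format]) (simp only: Re_saddle[OF elim(2)] elim(1))
  qed
qed

lemma eventually_norm_saddle_fun_le:
  "eventually (\<lambda>N. \<forall>t. norm (saddle_fun N t) \<le> 2 * majorant a t) at_top"
  using eventually_G_saddle[OF zero_less_one] eventually_ge_at_top[of "1::real"]
proof eventually_elim
  case (elim N)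
  have "norm (G (saddle_point N t)) \<le> 2" for t
    using elim(1) norm_triangle_sub[of "G (saddle_point N t)" 1]
    by (smt (verit) norm_one)
  thus ?case using elim(2) by (auto intro: norm_saddle_fun_le)
qed

lemma saddle_fun_tendsto: "((\<lambda>N. saddle_fun N t) \<longlongrightarrow> of_real (exp (- (t\<^sup>2 / 4)))) at_top"
proof -
  have "((\<lambda>N. G (saddle_point N t)) \<longlongrightarrow> 1) at_top"
    unfolding tendsto_iff dist_norm
  proof safe
    fix e :: real assume "e > 0"
    from eventually_G_saddle[OF this]
    show "eventually (\<lambda>N. norm (G (saddle_point N t) - 1) < e) at_top"
      by eventually_elim auto
  qed
  moreover have "((\<lambda>N. saddle_root N t powr of_real (a / 2 - 2)) \<longlongrightarrow> 1 powr of_real (a / 2 - 2)) at_top"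
    by (intro tendsto_powr_complex saddle_root_tendsto tendsto_const) (auto simp: complex_nonpos_Reals_iff)
  ultimately have "((\<lambda>N. saddle_fun N t) \<longlongrightarrow> of_real (exp (- (t\<^sup>2 / 4))) * 1 powr of_real (a / 2 - 2) * 1) at_top"
    unfolding saddle_fun_def by (intro tendsto_mult exp_saddle_root_tendsto)
  thus ?thesis by simp
qed

lemma integral_gaussian_quarter:
  "(\<integral>t. complex_of_real (exp (- (t\<^sup>2 / 4))) \<partial>lborel) = of_real (2 * sqrt pi)"
proof -
  have "(\<integral>t. exp (- (t\<^sup>2 / 4)) \<partial>lborel) = (\<integral>t. 2 * sqrt pi * normal_density 0 (sqrt 2) t \<partial>lborel)"
    by (intro Bochner_Integration.integral_cong) (auto simp: normal_density_def real_sqrt_mult)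
  also have "\<dots> = 2 * sqrt pi" by simp
  finally show ?thesis by simp
qed

lemma saddle_integral_tendsto:
  "((\<lambda>N. \<integral>t. saddle_fun N t \<partial>lborel) \<longlongrightarrow> of_real (2 * sqrt pi)) at_top"
proof -
  \<comment> \<open>Measurability of \<open>saddle_fun N\<close> is known for positive
    \<open>N\<close>, while dominated convergence asks for it at every \<open>N\<close>.\<close>
  define g where "g N = (if N > 0 then saddle_fun N else (\<lambda>_. 0))" for N
  have "((\<lambda>N. \<integral>t. g N t \<partial>lborel) \<longlongrightarrow> (\<integral>t. complex_of_real (exp (- (t\<^sup>2 / 4))) \<partial>lborel)) at_top"
  proof (rule integral_dominated_convergence_at_top[where w = "\<lambda>t. 2 * majorant a t"])
    show "eventually (\<lambda>N. AE t in lborel. norm (g N t) \<le> 2 * majorant a t) at_top"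
      using eventually_norm_saddle_fun_le eventually_gt_at_top[of "0::real"]
      by eventually_elim (auto simp: g_def)
    show "AE t in lborel. ((\<lambda>N. g N t) \<longlongrightarrow> complex_of_real (exp (- (t\<^sup>2 / 4)))) at_top"
    proof (rule AE_I2)
      fix t
      have "eventually (\<lambda>N. saddle_fun N t = g N t) at_top"
        using eventually_gt_at_top[of "0::real"] by eventually_elim (auto simp: g_def)
      thus "((\<lambda>N. g N t) \<longlongrightarrow> complex_of_real (exp (- (t\<^sup>2 / 4)))) at_top"
        by (rule Lim_transform_eventually[OF saddle_fun_tendsto])
    qed
  qed (use saddle_fun_measurable integrable_majorant[OF a] in \<open>auto simp: g_def\<close>)
  moreover have "eventually (\<lambda>N. (\<integral>t. g N t \<partial>lborel) = (\<integral>t. saddle_fun N t \<partial>lborel)) at_top"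
    using eventually_gt_at_top[of "0::real"] by eventually_elim (auto simp: g_def)
  ultimately show ?thesis unfolding integral_gaussian_quarter by (rule Lim_transform_eventually)
qed

text \<open>The substitution \<open>u = q * t\<close> with \<open>q = s / sqrt N\<close> cancels the
  abscissa \<open>s\<close> left by the division by \<open>l\<close>. What remains is
  \<open>N powr (a / 2)\<close> from \<open>kummer_arg\<close> over \<open>sqrt N\<close> from the
  width of the peak.\<close>

lemma F_eq_saddle:
  "eventually (\<lambda>N. complex_of_real (F (T\<^sup>2 / (8 * N))) =
     of_real (8 powr (a / 2) / (2 * pi * C) * N powr ((a - 1) / 2) * exp (- N)) *
       (\<integral>t. saddle_fun N t \<partial>lborel)) at_top"
  using eventually_norm_saddle_fun_le eventually_gt_at_top[of "0::real"]
proof eventually_elim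
  case (elim N)
  define s where "s = saddle_abscissa N"
  define q where "q = s / sqrt N"
  define \<epsilon> where "\<epsilon> = T\<^sup>2 / (8 * N)"
  define K where "K = exp (- N) * (8 * N) powr (a / 2) / (C * s)"
  define h where "h u = exp ((of_real s - \<i> * of_real u) * of_real \<epsilon>) * laplace F (of_real s - \<i> * of_real u)" for u :: real
  have N: "N > 0" by fact
  have s: "s > 0" using saddle_abscissa_pos[OF N] by (simp add: s_def)
  have q: "q > 0" using s N by (simp add: q_def)
  have l: "saddle_point N t = of_real s - \<i> * of_real (0 + q * t)" for t
    by (simp add: saddle_point_def s_def saddle_root_square q_def algebra_simps)
  have h: "h (0 + q * t) = of_real K * saddle_fun N t" for t
    using inversion_integrand_eq[OF N, of t]
    unfolding h_def K_def s_def[symmetric] \<epsilon>_def[symmetric] l by (simp only:)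
  have sint: "integrable lborel (saddle_fun N)"
    by (rule Bochner_Integration.integrable_bound[where f = "\<lambda>t. 2 * majorant a t"])
       (use elim saddle_fun_measurable[OF N] integrable_majorant[OF a] in \<open>auto intro: order_trans[OF _ abs_ge_self]\<close>)
  hence "integrable lborel (\<lambda>t. h (0 + q * t))" unfolding h by (rule integrable_mult_right)
  hence hint: "integrable lborel h"
    using lborel_integrable_real_affine_iff[of q h 0] q by simp
  have "complex_of_real (F \<epsilon>) = 1 / (2 * pi) * (\<integral>u. h u \<partial>lborel)"
    using F_inversion[OF s, of \<epsilon>] hint unfolding h_def by simp
  also have "(\<integral>u. h u \<partial>lborel) = q *\<^sub>R (\<integral>t. h (0 + q * t) \<partial>lborel)"
    using lborel_integral_real_affine[of q h 0] q by simp
  also have "\<dots> = of_real (q * K) * (\<integral>t. saddle_fun N t \<partial>lborel)"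
    unfolding h by (simp add: scaleR_conv_of_real)
  also have "q * K = 8 powr (a / 2) / C * N powr ((a - 1) / 2) * exp (- N)"
  proof -
    have "q * K = exp (- N) * (8 powr (a / 2) * N powr (a / 2)) / (C * sqrt N)"
      using s N C_pos by (simp add: q_def K_def powr_mult)
    also have "N powr (a / 2) = N powr ((a - 1) / 2) * sqrt N"
      using N by (simp add: powr_half_sqrt[symmetric] powr_add[symmetric] field_simps)
    finally show ?thesis using N C_pos by (simp add: field_simps)
  qed
  finally show ?case unfolding \<epsilon>_def by (simp add: field_simps)
qed

theorem small_ball_asymp:
  "\<exists>c>0. ((\<lambda>\<epsilon>. F \<epsilon> / (\<epsilon> powr ((1 - a) / 2) * exp (- (T\<^sup>2 / (8 * \<epsilon>))))) \<longlongrightarrow> c) (at_right 0)"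
proof -
  define K where "K = 8 powr (a / 2) / (2 * pi * C)"
  define c where "c = K * (T\<^sup>2 / 8) powr ((a - 1) / 2) * (2 * sqrt pi)"
  have K: "K > 0" using C_pos by (simp add: K_def)
  have c: "c > 0" using K T by (simp add: c_def)
  have lim: "filterlim (\<lambda>\<epsilon>. T\<^sup>2 / (8 * \<epsilon>)) at_top (at_right 0)"
    using T by real_asymp
  have "((\<lambda>N. K * Re (\<integral>t. saddle_fun N t \<partial>lborel)) \<longlongrightarrow> K * Re (of_real (2 * sqrt pi))) at_top"
    by (intro tendsto_intros saddle_integral_tendsto)
  moreover have "eventually (\<lambda>N. K * Re (\<integral>t. saddle_fun N t \<partial>lborel) = F (T\<^sup>2 / (8 * N)) / (N powr ((a - 1) / 2) * exp (- N))) at_top"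
    using F_eq_saddle eventually_gt_at_top[of "0::real"]
  proof eventually_elim
    case (elim N)
    have "F (T\<^sup>2 / (8 * N)) = (K * N powr ((a - 1) / 2) * exp (- N)) * Re (\<integral>t. saddle_fun N t \<partial>lborel)"
      using arg_cong[OF elim(1), of Re] unfolding K_def[symmetric] by simp
    thus ?case using elim(2) by (simp add: field_simps)
  qed
  ultimately have "((\<lambda>N. F (T\<^sup>2 / (8 * N)) / (N powr ((a - 1) / 2) * exp (- N))) \<longlongrightarrow> K * Re (of_real (2 * sqrt pi))) at_top"
    by (rule Lim_transform_eventually)
  from filterlim_compose[OF this lim]
  have "((\<lambda>\<epsilon>. F (T\<^sup>2 / (8 * (T\<^sup>2 / (8 * \<epsilon>)))) / ((T\<^sup>2 / (8 * \<epsilon>)) powr ((a - 1) / 2) * exp (- (T\<^sup>2 / (8 * \<epsilon>))))) \<longlongrightarrow> K * (2 * sqrt pi)) (at_right 0)"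
    by simp
  hence "((\<lambda>\<epsilon>. (T\<^sup>2 / 8) powr ((a - 1) / 2) * (F (T\<^sup>2 / (8 * (T\<^sup>2 / (8 * \<epsilon>)))) / ((T\<^sup>2 / (8 * \<epsilon>)) powr ((a - 1) / 2) * exp (- (T\<^sup>2 / (8 * \<epsilon>)))))) \<longlongrightarrow>
      (T\<^sup>2 / 8) powr ((a - 1) / 2) * (K * (2 * sqrt pi))) (at_right 0)"
    by (intro tendsto_mult tendsto_const)
  moreover have "eventually (\<lambda>\<epsilon>. (T\<^sup>2 / 8) powr ((a - 1) / 2) * (F (T\<^sup>2 / (8 * (T\<^sup>2 / (8 * \<epsilon>)))) / ((T\<^sup>2 / (8 * \<epsilon>)) powr ((a - 1) / 2) * exp (- (T\<^sup>2 / (8 * \<epsilon>)))))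
      = F \<epsilon> / (\<epsilon> powr ((1 - a) / 2) * exp (- (T\<^sup>2 / (8 * \<epsilon>))))) (at_right 0)"
    using eventually_at_right_less[of "0::real"]
  proof eventually_elim
    case (elim \<epsilon>)
    have 1: "T\<^sup>2 / (8 * (T\<^sup>2 / (8 * \<epsilon>))) = \<epsilon>" using elim T by simp
    have "(T\<^sup>2 / (8 * \<epsilon>)) powr ((a - 1) / 2) = (T\<^sup>2 / 8) powr ((a - 1) / 2) / \<epsilon> powr ((a - 1) / 2)"
      using powr_divide[of "T\<^sup>2 / 8" \<epsilon> "(a - 1) / 2"] elim by simp
    also have "\<epsilon> powr ((a - 1) / 2) = 1 / \<epsilon> powr ((1 - a) / 2)"
      using elim by (simp add: powr_minus_divide[symmetric] diff_divide_distrib)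
    finally have 2: "(T\<^sup>2 / (8 * \<epsilon>)) powr ((a - 1) / 2) = (T\<^sup>2 / 8) powr ((a - 1) / 2) * \<epsilon> powr ((1 - a) / 2)"
      by simp
    show ?case unfolding 1 2 using T by (simp add: field_simps)
  qed
  ultimately have "((\<lambda>\<epsilon>. F \<epsilon> / (\<epsilon> powr ((1 - a) / 2) * exp (- (T\<^sup>2 / (8 * \<epsilon>))))) \<longlongrightarrow>
      (T\<^sup>2 / 8) powr ((a - 1) / 2) * (K * (2 * sqrt pi))) (at_right 0)"
    by (rule Lim_transform_eventually)
  thus ?thesis using c unfolding c_def by (intro exI[of _ c]) (simp add: c_def mult_ac)
qed

end

subsection \<open>Wiener integrals over the half-line\<close>

text \<open>A telescoping sum restricted to the cells inside \<open>{a<..b}\<close>. Stopping at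
  \<open>l\<close> and truncating both end points with \<open>min\<close> gives a form that supports
  induction.\<close>

lemma sum_increments_truncated:
  fixes G :: "real \<Rightarrow> real"
  assumes mono: "\<And>i. i < m \<Longrightarrow> p i \<le> p (Suc i)"
    and a: "a \<in> p ` {..m}" and b: "b \<in> p ` {..m}" and ab: "a \<le> b" and l: "l \<le> m"
  shows "(\<Sum>i<l. indicator {a<..b} (p (Suc i)) * (G (p (Suc i)) - G (p i))) = G (min b (p l)) - G (min a (p l))"
  using l
proof (induction l)
  case 0
  have "p 0 \<le> p k" if "k \<le> m" for k
    using that
  proof (induction k)
    case (Suc k) thus ?case using mono[of k] by auto
  qed auto
  hence "p 0 \<le> a" "p 0 \<le> b" using a b by auto
  thus ?case by (simp add: min_absorb2)
next
  case (Suc l)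
  have mono': "p i \<le> p j" if "i \<le> j" "j \<le> m" for i j
    using that
  proof (induction j)
    case (Suc j) thus ?case using mono[of j] by (cases "i = Suc j") auto
  qed auto
  \<comment> \<open>No partition point lies strictly between \<open>p l\<close> and
    \<open>p (Suc l)\<close>, so neither \<open>a\<close> nor \<open>b\<close> cuts a cell.\<close>
  have gap: "x \<le> p l" if "x \<in> p ` {..m}" "x < p (Suc l)" for x
  proof -
    from that obtain k where k: "k \<le> m" "x = p k" by auto
    have "k \<le> l"
    proof (rule ccontr)
      assume "\<not> k \<le> l"
      hence "p (Suc l) \<le> p k" using k by (intro mono') auto
      thus False using that k by simp
    qed
    thus ?thesis using k Suc.prems by (auto intro: mono')
  qed
  have le: "p l \<le> p (Suc l)" using Suc.prems by (intro mono) auto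
  consider "p (Suc l) \<le> a" | "a < p (Suc l)" "p (Suc l) \<le> b" | "b < p (Suc l)" by linarith
  thus ?case
  proof cases
    case 1
    thus ?thesis using Suc le ab by (simp add: min_absorb2)
  next
    case 2
    hence "a \<le> p l" using gap a by auto
    thus ?thesis using Suc le ab 2 by (simp add: min_absorb1 min_absorb2)
  next
    case 3
    hence "b \<le> p l" "a \<le> p l" using gap a b ab by auto
    thus ?thesis using Suc le ab 3 by (simp add: min_absorb1)
  qed
qed

lemma sum_increments_interval:
  fixes G :: "real \<Rightarrow> real"
  assumes mono: "\<And>i. i < m \<Longrightarrow> p i \<le> p (Suc i)"
    and a: "a \<in> p ` {..m}" and b: "b \<in> p ` {..m}" and ab: "a \<le> b"
  shows "(\<Sum>i<m. indicator {a<..b} (p (Suc i)) * (G (p (Suc i)) - G (p i))) = G b - G a"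
proof -
  have "p k \<le> p m" if "k \<le> m" for k
    using that
  proof (induction rule: inc_induct)
    case (step n) thus ?case using mono[of n] by auto
  qed auto
  hence "a \<le> p m" "b \<le> p m" using a b by auto
  thus ?thesis using sum_increments_truncated[OF assms order_refl, of G] by (simp add: min_absorb1)
qed

text \<open>Cells are open on the left and closed on the right, so the coefficients on the finer
  partition are read off at right end points.\<close>

lemma step_integral_refine:
  assumes mono: "\<And>i. i < m \<Longrightarrow> p i \<le> p (Suc i)"
    and u: "\<And>i. i < n \<Longrightarrow> u i \<le> u (Suc i)" and sub: "u ` {..n} \<subseteq> p ` {..m}"
  shows "step_integral B m p (\<lambda>i. step_fun n u c (p (Suc i))) \<omega> = step_integral B n u c \<omega>"
proof -
  have "step_integral B m p (\<lambda>i. step_fun n u c (p (Suc i))) \<omega> =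
      (\<Sum>j<n. c j * (\<Sum>i<m. indicator {u j<..u (Suc j)} (p (Suc i)) * (B (p (Suc i)) \<omega> - B (p i) \<omega>)))"
    unfolding step_integral_def step_fun_def sum_distrib_left sum_distrib_right
    by (subst sum.swap) (simp add: mult_ac)
  also have "\<dots> = (\<Sum>j<n. c j * (B (u (Suc j)) \<omega> - B (u j) \<omega>))"
  proof (intro sum.cong refl arg_cong2[where f = "(*)"])
    fix j assume "j \<in> {..<n}"
    thus "(\<Sum>i<m. indicator {u j<..u (Suc j)} (p (Suc i)) * (B (p (Suc i)) \<omega> - B (p i) \<omega>)) = B (u (Suc j)) \<omega> - B (u j) \<omega>"
      using sub u by (intro sum_increments_interval[where G = "\<lambda>x. B x \<omega>"] mono) auto
  qed
  finally show ?thesis by (simp add: step_integral_def)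
qed

text \<open>A step function is the step integral for the integrator that jumps from 0 to 1 at
  \<open>s\<close>; identities for arbitrary integrators therefore carry over to step
  functions.\<close>

lemma step_fun_eq_step_integral:
  assumes u: "\<And>i. i < n \<Longrightarrow> u i \<le> u (Suc i)"
  shows "step_fun n u c s = step_integral (\<lambda>x (_::unit). indicator {s..} x) n u c ()"
  unfolding step_fun_def step_integral_def
proof (intro sum.cong refl arg_cong2[where f = "(*)"])
  fix i assume "i \<in> {..<n}"
  thus "indicator {u i<..u (Suc i)} s = (indicator {s..} (u (Suc i)) - indicator {s..} (u i) :: real)"
    using u[of i] by (auto simp: indicator_def)
qed

lemma step_integral_linear:
  "step_integral B m p (\<lambda>i. x * d i + y * e i) \<omega> = x * step_integral B m p d \<omega> + y * step_integral B m p e \<omega>"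
  unfolding step_integral_def sum_distrib_left sum.distrib[symmetric]
  by (intro sum.cong) (auto simp: algebra_simps)

text \<open>Partitions start at a nonnegative time because the assumptions on \<open>B\<close>
  concern such times only.\<close>

definition step_data :: "nat \<Rightarrow> (nat \<Rightarrow> real) \<Rightarrow> bool" where
  "step_data n u \<longleftrightarrow> 0 \<le> u 0 \<and> (\<forall>i<n. u i \<le> u (Suc i))"

lemma step_data_nonneg: "step_data n u \<Longrightarrow> i \<le> n \<Longrightarrow> 0 \<le> u i"
  by (induction i) (auto simp: step_data_def intro: order_trans)

lemma step_linear_combination:
  fixes B :: "real \<Rightarrow> 'a \<Rightarrow> real"
  assumes u: "step_data n u" and u': "step_data n' u'"
  obtains m p d where "step_data m p"
    "\<And>s. step_fun m p d s = x * step_fun n u c s + y * step_fun n' u' c' s"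
    "\<And>\<omega>. step_integral B m p d \<omega> = x * step_integral B n u c \<omega> + y * step_integral B n' u' c' \<omega>"
proof -
  define P where "P = u ` {..n} \<union> u' ` {..n'}"
  define xs where "xs = sorted_list_of_set P"
  define p where "p i = xs ! i" for i
  define m where "m = length xs - 1"
  define d where "d i = x * step_fun n u c (p (Suc i)) + y * step_fun n' u' c' (p (Suc i))" for i
  have P: "finite P" "P \<noteq> {}" by (auto simp: P_def)
  hence xs: "set xs = P" "sorted xs" "xs \<noteq> []" by (auto simp: xs_def)
  hence len: "length xs = Suc m" by (cases xs) (auto simp: m_def)
  have mono: "p i \<le> p (Suc i)" if "i < m" for i
    unfolding p_def using that len xs(2) by (intro sorted_nth_mono) auto
  have im: "p ` {..m} = P"
    unfolding xs(1)[symmetric] by (auto simp: p_def set_conv_nth len less_Suc_eq_le)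
  have "p 0 \<in> P" using im by auto
  hence "0 \<le> p 0" using step_data_nonneg[OF u] step_data_nonneg[OF u'] by (auto simp: P_def)
  hence p: "step_data m p" using mono by (auto simp: step_data_def)
  \<comment> \<open>The integrator and its space are arbitrary here: the fact is used for the given
    \<open>B\<close> and, through indicators, for the step functions.\<close>
  have int: "step_integral B m p d \<omega> = x * step_integral B n u c \<omega> + y * step_integral B n' u' c' \<omega>"
    for B :: "real \<Rightarrow> 'b \<Rightarrow> real" and \<omega>
    unfolding d_def step_integral_linear
    using u u' by (subst (1 2) step_integral_refine) (auto simp: mono im P_def step_data_def)
  have "step_fun m p d s = x * step_fun n u c s + y * step_fun n' u' c' s" for s
    using u u' p by (subst (1 2 3) step_fun_eq_step_integral) (auto simp: int step_data_def)
  thus ?thesis by (rule that[OF p _ int])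
qed

lemma step_fun_measurable [measurable]: "step_fun n u c \<in> borel_measurable borel"
  unfolding step_fun_def by measurable

lemma indicator_disjoint_intervals:
  assumes u: "step_data n u" and ij: "i < n" "j < n" "i \<noteq> j"
  shows "indicator {u i<..u (Suc i)} s * indicator {u j<..u (Suc j)} s = (0 :: real)"
proof -
  have mono: "u k \<le> u l" if "k \<le> l" "l \<le> n" for k l
    using that u by (induction l) (auto simp: le_Suc_eq step_data_def intro: order_trans)
  consider "Suc i \<le> j" | "Suc j \<le> i" using ij by linarith
  thus ?thesis
  proof cases
    case 1
    with mono[of "Suc i" j] ij show ?thesis by (auto simp: indicator_def)
  next
    case 2
    with mono[of "Suc j" i] ij show ?thesis by (auto simp: indicator_def)
  qed
qed

lemma step_fun_square:
  assumes u: "step_data n u"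
  shows "(step_fun n u c s)\<^sup>2 = (\<Sum>i<n. (c i)\<^sup>2 * indicator {u i<..u (Suc i)} s)"
proof -
  have "(step_fun n u c s)\<^sup>2 = (\<Sum>i<n. \<Sum>j<n. (c i * indicator {u i<..u (Suc i)} s) * (c j * indicator {u j<..u (Suc j)} s))"
    by (simp only: step_fun_def power2_eq_square sum_product)
  also have "\<dots> = (\<Sum>i<n. \<Sum>j<n. if j = i then (c i)\<^sup>2 * indicator {u i<..u (Suc i)} s else 0)"
  proof (intro sum.cong refl)
    fix i j assume "i \<in> {..<n}" "j \<in> {..<n}"
    hence "indicator {u i<..u (Suc i)} s * indicator {u j<..u (Suc j)} s = (0::real)" if "i \<noteq> j"
      using that by (intro indicator_disjoint_intervals[OF u]) auto
    thus "(c i * indicator {u i<..u (Suc i)} s) * (c j * indicator {u j<..u (Suc j)} s)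
        = (if j = i then (c i)\<^sup>2 * indicator {u i<..u (Suc i)} s else 0)"
      by (auto simp: indicator_def power2_eq_square split: if_splits)
  qed
  also have "\<dots> = (\<Sum>i<n. (c i)\<^sup>2 * indicator {u i<..u (Suc i)} s)" by (simp add: sum.delta)
  finally show ?thesis .
qed

lemma step_fun_square_integral:
  assumes u: "step_data n u"
  shows "integrable lborel (\<lambda>s. (step_fun n u c s)\<^sup>2)"
    "(\<integral>s. (step_fun n u c s)\<^sup>2 \<partial>lborel) = (\<Sum>i<n. (c i)\<^sup>2 * (u (Suc i) - u i))"
proof -
  have int: "integrable lborel (\<lambda>s. (c i)\<^sup>2 * indicator {u i<..u (Suc i)} s)" for i
    by (cases "u i \<le> u (Suc i)") (auto intro!: integrable_mult_right integrable_real_indicator)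
  show "integrable lborel (\<lambda>s. (step_fun n u c s)\<^sup>2)"
    unfolding step_fun_square[OF u] by (intro Bochner_Integration.integrable_sum int)
  have "(\<integral>s. (step_fun n u c s)\<^sup>2 \<partial>lborel) = (\<Sum>i<n. \<integral>s. (c i)\<^sup>2 * indicator {u i<..u (Suc i)} s \<partial>lborel)"
    unfolding step_fun_square[OF u] by (intro Bochner_Integration.integral_sum int)
  also have "\<dots> = (\<Sum>i<n. (c i)\<^sup>2 * (u (Suc i) - u i))"
    using u by (intro sum.cong) (auto simp: step_data_def)
  finally show "(\<integral>s. (step_fun n u c s)\<^sup>2 \<partial>lborel) = (\<Sum>i<n. (c i)\<^sup>2 * (u (Suc i) - u i))" .
qed

lemma nn_integral_square_combination_le:
  fixes f g :: "'b \<Rightarrow> real"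
  assumes [measurable]: "f \<in> borel_measurable N" "g \<in> borel_measurable N"
  shows "(\<integral>\<^sup>+s. ennreal ((x * f s + y * g s)\<^sup>2) \<partial>N) \<le>
    ennreal (2 * x\<^sup>2) * (\<integral>\<^sup>+s. ennreal ((f s)\<^sup>2) \<partial>N) + ennreal (2 * y\<^sup>2) * (\<integral>\<^sup>+s. ennreal ((g s)\<^sup>2) \<partial>N)"
proof -
  have "(\<integral>\<^sup>+s. ennreal ((x * f s + y * g s)\<^sup>2) \<partial>N) \<le>
     (\<integral>\<^sup>+s. ennreal (2 * x\<^sup>2) * ennreal ((f s)\<^sup>2) + ennreal (2 * y\<^sup>2) * ennreal ((g s)\<^sup>2) \<partial>N)"
  proof (rule nn_integral_mono)
    fix s
    have "0 \<le> (x * f s - y * g s)\<^sup>2" by simp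
    hence "(x * f s + y * g s)\<^sup>2 \<le> 2 * x\<^sup>2 * (f s)\<^sup>2 + 2 * y\<^sup>2 * (g s)\<^sup>2"
      by (simp add: power2_eq_square algebra_simps)
    thus "ennreal ((x * f s + y * g s)\<^sup>2) \<le> ennreal (2 * x\<^sup>2) * ennreal ((f s)\<^sup>2) + ennreal (2 * y\<^sup>2) * ennreal ((g s)\<^sup>2)"
      by (simp flip: ennreal_mult ennreal_plus)
  qed
  also have "\<dots> = ennreal (2 * x\<^sup>2) * (\<integral>\<^sup>+s. ennreal ((f s)\<^sup>2) \<partial>N) + ennreal (2 * y\<^sup>2) * (\<integral>\<^sup>+s. ennreal ((g s)\<^sup>2) \<partial>N)"
    by (simp add: nn_integral_add nn_integral_cmult)
  finally show ?thesis .
qed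

lemma tendsto_nn_integral_square_combination:
  fixes f g :: "nat \<Rightarrow> 'b \<Rightarrow> real"
  assumes "\<And>k. f k \<in> borel_measurable N" "\<And>k. g k \<in> borel_measurable N"
    and "(\<lambda>k. \<integral>\<^sup>+s. ennreal ((f k s)\<^sup>2) \<partial>N) \<longlonglongrightarrow> 0" "(\<lambda>k. \<integral>\<^sup>+s. ennreal ((g k s)\<^sup>2) \<partial>N) \<longlonglongrightarrow> 0"
  shows "(\<lambda>k. \<integral>\<^sup>+s. ennreal ((x * f k s + y * g k s)\<^sup>2) \<partial>N) \<longlonglongrightarrow> 0"
proof (rule tendsto_sandwich[where f = "\<lambda>_. 0"])
  have "(\<lambda>k. ennreal (2 * x\<^sup>2) * (\<integral>\<^sup>+s. ennreal ((f k s)\<^sup>2) \<partial>N) + ennreal (2 * y\<^sup>2) * (\<integral>\<^sup>+s. ennreal ((g k s)\<^sup>2) \<partial>N))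
      \<longlonglongrightarrow> ennreal (2 * x\<^sup>2) * 0 + ennreal (2 * y\<^sup>2) * 0"
    by (intro tendsto_add ennreal_tendsto_cmult assms) auto
  thus "(\<lambda>k. ennreal (2 * x\<^sup>2) * (\<integral>\<^sup>+s. ennreal ((f k s)\<^sup>2) \<partial>N) + ennreal (2 * y\<^sup>2) * (\<integral>\<^sup>+s. ennreal ((g k s)\<^sup>2) \<partial>N)) \<longlonglongrightarrow> 0"
    by simp
  show "eventually (\<lambda>k. (\<integral>\<^sup>+s. ennreal ((x * f k s + y * g k s)\<^sup>2) \<partial>N) \<le>
     ennreal (2 * x\<^sup>2) * (\<integral>\<^sup>+s. ennreal ((f k s)\<^sup>2) \<partial>N) + ennreal (2 * y\<^sup>2) * (\<integral>\<^sup>+s. ennreal ((g k s)\<^sup>2) \<partial>N)) sequentially"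
    by (intro always_eventually allI nn_integral_square_combination_le assms)
qed auto

section \<open>Linear combinations of Wiener integrals\<close>

context wiener_process
begin

lemma step_integral_measurable:
  assumes "step_data n u"
  shows "step_integral B n u c \<in> borel_measurable M"
  unfolding step_integral_def using assms
  by (intro borel_measurable_sum borel_measurable_times borel_measurable_const borel_measurable_diff measurable)
     (auto intro: step_data_nonneg)

text \<open>The Wiener integral over the half-line, which makes linear combinations across different times possible.\<close>

definition wiener_integral_of :: "(real \<Rightarrow> real) \<Rightarrow> ('a \<Rightarrow> real) \<Rightarrow> bool" where
  "wiener_integral_of f Y \<longleftrightarrow> f \<in> borel_measurable borel \<and> Y \<in> borel_measurable M \<and>
     (\<exists>n u c. (\<forall>k. step_data (n k) (u k)) \<and>
        (\<lambda>k. \<integral>\<^sup>+s. ennreal ((f s - step_fun (n k) (u k) (c k) s)\<^sup>2) \<partial>lborel) \<longlonglongrightarrow> 0 \<and>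
        (\<lambda>k. \<integral>\<^sup>+\<omega>. ennreal ((Y \<omega> - step_integral B (n k) (u k) (c k) \<omega>)\<^sup>2) \<partial>M) \<longlonglongrightarrow> 0)"

lemma wiener_integral_of_measurable:
  assumes "wiener_integral_of f Y"
  shows "f \<in> borel_measurable borel" "Y \<in> borel_measurable M"
  using assms by (auto simp: wiener_integral_of_def)

lemma wiener_integral_of_combination:
  assumes f: "wiener_integral_of f Y" and g: "wiener_integral_of g Z"
  shows "wiener_integral_of (\<lambda>s. x * f s + y * g s) (\<lambda>\<omega>. x * Y \<omega> + y * Z \<omega>)"
proof -
  note [measurable] = wiener_integral_of_measurable[OF f] wiener_integral_of_measurable[OF g]
  from f obtain n u c where 1: "\<And>k. step_data (n k) (u k)"
        "(\<lambda>k. \<integral>\<^sup>+s. ennreal ((f s - step_fun (n k) (u k) (c k) s)\<^sup>2) \<partial>lborel) \<longlonglongrightarrow> 0"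
        "(\<lambda>k. \<integral>\<^sup>+\<omega>. ennreal ((Y \<omega> - step_integral B (n k) (u k) (c k) \<omega>)\<^sup>2) \<partial>M) \<longlonglongrightarrow> 0"
    unfolding wiener_integral_of_def by blast
  from g obtain n' u' c' where 2: "\<And>k. step_data (n' k) (u' k)"
        "(\<lambda>k. \<integral>\<^sup>+s. ennreal ((g s - step_fun (n' k) (u' k) (c' k) s)\<^sup>2) \<partial>lborel) \<longlonglongrightarrow> 0"
        "(\<lambda>k. \<integral>\<^sup>+\<omega>. ennreal ((Z \<omega> - step_integral B (n' k) (u' k) (c' k) \<omega>)\<^sup>2) \<partial>M) \<longlonglongrightarrow> 0"
    unfolding wiener_integral_of_def by blast
  have "\<exists>m p d. step_data m p \<and>
     (\<forall>s. step_fun m p d s = x * step_fun (n k) (u k) (c k) s + y * step_fun (n' k) (u' k) (c' k) s) \<and>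
     (\<forall>\<omega>. step_integral B m p d \<omega> = x * step_integral B (n k) (u k) (c k) \<omega> + y * step_integral B (n' k) (u' k) (c' k) \<omega>)" for k
    by (rule step_linear_combination[OF 1(1) 2(1), where x = x and y = y and c = "c k" and c' = "c' k" and B = B]) blast
  then obtain m p d where 3: "\<And>k. step_data (m k) (p k)"
     "\<And>k s. step_fun (m k) (p k) (d k) s = x * step_fun (n k) (u k) (c k) s + y * step_fun (n' k) (u' k) (c' k) s"
     "\<And>k \<omega>. step_integral B (m k) (p k) (d k) \<omega> = x * step_integral B (n k) (u k) (c k) \<omega> + y * step_integral B (n' k) (u' k) (c' k) \<omega>"
    by metis
  note [measurable] = step_integral_measurable[OF 1(1)] step_integral_measurable[OF 2(1)]
  have "(\<lambda>k. \<integral>\<^sup>+s. ennreal ((x * (f s - step_fun (n k) (u k) (c k) s) + y * (g s - step_fun (n' k) (u' k) (c' k) s))\<^sup>2) \<partial>lborel) \<longlonglongrightarrow> 0"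
    by (rule tendsto_nn_integral_square_combination[OF _ _ 1(2) 2(2)]) measurable
  moreover have "(\<lambda>k. \<integral>\<^sup>+\<omega>. ennreal ((x * (Y \<omega> - step_integral B (n k) (u k) (c k) \<omega>) + y * (Z \<omega> - step_integral B (n' k) (u' k) (c' k) \<omega>))\<^sup>2) \<partial>M) \<longlonglongrightarrow> 0"
    by (rule tendsto_nn_integral_square_combination[OF _ _ 1(3) 2(3)]) measurable
  ultimately show ?thesis
    unfolding wiener_integral_of_def
    by (intro conjI exI[of _ m] exI[of _ p] exI[of _ d] allI 3(1)) (simp_all add: 3(2,3) algebra_simps)
qed

text \<open>The approximating step functions already vanish outside \<open>{0..t}\<close>, so
  extending the integrand by zero leaves all errors unchanged.\<close>

lemma has_wiener_integral_imp_wiener_integral_of: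
  assumes "has_wiener_integral M B f 0 t Y"
  shows "wiener_integral_of (\<lambda>s. indicator {0..t} s * f s) Y"
proof -
  from assms obtain n u c where 1: "\<And>k. u k 0 = 0" "\<And>k. u k (n k) = t" "\<And>k i. i < n k \<Longrightarrow> u k i \<le> u k (Suc i)"
    "(\<lambda>k. \<integral>\<^sup>+s\<in>{0..t}. ennreal ((f s - step_fun (n k) (u k) (c k) s)\<^sup>2) \<partial>lborel) \<longlonglongrightarrow> 0"
    "(\<lambda>k. \<integral>\<^sup>+\<omega>. ennreal ((Y \<omega> - step_integral B (n k) (u k) (c k) \<omega>)\<^sup>2) \<partial>M) \<longlonglongrightarrow> 0"
    unfolding has_wiener_integral_def by blast
  have sd: "step_data (n k) (u k)" for k using 1 by (auto simp: step_data_def)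
  have zero: "step_fun (n k) (u k) (c k) s = 0" if "s \<notin> {0..t}" for k s
  proof -
    have "s \<notin> {u k i<..u k (Suc i)}" if i: "i < n k" for i
    proof -
      have "u k i \<ge> 0" using step_data_nonneg[OF sd] i by auto
      moreover have "u k (Suc i) \<le> u k (n k)" using Suc_leI[OF i]
      proof (induction rule: inc_induct)
        case (step m) thus ?case using 1(3)[of m k] by auto
      qed auto
      ultimately show ?thesis using \<open>s \<notin> {0..t}\<close> 1(2)[of k] by auto
    qed
    thus ?thesis unfolding step_fun_def by (intro sum.neutral) (auto simp: indicator_def)
  qed
  have "(\<integral>\<^sup>+s. ennreal ((indicator {0..t} s * f s - step_fun (n k) (u k) (c k) s)\<^sup>2) \<partial>lborel)
     = (\<integral>\<^sup>+s\<in>{0..t}. ennreal ((f s - step_fun (n k) (u k) (c k) s)\<^sup>2) \<partial>lborel)" for k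
    by (intro nn_integral_cong) (auto simp: indicator_def zero)
  moreover have "(\<lambda>s. indicator {0..t} s * f s) \<in> borel_measurable borel"
    using assms by (simp add: has_wiener_integral_def set_borel_measurable_def)
  ultimately show ?thesis
    using assms sd 1(4,5) unfolding wiener_integral_of_def has_wiener_integral_def
    by (intro conjI exI[of _ n] exI[of _ u] exI[of _ c]) auto
qed

end

subsection \<open>Gaussian factors and orthogonal Wiener integrals\<close>

lemma (in prob_space) char_centered_normal:
  assumes X: "distributed M lborel X (normal_density 0 \<sigma>)" and \<sigma>: "\<sigma> > 0"
  shows "(CLINT \<omega>|M. iexp (\<theta> * X \<omega>)) = of_real (exp (- (\<theta> * \<sigma>)\<^sup>2 / 2))"
proof -
  have 1: "distributed M lborel (\<lambda>\<omega>. (X \<omega> - 0) / \<sigma>) std_normal_density"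
    using X normal_standard_normal_convert[OF \<sigma>, of X 0] by simp
  have [measurable]: "X \<in> borel_measurable M" using distributed_measurable[OF X] by simp
  have "(CLINT \<omega>|M. iexp (\<theta> * X \<omega>)) = (CLINT \<omega>|M. iexp (\<theta> * \<sigma> * (X \<omega> / \<sigma>)))"
    using \<sigma> by simp
  also have "\<dots> = (CLINT x|distr M lborel (\<lambda>\<omega>. X \<omega> / \<sigma>). iexp (\<theta> * \<sigma> * x))"
    by (subst integral_distr) auto
  also have "distr M lborel (\<lambda>\<omega>. X \<omega> / \<sigma>) = std_normal_distribution"
    using distributed_distr_eq_density[OF 1] by simp
  also have "(CLINT x|std_normal_distribution. iexp (\<theta> * \<sigma> * x)) = of_real (exp (- (\<theta> * \<sigma>)\<^sup>2 / 2))"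
    using fun_cong[OF char_std_normal_distribution, of "\<theta> * \<sigma>"] by (simp add: char_def)
  finally show ?thesis .
qed

text \<open>The map \<open>iexp\<close> is 1-Lipschitz, and
  \<open>\<bar>d\<bar> \<le> e / 4 + d\<^sup>2 / e\<close> controls the first moment by the second
  without Cauchy-Schwarz.\<close>

lemma (in prob_space) tendsto_char_L2:
  assumes [measurable]: "Y \<in> borel_measurable M" "\<And>k. I k \<in> borel_measurable M"
    and lim: "(\<lambda>k. \<integral>\<^sup>+\<omega>. ennreal ((Y \<omega> - I k \<omega>)\<^sup>2) \<partial>M) \<longlonglongrightarrow> 0"
  shows "(\<lambda>k. CLINT \<omega>|M. iexp (I k \<omega>)) \<longlonglongrightarrow> (CLINT \<omega>|M. iexp (Y \<omega>))"
proof (rule tendstoI)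
  fix e :: real assume e: "e > 0"
  have "eventually (\<lambda>k. (\<integral>\<^sup>+\<omega>. ennreal ((Y \<omega> - I k \<omega>)\<^sup>2) \<partial>M) < ennreal (e\<^sup>2 / 2)) sequentially"
    using e by (intro order_tendstoD(2)[OF lim]) simp
  thus "eventually (\<lambda>k. dist (CLINT \<omega>|M. iexp (I k \<omega>)) (CLINT \<omega>|M. iexp (Y \<omega>)) < e) sequentially"
  proof eventually_elim
    case (elim k)
    have int: "integrable M (\<lambda>\<omega>. (Y \<omega> - I k \<omega>)\<^sup>2)"
      using elim by (intro integrableI_nonneg) (auto intro: less_trans)
    have "ennreal (\<integral>\<omega>. (Y \<omega> - I k \<omega>)\<^sup>2 \<partial>M) < ennreal (e\<^sup>2 / 2)"
      using elim nn_integral_eq_integral[OF int] by simp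
    hence small: "(\<integral>\<omega>. (Y \<omega> - I k \<omega>)\<^sup>2 \<partial>M) < e\<^sup>2 / 2"
      by (simp add: ennreal_less_iff)
    have "norm ((CLINT \<omega>|M. iexp (I k \<omega>)) - (CLINT \<omega>|M. iexp (Y \<omega>))) = norm (CLINT \<omega>|M. iexp (I k \<omega>) - iexp (Y \<omega>))"
      by (subst Bochner_Integration.integral_diff) (auto intro!: integrable_iexp)
    also have "\<dots> \<le> (\<integral>\<omega>. norm (iexp (I k \<omega>) - iexp (Y \<omega>)) \<partial>M)" by (rule integral_norm_bound)
    also have "\<dots> \<le> (\<integral>\<omega>. e / 4 + (Y \<omega> - I k \<omega>)\<^sup>2 / e \<partial>M)"
    proof (rule integral_mono)
      show "integrable M (\<lambda>\<omega>. norm (iexp (I k \<omega>) - iexp (Y \<omega>)))"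
        by (intro integrable_norm Bochner_Integration.integrable_diff integrable_iexp) auto
      show "integrable M (\<lambda>\<omega>. e / 4 + (Y \<omega> - I k \<omega>)\<^sup>2 / e)" using int by auto
      fix \<omega>
      define d where "d = I k \<omega> - Y \<omega>"
      have "iexp (I k \<omega>) - iexp (Y \<omega>) = iexp (Y \<omega>) * (iexp d - 1)"
        by (simp add: d_def algebra_simps flip: exp_add)
      hence "norm (iexp (I k \<omega>) - iexp (Y \<omega>)) = norm (iexp d - 1)" by (simp add: norm_mult)
      also have "\<dots> \<le> \<bar>d\<bar>" using iexp_approx1[of d 0] by simp
      also have "\<bar>d\<bar> \<le> e / 4 + d\<^sup>2 / e"
      proof -
        have "0 \<le> (\<bar>d\<bar> - e / 2)\<^sup>2 / e" using e by simp
        also have "\<dots> = d\<^sup>2 / e - \<bar>d\<bar> + e / 4" using e by (simp add: field_simps power2_eq_square)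
        finally show ?thesis by simp
      qed
      finally show "norm (iexp (I k \<omega>) - iexp (Y \<omega>)) \<le> e / 4 + (Y \<omega> - I k \<omega>)\<^sup>2 / e"
        by (simp add: d_def power2_commute)
    qed
    also have "\<dots> = e / 4 + (\<integral>\<omega>. (Y \<omega> - I k \<omega>)\<^sup>2 \<partial>M) / e"
      using int by (simp add: prob_space)
    also have "\<dots> < e / 4 + (e\<^sup>2 / 2) / e"
      using small e by (intro add_strict_left_mono divide_strict_right_mono) auto
    also have "\<dots> < e" using e by (simp add: power2_eq_square)
    finally show ?case by (simp add: dist_norm)
  qed
qed

text \<open>With \<open>d = \<phi> k s - f s\<close>, the difference of the squares is at most
  \<open>(1 + 1 / \<eta>) * d\<^sup>2 + \<eta> * (f s)\<^sup>2\<close>; \<eta> is fixed first and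
  \<open>k\<close> taken large afterwards.\<close>

lemma L2_norm_limit:
  fixes f :: "'b \<Rightarrow> real"
  assumes [measurable]: "f \<in> borel_measurable N"
    and ph: "\<And>k. \<phi> k \<in> borel_measurable N" "\<And>k. integrable N (\<lambda>s. (\<phi> k s)\<^sup>2)"
    and lim: "(\<lambda>k. \<integral>\<^sup>+s. ennreal ((f s - \<phi> k s)\<^sup>2) \<partial>N) \<longlonglongrightarrow> 0"
  shows "integrable N (\<lambda>s. (f s)\<^sup>2)" "(\<lambda>k. \<integral>s. (\<phi> k s)\<^sup>2 \<partial>N) \<longlonglongrightarrow> (\<integral>s. (f s)\<^sup>2 \<partial>N)"
proof -
  note [measurable] = ph(1)
  have dint: "integrable N (\<lambda>s. (f s - \<phi> k s)\<^sup>2)"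
    if "(\<integral>\<^sup>+s. ennreal ((f s - \<phi> k s)\<^sup>2) \<partial>N) < ennreal x" for k x
    using that by (intro integrableI_nonneg) (auto intro: less_trans)
  have "eventually (\<lambda>k. (\<integral>\<^sup>+s. ennreal ((f s - \<phi> k s)\<^sup>2) \<partial>N) < ennreal 1) sequentially"
    by (intro order_tendstoD(2)[OF lim]) simp
  then obtain k where "(\<integral>\<^sup>+s. ennreal ((f s - \<phi> k s)\<^sup>2) \<partial>N) < ennreal 1"
    by (auto simp: eventually_sequentially)
  from dint[OF this] have k: "integrable N (\<lambda>s. (f s - \<phi> k s)\<^sup>2)" .
  show fint: "integrable N (\<lambda>s. (f s)\<^sup>2)"
  proof (rule Bochner_Integration.integrable_bound)
    show "integrable N (\<lambda>s. 2 * (f s - \<phi> k s)\<^sup>2 + 2 * (\<phi> k s)\<^sup>2)" using k ph(2)[of k] by auto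
    show "AE s in N. norm ((f s)\<^sup>2) \<le> norm (2 * (f s - \<phi> k s)\<^sup>2 + 2 * (\<phi> k s)\<^sup>2)"
    proof (rule AE_I2)
      fix s
      have "0 \<le> (f s - 2 * \<phi> k s)\<^sup>2" by simp
      thus "norm ((f s)\<^sup>2) \<le> norm (2 * (f s - \<phi> k s)\<^sup>2 + 2 * (\<phi> k s)\<^sup>2)"
        by (simp add: power2_eq_square algebra_simps)
    qed
  qed measurable
  define A where "A = (\<integral>s. (f s)\<^sup>2 \<partial>N)"
  have A: "A \<ge> 0" by (simp add: A_def)
  show "(\<lambda>k. \<integral>s. (\<phi> k s)\<^sup>2 \<partial>N) \<longlonglongrightarrow> (\<integral>s. (f s)\<^sup>2 \<partial>N)"
  proof (rule tendstoI)
    fix e :: real assume e: "e > 0"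
    \<comment> \<open>\<eta> makes the term with \<open>f\<close> at most \<open>e / 2\<close>, then
      \<open>x\<close> makes the other one less than \<open>e / 2\<close>. The summand 1 avoids a
      division by zero when \<open>A = 0\<close>.\<close>
    define \<eta> where "\<eta> = e / 2 / (A + 1)"
    have \<eta>: "\<eta> > 0" using e A by (simp add: \<eta>_def)
    define x where "x = (e / 2) / (1 + 1 / \<eta>)"
    have x: "x > 0" using e \<eta> by (simp add: x_def add_pos_pos)
    have "eventually (\<lambda>k. (\<integral>\<^sup>+s. ennreal ((f s - \<phi> k s)\<^sup>2) \<partial>N) < ennreal x) sequentially"
      using x by (intro order_tendstoD(2)[OF lim]) simp
    thus "eventually (\<lambda>k. dist (\<integral>s. (\<phi> k s)\<^sup>2 \<partial>N) (\<integral>s. (f s)\<^sup>2 \<partial>N) < e) sequentially"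
    proof eventually_elim
      case (elim k)
      have int: "integrable N (\<lambda>s. (f s - \<phi> k s)\<^sup>2)" using elim by (rule dint)
      have "ennreal (\<integral>s. (f s - \<phi> k s)\<^sup>2 \<partial>N) < ennreal x"
        using elim nn_integral_eq_integral[OF int] by simp
      hence small: "(\<integral>s. (f s - \<phi> k s)\<^sup>2 \<partial>N) < x"
        by (simp add: ennreal_less_iff)
      have "\<bar>(\<integral>s. (\<phi> k s)\<^sup>2 \<partial>N) - (\<integral>s. (f s)\<^sup>2 \<partial>N)\<bar> = \<bar>\<integral>s. (\<phi> k s)\<^sup>2 - (f s)\<^sup>2 \<partial>N\<bar>"
        using ph(2)[of k] fint by (subst Bochner_Integration.integral_diff) auto
      also have "\<dots> \<le> (\<integral>s. \<bar>(\<phi> k s)\<^sup>2 - (f s)\<^sup>2\<bar> \<partial>N)" by (rule integral_abs_bound)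
      also have "\<dots> \<le> (\<integral>s. (1 + 1 / \<eta>) * (f s - \<phi> k s)\<^sup>2 + \<eta> * (f s)\<^sup>2 \<partial>N)"
      proof (rule integral_mono)
        fix s
        define d where "d = \<phi> k s - f s"
        have "\<bar>2 * f s * d\<bar> \<le> \<eta> * (f s)\<^sup>2 + d\<^sup>2 / \<eta>"
        proof -
          have "0 \<le> (\<eta> * \<bar>f s\<bar> - \<bar>d\<bar>)\<^sup>2 / \<eta>" using \<eta> by simp
          also have "\<dots> = \<eta> * (f s)\<^sup>2 + d\<^sup>2 / \<eta> - 2 * \<bar>f s\<bar> * \<bar>d\<bar>"
            using \<eta> by (simp add: field_simps power2_eq_square)
          finally show ?thesis by (simp add: abs_mult)
        qed
        moreover have "(\<phi> k s)\<^sup>2 - (f s)\<^sup>2 = d\<^sup>2 + 2 * f s * d"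
          by (simp add: d_def power2_eq_square algebra_simps)
        moreover have "\<bar>d\<^sup>2 + 2 * f s * d\<bar> \<le> d\<^sup>2 + \<bar>2 * f s * d\<bar>"
          by (rule order_trans[OF abs_triangle_ineq]) simp
        ultimately have "\<bar>(\<phi> k s)\<^sup>2 - (f s)\<^sup>2\<bar> \<le> d\<^sup>2 + (\<eta> * (f s)\<^sup>2 + d\<^sup>2 / \<eta>)" by linarith
        also have "\<dots> = (1 + 1 / \<eta>) * d\<^sup>2 + \<eta> * (f s)\<^sup>2" by (simp add: algebra_simps)
        also have "d\<^sup>2 = (f s - \<phi> k s)\<^sup>2" by (simp add: d_def power2_commute)
        finally show "\<bar>(\<phi> k s)\<^sup>2 - (f s)\<^sup>2\<bar> \<le> (1 + 1 / \<eta>) * (f s - \<phi> k s)\<^sup>2 + \<eta> * (f s)\<^sup>2" .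
      qed (use ph(2)[of k] fint int in auto)
      also have "\<dots> = (1 + 1 / \<eta>) * (\<integral>s. (f s - \<phi> k s)\<^sup>2 \<partial>N) + \<eta> * A"
        using int fint unfolding A_def
        by (subst Bochner_Integration.integral_add) (auto simp del: integral_mult_right_zero simp: integral_mult_right_zero)
      also have "\<dots> < (1 + 1 / \<eta>) * x + \<eta> * A"
        using small \<eta> by (intro add_strict_right_mono mult_strict_left_mono) (auto intro: add_pos_pos)
      also have "(1 + 1 / \<eta>) * x = e / 2"
      proof -
        have "1 + 1 / \<eta> > 0" using \<eta> by (simp add: add_pos_pos)
        thus ?thesis unfolding x_def
          by (metis less_irrefl nonzero_mult_div_cancel_left times_divide_eq_right)
      qed
      also have "\<eta> * A \<le> e / 2"
      proof -
        have "\<eta> * A \<le> \<eta> * (A + 1)" using \<eta> by simp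
        also have "\<dots> = e / 2"
          using A unfolding \<eta>_def by (intro nonzero_eq_divide_eq[THEN iffD1]) auto
        finally show ?thesis .
      qed
      finally show ?case by (simp add: dist_real_def)
    qed
  qed
qed

text \<open>The damping turns the standard normal density into that of variance
  \<open>1 / (1 + v)\<close>, up to the factor \<open>1 / sqrt (1 + v)\<close>; what remains is a
  normal characteristic function.\<close>

lemma gaussian_fourier_integral:
  assumes v: "v \<ge> 0"
  shows "(CLINT \<theta>|std_normal_distribution. of_real (exp (- v * \<theta>\<^sup>2 / 2)) * iexp (m * \<theta>))
    = of_real (exp (- m\<^sup>2 / (2 * (1 + v))) / sqrt (1 + v))"
proof -
  define s where "s = 1 / sqrt (1 + v)"
  have s: "s > 0" using v by (simp add: s_def)
  have s2: "s\<^sup>2 = 1 / (1 + v)" using v by (simp add: s_def power_divide)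
  define h where "h \<theta> = std_normal_density \<theta> *\<^sub>R (of_real (exp (- v * \<theta>\<^sup>2 / 2)) * iexp (m * \<theta>))" for \<theta>
  have "(CLINT \<theta>|std_normal_distribution. of_real (exp (- v * \<theta>\<^sup>2 / 2)) * iexp (m * \<theta>)) = (CLINT \<theta>|lborel. h \<theta>)"
    unfolding h_def by (subst integral_density) auto
  also have "\<dots> = s *\<^sub>R (CLINT x|lborel. h (0 + s * x))"
    using lborel_integral_real_affine[of s h 0] s by simp
  also have "(\<lambda>x. h (0 + s * x)) = (\<lambda>x. std_normal_density x *\<^sub>R iexp (m * s * x))"
  proof
    fix x
    have "- (s * x)\<^sup>2 / 2 + - v * (s * x)\<^sup>2 / 2 = - ((1 + v) * s\<^sup>2) * x\<^sup>2 / 2"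
      by (simp add: power_mult_distrib algebra_simps)
    also have "(1 + v) * s\<^sup>2 = 1" using v by (simp add: s2)
    finally have "exp (- (s * x)\<^sup>2 / 2) * exp (- v * (s * x)\<^sup>2 / 2) = exp (- x\<^sup>2 / 2)"
      by (simp flip: exp_add)
    hence "std_normal_density (s * x) * exp (- v * (s * x)\<^sup>2 / 2) = std_normal_density x"
      by (simp add: std_normal_density_def mult.assoc)
    thus "h (0 + s * x) = std_normal_density x *\<^sub>R iexp (m * s * x)"
      by (simp add: h_def scaleR_conv_of_real mult_ac flip: of_real_mult)
  qed
  also have "(CLINT x|lborel. std_normal_density x *\<^sub>R iexp (m * s * x)) = char std_normal_distribution (m * s)"
    unfolding char_def by (subst integral_density) auto
  also have "\<dots> = of_real (exp (- (m * s)\<^sup>2 / 2))" by (simp add: char_std_normal_distribution)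
  also have "- (m * s)\<^sup>2 / 2 = - m\<^sup>2 / (2 * (1 + v))" by (simp add: power_mult_distrib s2)
  finally show ?thesis by (simp add: s_def scaleR_conv_of_real)
qed

lemma (in prob_space) gaussian_mixture:
  fixes \<Phi> :: "'a \<Rightarrow> complex"
  assumes [measurable]: "\<Phi> \<in> borel_measurable M" "Z \<in> borel_measurable M"
    and bound: "\<And>\<omega>. norm (\<Phi> \<omega>) \<le> 1"
    and p: "p \<in> borel_measurable borel" "\<And>\<theta>. norm (p \<theta>) \<le> 1"
  shows "(CLINT \<theta>|std_normal_distribution. p \<theta> * (CLINT \<omega>|M. \<Phi> \<omega> * iexp (\<kappa> * \<theta> * Z \<omega>)))
     = (CLINT \<omega>|M. \<Phi> \<omega> * (CLINT \<theta>|std_normal_distribution. p \<theta> * iexp (\<kappa> * Z \<omega> * \<theta>)))"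
proof -
  note [measurable] = p(1)
  interpret N: prob_space std_normal_distribution
    using real_dist_normal_dist by (simp add: real_distribution_def)
  interpret P: pair_prob_space M std_normal_distribution ..
  have "integrable (M \<Otimes>\<^sub>M std_normal_distribution) (\<lambda>(\<omega>, \<theta>). p \<theta> * (\<Phi> \<omega> * iexp (\<kappa> * \<theta> * Z \<omega>)))"
  proof (rule P.integrable_const_bound[of _ 1])
    show "AE x in M \<Otimes>\<^sub>M std_normal_distribution. norm (case x of (\<omega>, \<theta>) \<Rightarrow> p \<theta> * (\<Phi> \<omega> * iexp (\<kappa> * \<theta> * Z \<omega>))) \<le> 1"
      using bound p(2)
      by (intro AE_I2) (auto simp: norm_mult norm_exp_eq_Re split: prod.splits intro!: mult_le_one)
  qed measurable
  from P.Fubini_integral[OF this]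
  have "(CLINT \<theta>|std_normal_distribution. CLINT \<omega>|M. p \<theta> * (\<Phi> \<omega> * iexp (\<kappa> * \<theta> * Z \<omega>)))
      = (CLINT \<omega>|M. CLINT \<theta>|std_normal_distribution. p \<theta> * (\<Phi> \<omega> * iexp (\<kappa> * \<theta> * Z \<omega>)))" .
  also have "\<dots> = (CLINT \<omega>|M. CLINT \<theta>|std_normal_distribution. \<Phi> \<omega> * (p \<theta> * iexp (\<kappa> * Z \<omega> * \<theta>)))"
    by (simp add: mult_ac)
  finally show ?thesis by simp
qed

text \<open>The Hubbard-Stratonovich device: \<open>exp (- c * z\<^sup>2)\<close> is the standard
  normal characteristic function at \<open>sqrt (2 * c) * z\<close>, and Fubini exchanges the
  integrals.\<close>

lemma (in prob_space) gaussian_mixture_square: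
  fixes \<Phi> :: "'a \<Rightarrow> complex"
  assumes "\<Phi> \<in> borel_measurable M" "Z \<in> borel_measurable M" "\<And>\<omega>. norm (\<Phi> \<omega>) \<le> 1" "c \<ge> 0"
  shows "(CLINT \<omega>|M. \<Phi> \<omega> * of_real (exp (- c * (Z \<omega>)\<^sup>2)))
     = (CLINT \<theta>|std_normal_distribution. CLINT \<omega>|M. \<Phi> \<omega> * iexp (sqrt (2 * c) * \<theta> * Z \<omega>))"
proof -
  have "(CLINT \<theta>|std_normal_distribution. iexp (sqrt (2 * c) * Z \<omega> * \<theta>)) = of_real (exp (- c * (Z \<omega>)\<^sup>2))" for \<omega>
    using fun_cong[OF char_std_normal_distribution, of "sqrt (2 * c) * Z \<omega>"] assms(4)
    by (simp add: char_def power_mult_distrib)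
  thus ?thesis
    using gaussian_mixture[OF assms(1,2,3), of "\<lambda>_. 1" "sqrt (2 * c)"] by simp
qed

section \<open>Characteristic functions and Gaussian functionals of Wiener integrals\<close>

context wiener_process
begin

lemma increment_measurable:
  "0 \<le> s \<Longrightarrow> 0 \<le> t \<Longrightarrow> (\<lambda>\<omega>. B t \<omega> - B s \<omega>) \<in> borel_measurable M"
  by (intro borel_measurable_diff measurable)

lemma increment_char:
  assumes "0 \<le> s" "s \<le> t"
  shows "(CLINT \<omega>|M. iexp (\<theta> * (B t \<omega> - B s \<omega>))) = of_real (exp (- (\<theta>\<^sup>2 * (t - s)) / 2))"
proof (cases "s = t")
  case True
  thus ?thesis by (simp add: prob_space)
next
  case False
  thus ?thesis
    using char_centered_normal[OF normal_increments[of s t], of \<theta>] assms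
    by (simp add: power_mult_distrib)
qed

lemma step_integral_char:
  assumes u: "step_data n u"
  shows "(CLINT \<omega>|M. iexp (step_integral B n u c \<omega>)) = of_real (exp (- (\<integral>s. (step_fun n u c s)\<^sup>2 \<partial>lborel) / 2))"
proof -
  define X where "X i \<omega> = c i * (B (u (Suc i)) \<omega> - B (u i) \<omega>)" for i \<omega>
  have nn: "0 \<le> u i" if "i \<le> n" for i using step_data_nonneg[OF u that] .
  have Xm: "X i \<in> borel_measurable M" if "i < n" for i
    unfolding X_def using that by (intro borel_measurable_times borel_measurable_const increment_measurable nn) auto
  have "indep_vars (\<lambda>_. borel) X {..<n}"
    unfolding X_def using u
    by (intro indep_vars_compose2[OF indep_increments]) (auto simp: step_data_def)
  from char_distr_sum[OF this, of 1]
  have "(CLINT \<omega>|M. iexp (\<Sum>i<n. X i \<omega>)) = (\<Prod>i<n. CLINT \<omega>|M. iexp (X i \<omega>))"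
    using Xm by (simp add: char_def integral_distr)
  also have "\<dots> = (\<Prod>i<n. of_real (exp (- ((c i)\<^sup>2 * (u (Suc i) - u i)) / 2)))"
    unfolding X_def using u nn
    by (intro prod.cong refl increment_char) (auto simp: step_data_def)
  also have "\<dots> = of_real (exp (\<Sum>i<n. - ((c i)\<^sup>2 * (u (Suc i) - u i)) / 2))"
    by (simp add: exp_sum flip: of_real_prod)
  also have "(\<Sum>i<n. - ((c i)\<^sup>2 * (u (Suc i) - u i)) / 2) = - (\<integral>s. (step_fun n u c s)\<^sup>2 \<partial>lborel) / 2"
    by (simp add: step_fun_square_integral[OF u] sum_negf sum_divide_distrib)
  finally show ?thesis by (simp add: step_integral_def X_def)
qed

lemma wiener_integral_char:
  assumes "wiener_integral_of f Y"
  shows "integrable lborel (\<lambda>s. (f s)\<^sup>2)"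
    "(CLINT \<omega>|M. iexp (Y \<omega>)) = of_real (exp (- (\<integral>s. (f s)\<^sup>2 \<partial>lborel) / 2))"
proof -
  note m = wiener_integral_of_measurable[OF assms]
  from assms obtain n u c where 1: "\<And>k. step_data (n k) (u k)"
        "(\<lambda>k. \<integral>\<^sup>+s. ennreal ((f s - step_fun (n k) (u k) (c k) s)\<^sup>2) \<partial>lborel) \<longlonglongrightarrow> 0"
        "(\<lambda>k. \<integral>\<^sup>+\<omega>. ennreal ((Y \<omega> - step_integral B (n k) (u k) (c k) \<omega>)\<^sup>2) \<partial>M) \<longlonglongrightarrow> 0"
    unfolding wiener_integral_of_def by blast
  have L2: "integrable lborel (\<lambda>s. (f s)\<^sup>2)"
    "(\<lambda>k. \<integral>s. (step_fun (n k) (u k) (c k) s)\<^sup>2 \<partial>lborel) \<longlonglongrightarrow> (\<integral>s. (f s)\<^sup>2 \<partial>lborel)"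
    by (rule L2_norm_limit[OF _ _ _ 1(2)]; use m step_fun_square_integral(1)[OF 1(1)] in simp)+
  show "integrable lborel (\<lambda>s. (f s)\<^sup>2)" by fact
  have "(\<lambda>k. CLINT \<omega>|M. iexp (step_integral B (n k) (u k) (c k) \<omega>)) \<longlonglongrightarrow> (CLINT \<omega>|M. iexp (Y \<omega>))"
    by (rule tendsto_char_L2[OF _ _ 1(3)]) (use m step_integral_measurable[OF 1(1)] in auto)
  moreover have "(\<lambda>k. CLINT \<omega>|M. iexp (step_integral B (n k) (u k) (c k) \<omega>)) \<longlonglongrightarrow>
      of_real (exp (- (\<integral>s. (f s)\<^sup>2 \<partial>lborel) / 2))"
    unfolding step_integral_char[OF 1(1)] by (intro tendsto_intros L2) auto
  ultimately show "(CLINT \<omega>|M. iexp (Y \<omega>)) = of_real (exp (- (\<integral>s. (f s)\<^sup>2 \<partial>lborel) / 2))"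
    by (rule LIMSEQ_unique)
qed

text \<open>
  Gaussian factors \<open>exp (- c * Y\<^sup>2)\<close> are mixtures of characters, so independence is only needed at the
  level of characteristic functions.
\<close>

lemma wiener_integral_orthogonal:
  fixes k :: nat
  assumes D: "wiener_integral_of g D"
    and Y: "\<And>j. j < k \<Longrightarrow> wiener_integral_of (f j) (Y j)" "\<And>j s. j < k \<Longrightarrow> f j s * g s = 0" "\<And>j. j < k \<Longrightarrow> c j \<ge> 0"
    and L: "wiener_integral_of l L" "\<And>s. l s * g s = 0"
  shows "(CLINT \<omega>|M. of_real (exp (- (\<Sum>j<k. c j * (Y j \<omega>)\<^sup>2))) * iexp (L \<omega> + \<eta> * D \<omega>))
    = of_real (exp (- \<eta>\<^sup>2 * (\<integral>s. (g s)\<^sup>2 \<partial>lborel) / 2)) *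
      (CLINT \<omega>|M. of_real (exp (- (\<Sum>j<k. c j * (Y j \<omega>)\<^sup>2))) * iexp (L \<omega>))"
  using Y L
\<comment> \<open>Writing the last Gaussian factor as a mixture adds a multiple of
  \<open>Y k\<close> to \<open>L\<close>. The new integrand still has zero product with
  \<open>g\<close>, hence the generalisation over \<open>l\<close> and \<open>L\<close>.\<close>
proof (induction k arbitrary: l L)
  case 0
  have "wiener_integral_of (\<lambda>s. 1 * l s + \<eta> * g s) (\<lambda>\<omega>. 1 * L \<omega> + \<eta> * D \<omega>)"
    by (rule wiener_integral_of_combination[OF 0(4) D])
  from wiener_integral_char(2)[OF this]
  have "(CLINT \<omega>|M. iexp (L \<omega> + \<eta> * D \<omega>)) = of_real (exp (- (\<integral>s. (l s + \<eta> * g s)\<^sup>2 \<partial>lborel) / 2))"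
    by simp
  also have "(\<lambda>s. (l s + \<eta> * g s)\<^sup>2) = (\<lambda>s. (l s)\<^sup>2 + \<eta>\<^sup>2 * (g s)\<^sup>2)"
    using 0(5) by (auto simp: power2_eq_square algebra_simps fun_eq_iff)
  also have "(\<integral>s. (l s)\<^sup>2 + \<eta>\<^sup>2 * (g s)\<^sup>2 \<partial>lborel) = (\<integral>s. (l s)\<^sup>2 \<partial>lborel) + \<eta>\<^sup>2 * (\<integral>s. (g s)\<^sup>2 \<partial>lborel)"
    using wiener_integral_char(1)[OF 0(4)] wiener_integral_char(1)[OF D] by simp
  also have "exp (- ((\<integral>s. (l s)\<^sup>2 \<partial>lborel) + \<eta>\<^sup>2 * (\<integral>s. (g s)\<^sup>2 \<partial>lborel)) / 2) =
      exp (- \<eta>\<^sup>2 * (\<integral>s. (g s)\<^sup>2 \<partial>lborel) / 2) * exp (- (\<integral>s. (l s)\<^sup>2 \<partial>lborel) / 2)"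
    by (simp add: field_simps flip: exp_add)
  finally show ?case using wiener_integral_char(2)[OF 0(4)] by simp
next
  case (Suc k)
  note [measurable] = wiener_integral_of_measurable(2)[OF Suc.prems(1)] wiener_integral_of_measurable(2)[OF D]
     wiener_integral_of_measurable(2)[OF Suc.prems(4)]
  have Ym: "Y j \<in> borel_measurable M" if "j < Suc k" for j
    using that by measurable
  define \<Psi> where "\<Psi> \<omega> = exp (- (\<Sum>j<k. c j * (Y j \<omega>)\<^sup>2))" for \<omega>
  have \<Psi>m [measurable]: "\<Psi> \<in> borel_measurable M"
  proof -
    have [measurable]: "(\<lambda>\<omega>. \<Sum>j<k. c j * (Y j \<omega>)\<^sup>2) \<in> borel_measurable M"
      using Ym by (intro borel_measurable_sum borel_measurable_times borel_measurable_const borel_measurable_power) auto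
    show ?thesis unfolding \<Psi>_def by measurable
  qed
  have \<Psi>1: "0 \<le> \<Psi> \<omega>" "\<Psi> \<omega> \<le> 1" for \<omega>
    using Suc.prems(3) by (auto simp: \<Psi>_def intro!: sum_nonneg)
  have split: "of_real (exp (- (\<Sum>j<Suc k. c j * (Y j \<omega>)\<^sup>2))) = of_real (\<Psi> \<omega>) * complex_of_real (exp (- c k * (Y k \<omega>)\<^sup>2))" for \<omega>
    by (simp add: \<Psi>_def flip: of_real_mult exp_add)
  have mix: "(CLINT \<omega>|M. of_real (exp (- (\<Sum>j<Suc k. c j * (Y j \<omega>)\<^sup>2))) * iexp (X \<omega>)) =
    (CLINT \<theta>|std_normal_distribution. CLINT \<omega>|M. of_real (\<Psi> \<omega>) * iexp (sqrt (2 * c k) * \<theta> * Y k \<omega> + X \<omega>))"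
    if [measurable]: "X \<in> borel_measurable M" for X
  proof -
    have "(CLINT \<omega>|M. (of_real (\<Psi> \<omega>) * iexp (X \<omega>)) * of_real (exp (- c k * (Y k \<omega>)\<^sup>2))) =
      (CLINT \<theta>|std_normal_distribution. CLINT \<omega>|M. (of_real (\<Psi> \<omega>) * iexp (X \<omega>)) * iexp (sqrt (2 * c k) * \<theta> * Y k \<omega>))"
      by (rule gaussian_mixture_square) (use \<Psi>1 Suc.prems(3)[of k] Ym[of k] in \<open>auto simp: norm_mult\<close>)
    thus ?thesis unfolding split by (simp add: mult_ac exp_add distrib_left)
  qed
  have IH: "(CLINT \<omega>|M. of_real (\<Psi> \<omega>) * iexp (x * Y k \<omega> + (L \<omega> + \<eta> * D \<omega>))) =
     of_real (exp (- \<eta>\<^sup>2 * (\<integral>s. (g s)\<^sup>2 \<partial>lborel) / 2)) * (CLINT \<omega>|M. of_real (\<Psi> \<omega>) * iexp (x * Y k \<omega> + L \<omega>))" for x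
  proof -
    have "wiener_integral_of (\<lambda>s. x * f k s + 1 * l s) (\<lambda>\<omega>. x * Y k \<omega> + 1 * L \<omega>)"
      by (rule wiener_integral_of_combination[OF Suc.prems(1) Suc.prems(4)]) simp
    moreover have "(x * f k s + 1 * l s) * g s = 0" for s
      using Suc.prems(2)[of k s] Suc.prems(5)[of s] by (auto simp: algebra_simps)
    ultimately have "(CLINT \<omega>|M. of_real (\<Psi> \<omega>) * iexp ((x * Y k \<omega> + 1 * L \<omega>) + \<eta> * D \<omega>)) =
       of_real (exp (- \<eta>\<^sup>2 * (\<integral>s. (g s)\<^sup>2 \<partial>lborel) / 2)) * (CLINT \<omega>|M. of_real (\<Psi> \<omega>) * iexp (x * Y k \<omega> + 1 * L \<omega>))"
      unfolding \<Psi>_def using Suc.prems(1,2,3) by (intro Suc.IH) auto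
    thus ?thesis by (simp add: add.assoc)
  qed
  have m: "(\<lambda>\<omega>. L \<omega> + \<eta> * D \<omega>) \<in> borel_measurable M" by measurable
  show ?case
    by (simp only: mix[OF m] mix[OF wiener_integral_of_measurable(2)[OF Suc.prems(4)]] IH integral_mult_right_zero)
qed

text \<open>\<open>D\<close> acts as an independent centred normal variable of variance
  \<open>v\<close>. After the square is opened as a mixture over \<theta>, orthogonality turns
  \<open>D\<close> into the damping
  \<open>exp (- (\<kappa>\<^sup>2 * v) * \<theta>\<^sup>2 / 2)\<close>; evaluating the mixture with
  this damping shrinks \<open>b\<close> to \<open>b / (1 + 2 * b * v)\<close>.\<close>

lemma wiener_integral_gaussian_step:
  fixes k :: nat
  assumes D: "wiener_integral_of g D"
    and Y: "\<And>j. j < k \<Longrightarrow> wiener_integral_of (f j) (Y j)" "\<And>j s. j < k \<Longrightarrow> f j s * g s = 0" "\<And>j. j < k \<Longrightarrow> c j \<ge> 0"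
    and Z: "wiener_integral_of l Z" "\<And>s. l s * g s = 0" and b: "b \<ge> 0"
  defines "v \<equiv> (\<integral>s. (g s)\<^sup>2 \<partial>lborel)"
  shows "(\<integral>\<omega>. exp (- (\<Sum>j<k. c j * (Y j \<omega>)\<^sup>2)) * exp (- b * (Z \<omega> + D \<omega>)\<^sup>2) \<partial>M)
    = (\<integral>\<omega>. exp (- (\<Sum>j<k. c j * (Y j \<omega>)\<^sup>2)) * exp (- (b / (1 + 2 * b * v)) * (Z \<omega>)\<^sup>2) \<partial>M) / sqrt (1 + 2 * b * v)"
proof -
  note [measurable] = wiener_integral_of_measurable(2)[OF D] wiener_integral_of_measurable(2)[OF Z(1)]
  have v: "v \<ge> 0" by (simp add: v_def)
  define \<kappa> where "\<kappa> = sqrt (2 * b)"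
  have \<kappa>: "\<kappa>\<^sup>2 = 2 * b" using b by (simp add: \<kappa>_def)
  define \<Psi> where "\<Psi> \<omega> = exp (- (\<Sum>j<k. c j * (Y j \<omega>)\<^sup>2))" for \<omega>
  have \<Psi>m [measurable]: "\<Psi> \<in> borel_measurable M"
  proof -
    have [measurable]: "(\<lambda>\<omega>. \<Sum>j<k. c j * (Y j \<omega>)\<^sup>2) \<in> borel_measurable M"
      using wiener_integral_of_measurable(2)[OF Y(1)]
      by (intro borel_measurable_sum borel_measurable_times borel_measurable_const borel_measurable_power) auto
    show ?thesis unfolding \<Psi>_def by measurable
  qed
  have \<Psi>1: "0 \<le> \<Psi> \<omega>" "\<Psi> \<omega> \<le> 1" for \<omega>
    using Y(3) by (auto simp: \<Psi>_def intro!: sum_nonneg)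
  have "(CLINT \<omega>|M. of_real (\<Psi> \<omega>) * of_real (exp (- b * (Z \<omega> + D \<omega>)\<^sup>2))) =
     (CLINT \<theta>|std_normal_distribution. CLINT \<omega>|M. of_real (\<Psi> \<omega>) * iexp (\<kappa> * \<theta> * (Z \<omega> + D \<omega>)))"
    unfolding \<kappa>_def by (rule gaussian_mixture_square) (use \<Psi>1 b in auto)
  also have "\<dots> = (CLINT \<theta>|std_normal_distribution. of_real (exp (- (\<kappa>\<^sup>2 * v) * \<theta>\<^sup>2 / 2)) *
      (CLINT \<omega>|M. of_real (\<Psi> \<omega>) * iexp (\<kappa> * \<theta> * Z \<omega>)))"
  proof (intro Bochner_Integration.integral_cong refl)
    fix \<theta>
    have "wiener_integral_of (\<lambda>s. (\<kappa> * \<theta>) * l s + 0 * l s) (\<lambda>\<omega>. (\<kappa> * \<theta>) * Z \<omega> + 0 * Z \<omega>)"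
      by (rule wiener_integral_of_combination[OF Z(1) Z(1)])
    hence "wiener_integral_of (\<lambda>s. \<kappa> * \<theta> * l s) (\<lambda>\<omega>. \<kappa> * \<theta> * Z \<omega>)" by simp
    from wiener_integral_orthogonal[OF D Y this, where k = k and \<eta> = "\<kappa> * \<theta>"] Z(2)
    have "(CLINT \<omega>|M. of_real (\<Psi> \<omega>) * iexp (\<kappa> * \<theta> * Z \<omega> + \<kappa> * \<theta> * D \<omega>)) =
      of_real (exp (- (\<kappa> * \<theta>)\<^sup>2 * v / 2)) * (CLINT \<omega>|M. of_real (\<Psi> \<omega>) * iexp (\<kappa> * \<theta> * Z \<omega>))"
      by (simp add: \<Psi>_def v_def mult.assoc)
    thus "(CLINT \<omega>|M. of_real (\<Psi> \<omega>) * iexp (\<kappa> * \<theta> * (Z \<omega> + D \<omega>))) = of_real (exp (- (\<kappa>\<^sup>2 * v) * \<theta>\<^sup>2 / 2)) *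
      (CLINT \<omega>|M. of_real (\<Psi> \<omega>) * iexp (\<kappa> * \<theta> * Z \<omega>))"
      by (simp add: power_mult_distrib mult_ac distrib_left)
  qed
  also have "\<dots> = (CLINT \<omega>|M. of_real (\<Psi> \<omega>) * (CLINT \<theta>|std_normal_distribution. of_real (exp (- (\<kappa>\<^sup>2 * v) * \<theta>\<^sup>2 / 2)) * iexp (\<kappa> * Z \<omega> * \<theta>)))"
    by (rule gaussian_mixture) (use \<Psi>1 v in \<open>auto intro!: mult_nonneg_nonneg\<close>)
  also have "\<dots> = (CLINT \<omega>|M. of_real (\<Psi> \<omega> * exp (- (b / (1 + 2 * b * v)) * (Z \<omega>)\<^sup>2) / sqrt (1 + 2 * b * v)))"
  proof (intro Bochner_Integration.integral_cong refl)
    fix \<omega>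
    have "- (\<kappa> * Z \<omega>)\<^sup>2 / (2 * (1 + \<kappa>\<^sup>2 * v)) = - (b / (1 + 2 * b * v)) * (Z \<omega>)\<^sup>2"
    proof -
      have "1 + 2 * b * v > 0" using b v by (simp add: add_pos_nonneg)
      thus ?thesis by (simp add: power_mult_distrib \<kappa> divide_simps)
    qed
    thus "of_real (\<Psi> \<omega>) * (CLINT \<theta>|std_normal_distribution. of_real (exp (- (\<kappa>\<^sup>2 * v) * \<theta>\<^sup>2 / 2)) * iexp (\<kappa> * Z \<omega> * \<theta>)) =
      complex_of_real (\<Psi> \<omega> * exp (- (b / (1 + 2 * b * v)) * (Z \<omega>)\<^sup>2) / sqrt (1 + 2 * b * v))"
      using b v by (subst gaussian_fourier_integral) (simp_all add: \<kappa>)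
  qed
  finally have "complex_of_real (\<integral>\<omega>. \<Psi> \<omega> * exp (- b * (Z \<omega> + D \<omega>)\<^sup>2) \<partial>M) =
     complex_of_real (\<integral>\<omega>. \<Psi> \<omega> * exp (- (b / (1 + 2 * b * v)) * (Z \<omega>)\<^sup>2) / sqrt (1 + 2 * b * v) \<partial>M)"
    unfolding integral_complex_of_real[symmetric] by simp
  hence "(\<integral>\<omega>. \<Psi> \<omega> * exp (- b * (Z \<omega> + D \<omega>)\<^sup>2) \<partial>M) =
     (\<integral>\<omega>. \<Psi> \<omega> * exp (- (b / (1 + 2 * b * v)) * (Z \<omega>)\<^sup>2) / sqrt (1 + 2 * b * v) \<partial>M)"
    by (simp only: of_real_eq_iff)
  thus ?thesis by (simp add: \<Psi>_def)
qed

text \<open>Increments are integrated out from the last to the first. Assumption \<open>bc\<close>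
  is the discrete Riccati recursion: once the later increments are gone, the accumulated coefficient
  of \<open>(Z j \<omega>)\<^sup>2\<close> is \<open>b j\<close>.\<close>

lemma wiener_integral_gaussian_chain:
  fixes g :: "nat \<Rightarrow> real \<Rightarrow> real" and Z :: "nat \<Rightarrow> 'a \<Rightarrow> real"
  assumes Z: "\<And>j. j \<le> n \<Longrightarrow> wiener_integral_of (g j) (Z j)"
    and orth: "\<And>i j s. i \<le> j \<Longrightarrow> j < n \<Longrightarrow> g i s * (g (Suc j) s - g j s) = 0"
    and zero: "(\<integral>s. (g 0 s)\<^sup>2 \<partial>lborel) = 0"
    and b: "\<And>j. j \<le> n \<Longrightarrow> b j \<ge> 0" and c: "\<And>j. j < n \<Longrightarrow> c j \<ge> 0"
    and v: "\<And>j. j < n \<Longrightarrow> (\<integral>s. (g (Suc j) s - g j s)\<^sup>2 \<partial>lborel) = v j"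
    and bc: "\<And>j. j < n \<Longrightarrow> c j + b (Suc j) / (1 + 2 * b (Suc j) * v j) = b j"
  shows "(\<integral>\<omega>. exp (- (\<Sum>j<n. c j * (Z j \<omega>)\<^sup>2) - b n * (Z n \<omega>)\<^sup>2) \<partial>M) = (\<Prod>j<n. 1 / sqrt (1 + 2 * b (Suc j) * v j))"
  using assms
proof (induction n)
  case 0
  have zero0: "wiener_integral_of (\<lambda>s. 0) (\<lambda>\<omega>. 0)"
    using wiener_integral_of_combination[OF 0(1) 0(1), of 0 0 0 0] by simp
  \<comment> \<open>\<open>Z 0\<close> is treated as an increment of variance 0 on top of the zero
    variable, so the step lemma evaluates the start as well.\<close>
  have "(\<integral>\<omega>. exp (- (\<Sum>j<0. c j * (Z j \<omega>)\<^sup>2)) * exp (- b 0 * (0 + Z 0 \<omega>)\<^sup>2) \<partial>M)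
    = (\<integral>\<omega>. exp (- (\<Sum>j<0. c j * (Z j \<omega>)\<^sup>2)) * exp (- (b 0 / (1 + 2 * b 0 * (\<integral>s. (g 0 s)\<^sup>2 \<partial>lborel))) * 0\<^sup>2) \<partial>M) / sqrt (1 + 2 * b 0 * (\<integral>s. (g 0 s)\<^sup>2 \<partial>lborel))"
    using 0 zero0 by (intro wiener_integral_gaussian_step[where l = "\<lambda>_. 0" and Z = "\<lambda>_. 0"]) auto
  thus ?case using 0(3) by (simp add: prob_space)
next
  case (Suc n)
  have D: "wiener_integral_of (\<lambda>s. 1 * g (Suc n) s + (-1) * g n s) (\<lambda>\<omega>. 1 * Z (Suc n) \<omega> + (-1) * Z n \<omega>)"
    by (intro wiener_integral_of_combination Suc.prems(1)) auto
  hence D: "wiener_integral_of (\<lambda>s. g (Suc n) s - g n s) (\<lambda>\<omega>. Z (Suc n) \<omega> - Z n \<omega>)" by simp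
  have "(\<integral>\<omega>. exp (- (\<Sum>j<Suc n. c j * (Z j \<omega>)\<^sup>2) - b (Suc n) * (Z (Suc n) \<omega>)\<^sup>2) \<partial>M) =
    (\<integral>\<omega>. exp (- (\<Sum>j<Suc n. c j * (Z j \<omega>)\<^sup>2)) * exp (- b (Suc n) * (Z n \<omega> + (Z (Suc n) \<omega> - Z n \<omega>))\<^sup>2) \<partial>M)"
    by (simp flip: exp_add)
  also have "\<dots> = (\<integral>\<omega>. exp (- (\<Sum>j<Suc n. c j * (Z j \<omega>)\<^sup>2)) * exp (- (b (Suc n) / (1 + 2 * b (Suc n) * (\<integral>s. (g (Suc n) s - g n s)\<^sup>2 \<partial>lborel))) * (Z n \<omega>)\<^sup>2) \<partial>M) /
      sqrt (1 + 2 * b (Suc n) * (\<integral>s. (g (Suc n) s - g n s)\<^sup>2 \<partial>lborel))"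
    using Suc.prems by (intro wiener_integral_gaussian_step[OF D, where f = g and l = "g n"]) auto
  also have "(\<integral>s. (g (Suc n) s - g n s)\<^sup>2 \<partial>lborel) = v n" by (intro Suc.prems) auto
  also have "(\<lambda>\<omega>. exp (- (\<Sum>j<Suc n. c j * (Z j \<omega>)\<^sup>2)) * exp (- (b (Suc n) / (1 + 2 * b (Suc n) * v n)) * (Z n \<omega>)\<^sup>2))
     = (\<lambda>\<omega>. exp (- (\<Sum>j<n. c j * (Z j \<omega>)\<^sup>2) - b n * (Z n \<omega>)\<^sup>2))"
  proof
    fix \<omega>
    have "b n = c n + b (Suc n) / (1 + 2 * b (Suc n) * v n)" using Suc.prems(7)[of n] by simp
    thus "exp (- (\<Sum>j<Suc n. c j * (Z j \<omega>)\<^sup>2)) * exp (- (b (Suc n) / (1 + 2 * b (Suc n) * v n)) * (Z n \<omega>)\<^sup>2)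
      = exp (- (\<Sum>j<n. c j * (Z j \<omega>)\<^sup>2) - b n * (Z n \<omega>)\<^sup>2)"
      by (simp add: algebra_simps flip: exp_add)
  qed
  also have "(\<integral>\<omega>. exp (- (\<Sum>j<n. c j * (Z j \<omega>)\<^sup>2) - b n * (Z n \<omega>)\<^sup>2) \<partial>M) = (\<Prod>j<n. 1 / sqrt (1 + 2 * b (Suc j) * v j))"
    using Suc.prems by (intro Suc.IH) auto
  finally show ?case by simp
qed

end

subsection \<open>The Riccati equation of the bridge\<close>

text \<open>The difference is \<open>exp (x / 2)\<close> times a positive first moment. The
  logarithmic derivative of \<open>kummer\<close> is thus bounded uniformly in
  \<open>x\<close>.\<close>

lemma kummer'_le:
  assumes "a > 0"
  shows "kummer' a x \<le> kummer a x / 2"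
proof -
  have "beta_moment a 1 x > 0"
    using beta_weight_integral_pos[OF assms, of "\<lambda>u. exp (- x * u) * u"] integrable_beta_weight[OF assms, of x 1]
    by (simp add: beta_moment_def mult.assoc)
  hence "exp (x / 2) * (beta_moment a 0 x / 2 - beta_moment a 1 x) \<le> exp (x / 2) * (beta_moment a 0 x / 2)"
    by (intro mult_left_mono) auto
  thus ?thesis by (simp add: kummer'_def kummer_def)
qed

locale bridge_ode =
  fixes \<alpha> T lam :: real
  assumes \<alpha>: "\<alpha> > 0" and T: "T > 0" and lam: "lam > 0"
begin

text \<open>At this scale the factor 1/4 in \<open>kummer_ODE\<close> becomes
  \<open>2 * lam\<close>.\<close>

definition \<kappa> :: real where "\<kappa> = sqrt (8 * lam)"

definition W :: "real \<Rightarrow> real" where "W t = (T - t) powr (2 * \<alpha>)"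

definition Y :: "real \<Rightarrow> real" where "Y t = kummer \<alpha> (\<kappa> * (T - t))"

definition P :: "real \<Rightarrow> real" where "P t = W t * (\<kappa> * kummer' \<alpha> (\<kappa> * (T - t)))"

text \<open>The variance function of the rescaled bridge, up to an additive constant. Starting at -1
  makes \<open>q\<close> differentiable at 0 from both sides; only increments of \<open>q\<close>
  matter.\<close>

definition q :: "real \<Rightarrow> real" where "q t = integral {-1..t} (\<lambda>s. (T - s) powr (- 2 * \<alpha>))"

text \<open>Solves the Riccati equation \<open>\<beta>' = 2 * \<beta>\<^sup>2 / W - lam * W\<close>,
  the continuous limit of the recursion. The quotient linearises it: \<open>Y' = - P / W\<close> and
  \<open>P' = - 2 * lam * W * Y\<close>.\<close>

definition \<beta> :: "real \<Rightarrow> real" where "\<beta> t = P t / (2 * Y t)"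

lemma \<kappa>: "\<kappa> > 0" "\<kappa>\<^sup>2 = 8 * lam"
  using lam by (simp_all add: \<kappa>_def)

lemma W_pos: "t < T \<Longrightarrow> W t > 0"
  by (simp add: W_def)

lemma W_antimono: "s \<le> t \<Longrightarrow> t < T \<Longrightarrow> W t \<le> W s"
  using \<alpha> unfolding W_def by (intro powr_mono2) auto

lemma inverse_W: "t < T \<Longrightarrow> (T - t) powr (- 2 * \<alpha>) = 1 / W t"
  by (simp add: W_def powr_minus_divide[symmetric])

lemma Y_pos: "Y t > 0"
  unfolding Y_def by (rule kummer_pos[OF \<alpha>])

lemma P_pos: "t < T \<Longrightarrow> P t > 0"
  using W_pos \<kappa> kummer'_pos[OF \<alpha>] by (simp add: P_def)

lemma \<beta>_pos: "t < T \<Longrightarrow> \<beta> t > 0"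
  using P_pos Y_pos by (simp add: \<beta>_def)

lemma P_over_W_le: "t < T \<Longrightarrow> P t / W t \<le> \<kappa> / 2 * Y t"
  using kummer'_le[OF \<alpha>, of "\<kappa> * (T - t)"] \<kappa> W_pos[of t] by (simp add: P_def Y_def)

lemma Y_deriv: "t < T \<Longrightarrow> (Y has_real_derivative - P t / W t) (at t)"
proof -
  assume t: "t < T"
  have "((\<lambda>t. kummer \<alpha> (\<kappa> * (T - t))) has_real_derivative kummer' \<alpha> (\<kappa> * (T - t)) * (\<kappa> * (0 - 1))) (at t)"
    by (rule DERIV_chain2[OF kummer_has_derivative[OF \<alpha>]]) (auto intro!: derivative_eq_intros)
  thus ?thesis using W_pos[OF t] by (simp add: Y_def[abs_def] P_def mult.commute)
qed

lemma P_deriv: "t < T \<Longrightarrow> (P has_real_derivative - 2 * lam * W t * Y t) (at t)"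
proof -
  assume t: "t < T"
  define f where "f x = x powr (2 * \<alpha>) * kummer' \<alpha> x" for x
  \<comment> \<open>The power of \<kappa> turns the weight
    \<open>(\<kappa> * (T - s)) powr (2 * \<alpha>)\<close> of \<open>kummer_ODE\<close> into
    \<open>W s\<close> and leaves the factor \<kappa> of the chain rule.\<close>
  have eq: "P s = \<kappa> powr (1 - 2 * \<alpha>) * f (\<kappa> * (T - s))" if "s \<in> {..<T}" for s
  proof -
    have "(\<kappa> * (T - s)) powr (2 * \<alpha>) = \<kappa> powr (2 * \<alpha>) * W s"
      using that \<kappa> by (simp add: powr_mult W_def)
    moreover have "\<kappa> powr (1 - 2 * \<alpha>) * \<kappa> powr (2 * \<alpha>) = \<kappa>"
      using \<kappa> by (simp flip: powr_add)
    ultimately show ?thesis by (simp add: P_def f_def mult_ac)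
  qed
  have f': "(f has_real_derivative (\<kappa> * (T - t)) powr (2 * \<alpha>) * kummer \<alpha> (\<kappa> * (T - t)) / 4) (at (\<kappa> * (T - t)))"
    unfolding f_def[abs_def] using t \<kappa> by (intro kummer_ODE \<alpha>) auto
  have g': "((\<lambda>t. \<kappa> * (T - t)) has_real_derivative - \<kappa>) (at t)"
    by (auto intro!: derivative_eq_intros)
  have "((\<lambda>t. f (\<kappa> * (T - t))) has_real_derivative (\<kappa> * (T - t)) powr (2 * \<alpha>) * kummer \<alpha> (\<kappa> * (T - t)) / 4 * - \<kappa>) (at t)"
    by (rule DERIV_chain2[where f = f and g = "\<lambda>t. \<kappa> * (T - t)", OF f' g'])
  from DERIV_cmult[OF this, of "\<kappa> powr (1 - 2 * \<alpha>)"]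
  have "((\<lambda>t. \<kappa> powr (1 - 2 * \<alpha>) * f (\<kappa> * (T - t))) has_real_derivative
     \<kappa> powr (1 - 2 * \<alpha>) * ((\<kappa> * (T - t)) powr (2 * \<alpha>) * kummer \<alpha> (\<kappa> * (T - t)) / 4 * - \<kappa>)) (at t)" .
  also have "\<kappa> powr (1 - 2 * \<alpha>) * ((\<kappa> * (T - t)) powr (2 * \<alpha>) * kummer \<alpha> (\<kappa> * (T - t)) / 4 * - \<kappa>) = - 2 * lam * W t * Y t"
  proof -
    have 1: "(\<kappa> * (T - t)) powr (2 * \<alpha>) = \<kappa> powr (2 * \<alpha>) * W t"
      using t \<kappa> by (simp add: powr_mult W_def)
    have "\<kappa> powr (1 - 2 * \<alpha>) * ((\<kappa> * (T - t)) powr (2 * \<alpha>) * kummer \<alpha> (\<kappa> * (T - t)) / 4 * - \<kappa>)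
      = - ((\<kappa> powr (1 - 2 * \<alpha>) * \<kappa> powr (2 * \<alpha>)) * \<kappa>) * W t * Y t / 4"
      unfolding 1 Y_def by (simp add: mult_ac)
    also have "\<kappa> powr (1 - 2 * \<alpha>) * \<kappa> powr (2 * \<alpha>) = \<kappa>" using \<kappa> by (simp flip: powr_add)
    also have "\<kappa> * \<kappa> = 8 * lam" using \<kappa> by (simp add: power2_eq_square)
    finally show ?thesis by simp
  qed
  finally show ?thesis
    by (rule has_field_derivative_transform_within_open[where S = "{..<T}"]) (use t eq in auto)
qed

lemma continuous_on_inverse_W: "continuous_on {..<T} (\<lambda>s. (T - s) powr (- 2 * \<alpha>))"
  by (intro continuous_intros) auto

lemma q_deriv:
  assumes "-1 < t" "t < T"
  shows "(q has_real_derivative 1 / W t) (at t)"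
proof -
  define b where "b = (t + T) / 2"
  have b: "t < b" "b < T" using assms by (auto simp: b_def)
  have "((\<lambda>t. integral {-1..t} (\<lambda>s. (T - s) powr (- 2 * \<alpha>))) has_real_derivative (T - t) powr (- 2 * \<alpha>)) (at t within {-1..b})"
    using b assms by (intro integral_has_real_derivative continuous_on_subset[OF continuous_on_inverse_W]) auto
  hence "((\<lambda>t. integral {-1..t} (\<lambda>s. (T - s) powr (- 2 * \<alpha>))) has_real_derivative (T - t) powr (- 2 * \<alpha>)) (at t)"
    using at_within_Icc_at[of "-1" t b] assms b by simp
  thus ?thesis using inverse_W assms by (simp add: q_def[abs_def])
qed

lemma q_increment:
  assumes "-1 < s" "s \<le> t" "t < T"
  shows "0 \<le> q t - q s" "q t - q s \<le> (t - s) / W t"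
proof -
  have "0 \<le> q t - q s \<and> q t - q s \<le> (t - s) / W t"
  proof (cases "s = t")
    case False
    hence "s < t" using assms by simp
    have "\<exists>z. s < z \<and> z < t \<and> q t - q s = (t - s) * (1 / W z)"
      by (rule MVT2) (use assms \<open>s < t\<close> in \<open>auto intro!: q_deriv\<close>)
    then obtain z where z: "s < z" "z < t" "q t - q s = (t - s) * (1 / W z)" by blast
    have "1 / W z \<le> 1 / W t" using z W_antimono[of z t] W_pos[of t] assms by (intro divide_left_mono) (auto intro!: mult_pos_pos W_pos)
    hence "(t - s) * (1 / W z) \<le> (t - s) * (1 / W t)" using \<open>s < t\<close> by (intro mult_left_mono) auto
    moreover have "W z > 0" using z assms by (intro W_pos) auto
    ultimately show ?thesis using z \<open>s < t\<close> by auto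
  qed simp
  thus "0 \<le> q t - q s" "q t - q s \<le> (t - s) / W t" by auto
qed

lemma Y_antimono: "s \<le> t \<Longrightarrow> t < T \<Longrightarrow> Y t \<le> Y s"
proof (rule DERIV_nonpos_imp_nonincreasing[of s t Y])
  fix x assume "s \<le> x" "x \<le> t" "t < T"
  thus "\<exists>y. (Y has_real_derivative y) (at x) \<and> y \<le> 0"
    using Y_deriv[of x] P_pos[of x] W_pos[of x] by (intro exI[of _ "- P x / W x"]) auto
qed

text \<open>The factor \<open>1 / W t\<close>, unbounded near \<open>T\<close>, cancels against the
  \<open>W\<close> inside \<open>P\<close>, so the bound is uniform up to \<open>T\<close>.\<close>

lemma \<beta>_q_le:
  assumes "-1 < s" "s \<le> t" "t < T"
  shows "0 \<le> 2 * \<beta> t * (q t - q s)" "2 * \<beta> t * (q t - q s) \<le> \<kappa> / 2 * (t - s)"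
proof -
  show "0 \<le> 2 * \<beta> t * (q t - q s)" using \<beta>_pos[of t] q_increment(1)[OF assms] assms by simp
  have "2 * \<beta> t * (q t - q s) \<le> 2 * \<beta> t * ((t - s) / W t)"
    using \<beta>_pos[of t] q_increment(2)[OF assms] assms by (intro mult_left_mono) auto
  also have "\<dots> = (P t / W t) / Y t * (t - s)" by (simp add: \<beta>_def)
  also have "\<dots> \<le> (\<kappa> / 2 * Y t) / Y t * (t - s)"
    using P_over_W_le[of t] Y_pos[of t] assms by (intro mult_right_mono divide_right_mono) auto
  also have "\<dots> = \<kappa> / 2 * (t - s)" using Y_pos[of t] by simp
  finally show "2 * \<beta> t * (q t - q s) \<le> \<kappa> / 2 * (t - s)" .
qed

text \<open>
  The weight \<open>c\<close> for which the discrete Riccati recursion is solved exactly by \<open>\<beta>\<close>; it is close to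
  \<open>lam * (t - s) * W s\<close>. Both bounds come from the mean value theorem, because the derivative of
  \<open>\<beta> x / (1 + 2 * \<beta> x * (q x - q s))\<close> is \<open>- lam * W x / (1 + 2 * \<beta> x * (q x - q s))\<^sup>2\<close>.
\<close>

lemma weight_bounds:
  assumes st: "-1 < s" "s < t" "t < T"
  defines "c \<equiv> \<beta> s - \<beta> t / (1 + 2 * \<beta> t * (q t - q s))"
  shows "c \<le> lam * (t - s) * W s" "lam * (t - s) * W t / (1 + \<kappa> / 2 * (t - s))\<^sup>2 \<le> c"
proof -
  \<comment> \<open>\<open>H x / Y x\<close> is the denominator
    \<open>1 + 2 * \<beta> x * (q x - q s)\<close>, and in \<open>H'\<close> the terms with
    \<open>P x / W x\<close> cancel.\<close>
  define H where "H x = Y x + P x * (q x - q s)" for x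
  define F where "F x = P x / (2 * H x)" for x
  have Hpos: "H x > 0" if "s \<le> x" "x \<le> t" for x
    using Y_pos[of x] P_pos[of x] q_increment(1)[of s x] that st unfolding H_def by (intro add_pos_nonneg) auto
  have H: "1 + 2 * \<beta> x * (q x - q s) = H x / Y x" for x
    using Y_pos[of x] by (simp add: H_def \<beta>_def field_simps)
  have F: "\<beta> x / (1 + 2 * \<beta> x * (q x - q s)) = F x" for x
    unfolding H using Y_pos[of x] by (simp add: \<beta>_def F_def field_simps)
  have F': "(F has_real_derivative - (lam * W x * (Y x / H x)\<^sup>2)) (at x)" if x: "s \<le> x" "x \<le> t" for x
  proof -
    have H': "(H has_real_derivative (- P x / W x) + ((- 2 * lam * W x * Y x) * (q x - q s) + 1 / W x * P x)) (at x)"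
      unfolding H_def[abs_def] using x st by (auto intro!: derivative_eq_intros Y_deriv P_deriv q_deriv)
    have "(F has_real_derivative ((- 2 * lam * W x * Y x) * (2 * H x) -
        P x * (2 * ((- P x / W x) + ((- 2 * lam * W x * Y x) * (q x - q s) + 1 / W x * P x)))) / (2 * H x * (2 * H x))) (at x)"
      unfolding F_def[abs_def]
      by (rule DERIV_divide[OF P_deriv DERIV_cmult[OF H']]) (use x st Hpos[of x] in auto)
    also have "(- 2 * lam * W x * Y x) * (2 * H x) -
        P x * (2 * ((- P x / W x) + ((- 2 * lam * W x * Y x) * (q x - q s) + 1 / W x * P x)))
        = - 4 * lam * W x * Y x * (H x - P x * (q x - q s))"
      by (simp add: algebra_simps)
    also have "H x - P x * (q x - q s) = Y x" by (simp add: H_def)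
    also have "- 4 * lam * W x * Y x * Y x / (2 * H x * (2 * H x)) = - (lam * W x * (Y x / H x)\<^sup>2)"
      using Hpos[of x] x by (simp add: power2_eq_square field_simps)
    finally show ?thesis .
  qed
  have "\<exists>z. s < z \<and> z < t \<and> F t - F s = (t - s) * - (lam * W z * (Y z / H z)\<^sup>2)"
    by (rule MVT2) (use st F' in auto)
  then obtain z where z: "s < z" "z < t" "F t - F s = (t - s) * - (lam * W z * (Y z / H z)\<^sup>2)" by blast
  have "F s = \<beta> s" by (simp add: F[symmetric])
  hence c: "c = lam * (t - s) * W z * (Y z / H z)\<^sup>2"
    using z(3) unfolding c_def F by (simp add: algebra_simps)
  have Hz: "H z > 0" using z Hpos by auto
  have Yz: "Y z / H z = 1 / (1 + 2 * \<beta> z * (q z - q s))" by (simp add: H)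
  have b: "0 \<le> 2 * \<beta> z * (q z - q s)" "2 * \<beta> z * (q z - q s) \<le> \<kappa> / 2 * (t - s)"
    using \<beta>_q_le[of s z] z st \<kappa> by (auto intro: order_trans[OF _ mult_left_mono])
  have hi: "Y z / H z \<le> 1" "0 \<le> Y z / H z" unfolding Yz using b by (auto simp: divide_le_eq)
  have lo: "1 / (1 + \<kappa> / 2 * (t - s)) \<le> Y z / H z"
    unfolding Yz using b by (intro divide_left_mono) (auto intro!: mult_pos_pos add_pos_nonneg)
  have "W z * (Y z / H z)\<^sup>2 \<le> W s * 1"
    using W_antimono[of s z] W_pos[of s] z st hi by (intro mult_mono) (auto simp: power_le_one)
  hence "(lam * (t - s)) * (W z * (Y z / H z)\<^sup>2) \<le> (lam * (t - s)) * W s"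
    using lam st by (intro mult_left_mono) auto
  thus "c \<le> lam * (t - s) * W s" unfolding c by (simp add: mult.assoc)
  have "W t * (1 / (1 + \<kappa> / 2 * (t - s)))\<^sup>2 \<le> W z * (Y z / H z)\<^sup>2"
    using W_antimono[of z t] W_pos[of z] z st lo \<kappa> by (intro mult_mono power_mono) auto
  hence "(lam * (t - s)) * (W t * (1 / (1 + \<kappa> / 2 * (t - s)))\<^sup>2) \<le> (lam * (t - s)) * (W z * (Y z / H z)\<^sup>2)"
    using lam st by (intro mult_left_mono) auto
  thus "lam * (t - s) * W t / (1 + \<kappa> / 2 * (t - s))\<^sup>2 \<le> c"
    unfolding c by (simp add: mult.assoc power_divide)
qed

text \<open>Replacing each factor by \<open>Y s / Y t\<close> would make the product telescope;
  \<open>p\<close> measures the relative error. The terms with \<open>P / W\<close> cancel in the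
  derivative of \<open>Y + P * (q - q s)\<close>, so this function decreases and the error is of
  second order in the step.\<close>

lemma factor_bounds:
  assumes st: "-1 < s" "s < t" "t < T"
  defines "p \<equiv> (1 + 2 * \<beta> t * (q t - q s)) * Y t / Y s"
  shows "p \<le> 1" "1 - 2 * lam * (t - s)\<^sup>2 \<le> p"
proof -
  define H where "H x = Y x + P x * (q x - q s)" for x
  have "(1 + 2 * \<beta> t * (q t - q s)) * Y t = H t"
    using Y_pos[of t] by (simp add: H_def \<beta>_def field_simps)
  hence p: "p = H t / Y s" by (simp add: p_def)
  have H': "(H has_real_derivative - (2 * lam * W x * Y x * (q x - q s))) (at x)" if x: "s \<le> x" "x \<le> t" for x
  proof -
    have "(H has_real_derivative (- P x / W x) + ((- 2 * lam * W x * Y x) * (q x - q s) + 1 / W x * P x)) (at x)"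
      unfolding H_def[abs_def] using x st by (auto intro!: derivative_eq_intros Y_deriv P_deriv q_deriv)
    thus ?thesis by simp
  qed
  have "\<exists>z. s < z \<and> z < t \<and> H t - H s = (t - s) * - (2 * lam * W z * Y z * (q z - q s))"
    by (rule MVT2) (use st H' in auto)
  then obtain z where z: "s < z" "z < t" "H t - H s = (t - s) * - (2 * lam * W z * Y z * (q z - q s))" by blast
  have Hs: "H s = Y s" by (simp add: H_def)
  have Wz: "W z > 0" using z st by (intro W_pos) auto
  have qz: "0 \<le> q z - q s" "q z - q s \<le> (z - s) / W z" using q_increment[of s z] z st by auto
  have "0 \<le> (t - s) * (2 * lam * W z * Y z * (q z - q s))"
    using st lam Wz Y_pos[of z] qz by (intro mult_nonneg_nonneg) auto
  hence "H t \<le> Y s" using z(3) Hs by linarith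
  thus "p \<le> 1" using Y_pos[of s] by (simp add: p)
  have "W z * (q z - q s) \<le> t - s"
    using qz(2) Wz z by (simp add: field_simps)
  hence "Y z * (W z * (q z - q s)) \<le> Y s * (t - s)"
    using Y_antimono[of s z] Y_pos[of z] Y_pos[of s] z st qz Wz by (intro mult_mono) (auto intro!: mult_nonneg_nonneg)
  hence "(2 * lam * (t - s)) * (Y z * (W z * (q z - q s))) \<le> (2 * lam * (t - s)) * (Y s * (t - s))"
    using lam st by (intro mult_left_mono) auto
  hence "H t \<ge> Y s - 2 * lam * (t - s) * (Y s * (t - s))" using z(3) Hs by (simp add: algebra_simps)
  hence "H t \<ge> Y s * (1 - 2 * lam * (t - s)\<^sup>2)" by (simp add: algebra_simps power2_eq_square)
  thus "1 - 2 * lam * (t - s)\<^sup>2 \<le> p" unfolding p using Y_pos[of s] by (simp add: field_simps)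
qed

text \<open>Apart from the telescoping quotients there remain \<open>Suc n\<close> corrections, each
  within a multiple of \<open>1 / (real (Suc n))\<^sup>2\<close> of 1; by Bernoulli's inequality
  their product tends to 1.\<close>

lemma product_tendsto:
  assumes \<tau>: "0 < \<tau>" "\<tau> < T"
  defines "t \<equiv> \<lambda>n j. real j * \<tau> / real (Suc n)"
  shows "(\<lambda>n. \<Prod>j<Suc n. 1 / sqrt (1 + 2 * \<beta> (t n (Suc j)) * (q (t n (Suc j)) - q (t n j)))) \<longlonglongrightarrow> sqrt (Y \<tau> / Y 0)"
proof -
  define p where "p n j = (1 + 2 * \<beta> (t n (Suc j)) * (q (t n (Suc j)) - q (t n j))) * Y (t n (Suc j)) / Y (t n j)" for n j
  have step: "t n (Suc j) - t n j = \<tau> / real (Suc n)" for n j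
    by (simp add: t_def field_simps del: of_nat_Suc) (simp add: algebra_simps)
  have t0: "t n 0 = 0" "t n (Suc n) = \<tau>" for n by (simp_all add: t_def del: of_nat_Suc)
  have tle: "0 \<le> t n j" "t n j \<le> \<tau>" if "j \<le> Suc n" for n j
    using that \<tau> by (auto simp: t_def divide_le_eq mult.commute mult_left_mono simp del: of_nat_Suc)
  have pb: "p n j \<le> 1" "1 - 2 * lam * (\<tau> / real (Suc n))\<^sup>2 \<le> p n j" if j: "j < Suc n" for n j
  proof -
    have "t n j < t n (Suc j)" using step[of n j] \<tau> by (metis diff_gt_0_iff_gt divide_pos_pos of_nat_0_less_iff zero_less_Suc)
    from factor_bounds[of "t n j" "t n (Suc j)", OF _ this] tle[of j n] tle[of "Suc j" n] j \<tau>
    show "p n j \<le> 1" "1 - 2 * lam * (\<tau> / real (Suc n))\<^sup>2 \<le> p n j"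
      unfolding p_def step by auto
  qed
  have prod: "(\<Prod>j<Suc n. 1 + 2 * \<beta> (t n (Suc j)) * (q (t n (Suc j)) - q (t n j))) = (\<Prod>j<Suc n. p n j) * (Y 0 / Y \<tau>)" for n
  proof -
    have "(\<Prod>j<m. 1 + 2 * \<beta> (t n (Suc j)) * (q (t n (Suc j)) - q (t n j))) = (\<Prod>j<m. p n j) * (Y 0 / Y (t n m))" for m
    proof (induction m)
      case 0 thus ?case using Y_pos[of 0] by (simp add: t0)
    next
      case (Suc m)
      have "1 + 2 * \<beta> (t n (Suc m)) * (q (t n (Suc m)) - q (t n m)) = p n m * (Y (t n m) / Y (t n (Suc m)))"
        using Y_pos[of "t n m"] Y_pos[of "t n (Suc m)"] by (simp add: p_def)
      thus ?case
        unfolding prod.lessThan_Suc Suc.IH using Y_pos[of "t n m"] by simp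
    qed
    from this[of "Suc n"] show ?thesis by (simp add: t0)
  qed
  have "(\<lambda>n. \<Prod>j<Suc n. p n j) \<longlonglongrightarrow> 1"
  proof (rule real_tendsto_sandwich)
    have "(\<lambda>n. 2 * lam * (\<tau> / real (Suc n))\<^sup>2) \<longlonglongrightarrow> 0"
      using \<tau>(1) lam by real_asymp
    hence small: "eventually (\<lambda>n. 2 * lam * (\<tau> / real (Suc n))\<^sup>2 < 1) sequentially"
      by (rule order_tendstoD) simp
    show "eventually (\<lambda>n. 1 - 2 * lam * \<tau>\<^sup>2 / real (Suc n) \<le> (\<Prod>j<Suc n. p n j)) sequentially"
      using small
    proof eventually_elim
      case (elim n)
      define x where "x = 2 * lam * (\<tau> / real (Suc n))\<^sup>2"
      have "1 + real (Suc n) * (- x) \<le> (1 + - x) ^ Suc n"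
        using elim by (intro Bernoulli_inequality) (simp add: x_def)
      moreover have "real (Suc n) * x = 2 * lam * \<tau>\<^sup>2 / real (Suc n)"
        by (simp add: x_def power2_eq_square del: of_nat_Suc)
      moreover have "(1 + - x) ^ Suc n = (\<Prod>j<Suc n. 1 - x)" by simp
      moreover have "(\<Prod>j<Suc n. 1 - x) \<le> (\<Prod>j<Suc n. p n j)"
        using pb(2)[of _ n] elim by (intro prod_mono) (auto simp: x_def)
      ultimately show ?case by simp
    qed
    show "eventually (\<lambda>n. (\<Prod>j<Suc n. p n j) \<le> 1) sequentially"
      using small
    proof eventually_elim
      case (elim n)
      have "0 \<le> p n j" if "j < Suc n" for j using pb(2)[OF that] elim by linarith
      thus ?case using pb(1)[of _ n] by (intro prod_le_1) auto
    qed
    show "(\<lambda>n. 1 - 2 * lam * \<tau>\<^sup>2 / real (Suc n)) \<longlonglongrightarrow> 1" by real_asymp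
  qed auto
  hence "(\<lambda>n. 1 / sqrt ((\<Prod>j<Suc n. p n j) * (Y 0 / Y \<tau>))) \<longlonglongrightarrow> 1 / sqrt (1 * (Y 0 / Y \<tau>))"
    using Y_pos[of 0] Y_pos[of \<tau>] by (intro tendsto_intros) auto
  moreover have "(\<Prod>j<Suc n. 1 / sqrt (f j)) = 1 / sqrt (\<Prod>j<Suc n. f j)" for f and n :: nat
    by (induction n) (simp_all add: real_sqrt_mult)
  ultimately show ?thesis by (simp only: prod) (simp add: real_sqrt_divide)
qed

end

section \<open>Left Riemann sums\<close>

lemma riemann_sum_tendsto:
  fixes f :: "real \<Rightarrow> real"
  assumes \<tau>: "\<tau> > 0" and f: "continuous_on {0..\<tau>} f"
  shows "(\<lambda>n. \<Sum>j<Suc n. \<tau> / real (Suc n) * f (real j * \<tau> / real (Suc n))) \<longlonglongrightarrow> integral {0..\<tau>} f"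
proof (rule LIMSEQ_I)
  fix e :: real assume e: "e > 0"
  have "uniformly_continuous_on {0..\<tau>} f" using f by (intro compact_uniformly_continuous) auto
  moreover have e': "e / (2 * \<tau>) > 0" using e \<tau> by simp
  ultimately obtain d where d: "d > 0" "\<And>x y. x \<in> {0..\<tau>} \<Longrightarrow> y \<in> {0..\<tau>} \<Longrightarrow> dist y x < d \<Longrightarrow> dist (f y) (f x) < e / (2 * \<tau>)"
    unfolding uniformly_continuous_on_def by metis
  have "eventually (\<lambda>n. \<tau> / real (Suc n) < d) sequentially"
    using d(1) by real_asymp
  then obtain N where N: "\<And>n. n \<ge> N \<Longrightarrow> \<tau> / real (Suc n) < d" by (auto simp: eventually_sequentially)
  show "\<exists>N. \<forall>n\<ge>N. norm ((\<Sum>j<Suc n. \<tau> / real (Suc n) * f (real j * \<tau> / real (Suc n))) - integral {0..\<tau>} f) < e"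
  proof (intro exI[of _ N] allI impI)
    fix n assume n: "n \<ge> N"
    define h where "h = \<tau> / real (Suc n)"
    have h: "h > 0" "h < d" using \<tau> N[OF n] by (auto simp: h_def)
    have tau: "real (Suc n) * h = \<tau>" by (simp add: h_def del: of_nat_Suc)
    have sub: "{real j * h..real (Suc j) * h} \<subseteq> {0..\<tau>}" if "j < Suc n" for j
    proof -
      have "real (Suc j) * h \<le> real (Suc n) * h" using that h by (intro mult_right_mono) auto
      thus ?thesis using tau h by auto
    qed
    have int: "f integrable_on {real j * h..real (Suc j) * h}" if "j < Suc n" for j
      using sub[OF that] by (intro integrable_continuous_interval continuous_on_subset[OF f])
    have split: "integral {0..real m * h} f = (\<Sum>j<m. integral {real j * h..real (Suc j) * h} f)" if "m \<le> Suc n" for m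
      using that
    proof (induction m)
      case (Suc m)
      have "real (Suc m) * h \<le> real (Suc n) * h" using Suc.prems h by (intro mult_right_mono) auto
      hence "f integrable_on {0..real (Suc m) * h}"
        using tau by (intro integrable_continuous_interval continuous_on_subset[OF f]) auto
      hence "integral {0..real (Suc m) * h} f = integral {0..real m * h} f + integral {real m * h..real (Suc m) * h} f"
        using h by (intro Henstock_Kurzweil_Integration.integral_combine[symmetric]) (auto simp: algebra_simps)
      thus ?case using Suc by simp
    qed simp
    have "\<bar>h * f (real j * h) - integral {real j * h..real (Suc j) * h} f\<bar> \<le> e / (2 * \<tau>) * h" if j: "j < Suc n" for j
    proof -
      have c: "integral {real j * h..real (Suc j) * h} (\<lambda>_. f (real j * h)) = h * f (real j * h)"
        using h by (simp add: algebra_simps)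
      have "integral {real j * h..real (Suc j) * h} f - h * f (real j * h) =
        integral {real j * h..real (Suc j) * h} (\<lambda>x. f x - f (real j * h))"
        unfolding c[symmetric] using int[OF j] by (intro Henstock_Kurzweil_Integration.integral_diff[symmetric]) auto
      also have "norm \<dots> \<le> e / (2 * \<tau>) * (real (Suc j) * h - real j * h)"
      proof (rule integral_bound)
        show "continuous_on {real j * h..real (Suc j) * h} (\<lambda>x. f x - f (real j * h))"
          using sub[OF j] by (intro continuous_intros continuous_on_subset[OF f])
        fix x assume x: "x \<in> {real j * h..real (Suc j) * h}"
        have "dist x (real j * h) < d" using x h by (auto simp: dist_real_def algebra_simps)
        moreover have "x \<in> {0..\<tau>}" "real j * h \<in> {0..\<tau>}"
          using sub[OF j] x by (blast, use sub[OF j] h in \<open>auto simp: algebra_simps\<close>)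
        ultimately have "dist (f x) (f (real j * h)) < e / (2 * \<tau>)" by (intro d(2))
        thus "norm (f x - f (real j * h)) \<le> e / (2 * \<tau>)" by (simp add: dist_real_def)
      qed (use h in \<open>auto simp: algebra_simps\<close>)
      finally show ?thesis by (simp add: algebra_simps abs_minus_commute)
    qed
    hence "(\<Sum>j<Suc n. \<bar>h * f (real j * h) - integral {real j * h..real (Suc j) * h} f\<bar>) \<le> (\<Sum>j<Suc n. e / (2 * \<tau>) * h)"
      by (intro sum_mono) auto
    also have "\<dots> = e / (2 * \<tau>) * (real (Suc n) * h)" by simp
    also have "\<dots> = e / 2" unfolding tau using \<tau> by simp
    finally have "\<bar>\<Sum>j<Suc n. h * f (real j * h) - integral {real j * h..real (Suc j) * h} f\<bar> \<le> e / 2"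
      by (rule order_trans[OF sum_abs])
    hence "\<bar>(\<Sum>j<Suc n. h * f (real j * h)) - integral {0..\<tau>} f\<bar> < e"
      using split[of "Suc n"] tau e by (simp add: sum_subtractf del: sum.lessThan_Suc of_nat_Suc)
    thus "norm ((\<Sum>j<Suc n. \<tau> / real (Suc n) * f (real j * \<tau> / real (Suc n))) - integral {0..\<tau>} f) < e"
      by (simp add: h_def)
  qed
qed

subsection \<open>The Laplace transform of the quadratic functional\<close>

text \<open>Continuity is required of every path, so that the path integrals are measurable with
  respect to \<open>M\<close> itself; the exceptional null set is treated at the end.\<close>

locale continuous_alpha_bridge = alpha_wiener_bridge M B \<alpha> T X
  for M :: "'a measure" and B :: "real \<Rightarrow> 'a \<Rightarrow> real" and \<alpha> T :: real and X :: "real \<Rightarrow> 'a \<Rightarrow> real" +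
  assumes \<alpha>_pos: "\<alpha> > 0" and T_pos: "T > 0"
    and continuous_everywhere: "\<And>\<omega>. \<omega> \<in> space M \<Longrightarrow> continuous_on {0..<T} (\<lambda>t. X t \<omega>)"
begin

lemma X_measurable: "0 \<le> t \<Longrightarrow> t < T \<Longrightarrow> X t \<in> borel_measurable M"
  using integral_representation by (auto simp: has_wiener_integral_def)

definition g :: "real \<Rightarrow> real \<Rightarrow> real" where
  "g t s = indicator {0..t} s * (T - s) powr (- \<alpha>)"

definition Z :: "real \<Rightarrow> 'a \<Rightarrow> real" where
  "Z t \<omega> = (T - t) powr (- \<alpha>) * X t \<omega>"

lemma Z_wiener_integral:
  assumes "0 \<le> t" "t < T"
  shows "wiener_integral_of (g t) (Z t)"
proof -
  have X: "wiener_integral_of (\<lambda>s. indicator {0..t} s * ((T - t) / (T - s)) powr \<alpha>) (X t)"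
    by (rule has_wiener_integral_imp_wiener_integral_of[OF integral_representation[OF assms]])
  have eq: "(T - t) powr (- \<alpha>) * (indicator {0..t} s * ((T - t) / (T - s)) powr \<alpha>) = g t s" for s
  proof (cases "s \<in> {0..t}")
    case True
    hence "((T - t) / (T - s)) powr \<alpha> = (T - t) powr \<alpha> * (T - s) powr (- \<alpha>)"
      using assms by (simp add: powr_divide powr_minus_divide)
    moreover have "(T - t) powr (- \<alpha>) * (T - t) powr \<alpha> = 1"
      using assms by (simp flip: powr_add)
    ultimately show ?thesis using True by (simp add: g_def)
  qed (simp add: g_def)
  show ?thesis
    using wiener_integral_of_combination[OF X X, of "(T - t) powr (- \<alpha>)" 0] by (simp add: eq Z_def[abs_def])
qed

lemma square_powr: "T - s > 0 \<Longrightarrow> ((T - s) powr (- \<alpha>))\<^sup>2 = (T - s) powr (- 2 * \<alpha>)"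
  by (simp add: power2_eq_square flip: powr_add)

section \<open>Path integrals up to times below \<open>T\<close> and their limit\<close>

definition I :: "real \<Rightarrow> 'a \<Rightarrow> real" where
  "I \<tau> \<omega> = integral {0..\<tau>} (\<lambda>t. (X t \<omega>)\<^sup>2)"

definition J :: "'a \<Rightarrow> ennreal" where
  "J \<omega> = (\<integral>\<^sup>+t\<in>{0..T}. ennreal ((X t \<omega>)\<^sup>2) \<partial>lborel)"

lemma continuous_square:
  assumes "\<omega> \<in> space M" "\<tau> < T"
  shows "continuous_on {0..\<tau>} (\<lambda>t. (X t \<omega>)\<^sup>2)"
  using assms by (intro continuous_intros continuous_on_subset[OF continuous_everywhere]) auto

lemma I_nonneg: "\<omega> \<in> space M \<Longrightarrow> \<tau> < T \<Longrightarrow> I \<tau> \<omega> \<ge> 0"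
  unfolding I_def
  by (intro Henstock_Kurzweil_Integration.integral_nonneg integrable_continuous_interval continuous_square) auto

lemma I_measurable:
  assumes "0 < \<tau>" "\<tau> < T"
  shows "I \<tau> \<in> borel_measurable M"
proof (rule borel_measurable_LIMSEQ_real)
  show "(\<lambda>n. \<Sum>j<Suc n. \<tau> / real (Suc n) * (X (real j * \<tau> / real (Suc n)) \<omega>)\<^sup>2) \<longlonglongrightarrow> I \<tau> \<omega>"
    if "\<omega> \<in> space M" for \<omega>
    unfolding I_def by (rule riemann_sum_tendsto[OF assms(1) continuous_square[OF that assms(2)]])
  show "(\<lambda>\<omega>. \<Sum>j<Suc n. \<tau> / real (Suc n) * (X (real j * \<tau> / real (Suc n)) \<omega>)\<^sup>2) \<in> borel_measurable M" for n
  proof (intro borel_measurable_sum borel_measurable_times borel_measurable_const borel_measurable_power X_measurable)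
    fix j assume "j \<in> {..<Suc n}"
    hence "real j * \<tau> \<le> real (Suc n) * \<tau>" using assms by (intro mult_right_mono) auto
    hence "real j * \<tau> / real (Suc n) \<le> \<tau>" by (simp add: divide_le_eq mult.commute del: of_nat_Suc)
    thus "real j * \<tau> / real (Suc n) < T" using assms by simp
  qed (use assms in auto)
qed

lemma ennreal_I:
  assumes \<omega>: "\<omega> \<in> space M" and "\<tau> < T"
  shows "ennreal (I \<tau> \<omega>) = (\<integral>\<^sup>+t\<in>{0..\<tau>}. ennreal ((X t \<omega>)\<^sup>2) \<partial>lborel)"
proof -
  have c: "continuous_on {0..\<tau>} (\<lambda>t. (X t \<omega>)\<^sup>2)" using assms by (rule continuous_square)
  have si: "set_integrable lborel {0..\<tau>} (\<lambda>t. (X t \<omega>)\<^sup>2)"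
    using c by (intro borel_integrable_compact[of "{0..\<tau>}", folded set_integrable_def]) auto
  hence "I \<tau> \<omega> = (\<integral>t. indicator {0..\<tau>} t * (X t \<omega>)\<^sup>2 \<partial>lborel)"
    using set_borel_integral_eq_integral(2)[OF si] by (simp add: I_def set_lebesgue_integral_def)
  also have "ennreal \<dots> = (\<integral>\<^sup>+t. ennreal (indicator {0..\<tau>} t * (X t \<omega>)\<^sup>2) \<partial>lborel)"
    using si by (intro nn_integral_eq_integral[symmetric]) (auto simp: set_integrable_def)
  also have "\<dots> = (\<integral>\<^sup>+t\<in>{0..\<tau>}. ennreal ((X t \<omega>)\<^sup>2) \<partial>lborel)"
    by (intro nn_integral_cong) (auto simp: indicator_def)
  finally show ?thesis .
qed

text \<open>The shift by 2 makes \<open>tau 0\<close> positive.\<close>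

definition tau :: "nat \<Rightarrow> real" where "tau m = T * (1 - 1 / real (m + 2))"

lemma tau: "0 < tau m" "tau m < T" "m \<le> m' \<Longrightarrow> tau m \<le> tau m'" "tau \<longlonglongrightarrow> T"
proof -
  show "0 < tau m" "tau m < T" using T_pos by (auto simp: tau_def)
  show "tau m \<le> tau m'" if "m \<le> m'"
    using that T_pos unfolding tau_def by (intro mult_left_mono) (auto intro!: divide_left_mono mult_pos_pos)
  show "tau \<longlonglongrightarrow> T" unfolding tau_def using T_pos by real_asymp
qed

lemma I_tendsto_J:
  assumes \<omega>: "\<omega> \<in> space M"
  shows "(\<lambda>m. ennreal (I (tau m) \<omega>)) \<longlonglongrightarrow> J \<omega>"
proof -
  define f where "f m t = ennreal ((X t \<omega>)\<^sup>2) * indicator {0..tau m} t" for m t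
  have "incseq f"
    using tau(3) by (auto simp: f_def incseq_def le_fun_def indicator_def intro: order_trans)
  have m: "f m \<in> borel_measurable lborel" for m
  proof -
    have "(\<lambda>t. indicator {0..tau m} t *\<^sub>R (X t \<omega>)\<^sup>2) \<in> borel_measurable borel"
      by (intro borel_measurable_continuous_on_indicator continuous_square[OF \<omega>] tau) auto
    hence "(\<lambda>t. ennreal (indicator {0..tau m} t *\<^sub>R (X t \<omega>)\<^sup>2)) \<in> borel_measurable lborel" by simp
    also have "(\<lambda>t. ennreal (indicator {0..tau m} t *\<^sub>R (X t \<omega>)\<^sup>2)) = f m"
      by (auto simp: f_def fun_eq_iff indicator_def)
    finally show ?thesis .
  qed
  have sup: "(SUP m. f m t) = ennreal ((X t \<omega>)\<^sup>2) * indicator {0..T} t" for t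
  proof (cases "t \<in> {0..<T}")
    case True
    have "eventually (\<lambda>m. t < tau m) sequentially"
      using True by (intro order_tendstoD(1)[OF tau(4)]) auto
    then obtain m where "t < tau m" by (auto simp: eventually_sequentially)
    hence "f m t = ennreal ((X t \<omega>)\<^sup>2)" using True by (simp add: f_def)
    moreover have "f m' t \<le> ennreal ((X t \<omega>)\<^sup>2)" for m' by (auto simp: f_def indicator_def)
    ultimately have "(SUP m. f m t) = ennreal ((X t \<omega>)\<^sup>2)"
      by (intro antisym SUP_least SUP_upper2[of m]) auto
    thus ?thesis using True by simp
  next
    \<comment> \<open>At \<open>t = T\<close> no \<open>f m\<close> contributes; the limit agrees
      because the bridge ends at 0.\<close>
    case False
    have "f m t = 0" for m using False tau(2)[of m] by (auto simp: f_def indicator_def)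
    moreover have "ennreal ((X t \<omega>)\<^sup>2) * indicator {0..T} t = 0"
      using False end_value[OF \<omega>] by (auto simp: indicator_def)
    ultimately show ?thesis by simp
  qed
  have "(\<lambda>m. integral\<^sup>N lborel (f m)) \<longlonglongrightarrow> (SUP m. integral\<^sup>N lborel (f m))"
    using \<open>incseq f\<close> by (intro LIMSEQ_SUP) (auto simp: incseq_def le_fun_def intro!: nn_integral_mono)
  also have "(SUP m. integral\<^sup>N lborel (f m)) = (\<integral>\<^sup>+t. (SUP m. f m t) \<partial>lborel)"
    by (rule nn_integral_monotone_convergence_SUP[OF \<open>incseq f\<close> m, symmetric])
  also have "\<dots> = J \<omega>" unfolding sup J_def ..
  finally show ?thesis unfolding f_def ennreal_I[OF \<omega> tau(2)] .
qed

lemma J_measurable [measurable]: "J \<in> borel_measurable M"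
proof (rule borel_measurable_LIMSEQ_order)
  show "(\<lambda>\<omega>. ennreal (I (tau m) \<omega>)) \<in> borel_measurable M" for m
    using I_measurable[OF tau(1,2)] by measurable
qed (rule I_tendsto_J)

text \<open>\<open>exp (- l * J)\<close> with value 0 at infinite \<open>J\<close>; the case
  distinction is needed because \<open>enn2real\<close> sends \<infinity> to 0.\<close>

definition exp_J :: "real \<Rightarrow> 'a \<Rightarrow> real" where
  "exp_J l \<omega> = (if J \<omega> = \<infinity> then 0 else exp (- l * enn2real (J \<omega>)))"

lemma exp_J_measurable [measurable]: "exp_J l \<in> borel_measurable M"
  unfolding exp_J_def[abs_def] by measurable

lemma exp_I_tendsto:
  assumes \<omega>: "\<omega> \<in> space M" and l: "l > 0"
  shows "(\<lambda>m. exp (- l * I (tau m) \<omega>)) \<longlonglongrightarrow> exp_J l \<omega>"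
proof (cases "J \<omega> = \<infinity>")
  case True
  have "filterlim (\<lambda>m. I (tau m) \<omega>) at_top sequentially"
    unfolding filterlim_at_top_dense
  proof
    fix x :: real
    have "eventually (\<lambda>m. ennreal x < ennreal (I (tau m) \<omega>)) sequentially"
      using True by (intro order_tendstoD(1)[OF I_tendsto_J[OF \<omega>]]) (simp add: ennreal_less_top)
    thus "eventually (\<lambda>m. x < I (tau m) \<omega>) sequentially"
      by eventually_elim (metis ennreal_leI leD leI)
  qed
  hence "(\<lambda>m. exp (- l * I (tau m) \<omega>)) \<longlonglongrightarrow> 0"
    using l by (intro filterlim_compose[OF exp_at_bot] filterlim_tendsto_neg_mult_at_bot[OF tendsto_const]) auto
  thus ?thesis using True by (simp add: exp_J_def)
next
  case False
  hence "J \<omega> = ennreal (enn2real (J \<omega>))" by (simp add: ennreal_enn2real_if top.not_eq_extremum)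
  with I_tendsto_J[OF \<omega>] have "(\<lambda>m. ennreal (I (tau m) \<omega>)) \<longlonglongrightarrow> ennreal (enn2real (J \<omega>))" by simp
  hence "(\<lambda>m. enn2real (ennreal (I (tau m) \<omega>))) \<longlonglongrightarrow> enn2real (J \<omega>)"
    by (rule tendsto_enn2real) simp
  hence "(\<lambda>m. I (tau m) \<omega>) \<longlonglongrightarrow> enn2real (J \<omega>)"
    using I_nonneg[OF \<omega> tau(2)] by simp
  hence "(\<lambda>m. exp (- l * I (tau m) \<omega>)) \<longlonglongrightarrow> exp (- l * enn2real (J \<omega>))" by (intro tendsto_intros)
  thus ?thesis using False by (simp add: exp_J_def)
qed

section \<open>Laplace transform of the path integral at a fixed parameter\<close>

context
  fixes lam :: real
  assumes lam_pos: "lam > 0"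
begin

interpretation ode: bridge_ode \<alpha> T lam
  using \<alpha>_pos T_pos lam_pos by unfold_locales

lemma g_increment:
  assumes "0 \<le> s" "s \<le> t" "t < T"
  shows "(\<integral>x. (g t x - g s x)\<^sup>2 \<partial>lborel) = ode.q t - ode.q s"
proof -
  have "(\<integral>x. (g t x - g s x)\<^sup>2 \<partial>lborel) = (\<integral>x. indicator {s..t} x *\<^sub>R (T - x) powr (- 2 * \<alpha>) \<partial>lborel)"
  proof (rule integral_cong_AE)
    have "AE x in lborel. x \<notin> {s}" by (intro AE_not_in finite_imp_null_set_lborel) auto
    thus "AE x in lborel. (g t x - g s x)\<^sup>2 = indicator {s..t} x *\<^sub>R (T - x) powr (- 2 * \<alpha>)"
    proof eventually_elim
      case (elim x)
      thus ?case using assms square_powr[of x] by (auto simp: g_def indicator_def)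
    qed
  qed (unfold g_def, measurable)
  also have "\<dots> = ode.q t - ode.q s"
  proof (rule integral_FTC_atLeastAtMost)
    show "continuous_on {s..t} (\<lambda>x. (T - x) powr (- 2 * \<alpha>))"
      using assms by (intro continuous_on_subset[OF ode.continuous_on_inverse_W]) auto
    fix x assume "s \<le> x" "x \<le> t"
    hence "(ode.q has_real_derivative (T - x) powr (- 2 * \<alpha>)) (at x)"
      using ode.q_deriv[of x] ode.inverse_W[of x] assms by simp
    thus "(ode.q has_vector_derivative (T - x) powr (- 2 * \<alpha>)) (at x within {s..t})"
      unfolding has_real_derivative_iff_has_vector_derivative by (rule has_vector_derivative_at_within)
  qed (use assms in auto)
  finally show ?thesis .
qed

lemma g_orthogonal: "0 \<le> r \<Longrightarrow> r \<le> s \<Longrightarrow> s \<le> t \<Longrightarrow> g r x * (g t x - g s x) = 0"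
  by (auto simp: g_def indicator_def)

lemma g_0: "(\<integral>x. (g 0 x)\<^sup>2 \<partial>lborel) = 0"
proof -
  have "AE x in lborel. x \<notin> {0::real}" by (intro AE_not_in finite_imp_null_set_lborel) auto
  hence "AE x in lborel. (g 0 x)\<^sup>2 = 0" by eventually_elim (auto simp: g_def indicator_def)
  thus ?thesis by (intro integral_eq_zero_AE)
qed

text \<open>With the weights \<open>c\<close> and the terminal weight at \<tau>, the function
  \<open>ode.\<beta>\<close> solves the recursion at the grid points without error. As
  \<open>ode.W t * (Z t \<omega>)\<^sup>2 = (X t \<omega>)\<^sup>2\<close>, the two bounds make the
  weighted sum nearly \<open>lam\<close> times a Riemann sum of the squared path.\<close>

lemma discrete_laplace:
  fixes n :: nat
  assumes \<tau>: "0 < \<tau>" "\<tau> < T"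
  defines "t \<equiv> \<lambda>j. real j * \<tau> / real (Suc n)"
  defines "c \<equiv> \<lambda>j. ode.\<beta> (t j) - ode.\<beta> (t (Suc j)) / (1 + 2 * ode.\<beta> (t (Suc j)) * (ode.q (t (Suc j)) - ode.q (t j)))"
  shows "(\<integral>\<omega>. exp (- (\<Sum>j<Suc n. c j * (Z (t j) \<omega>)\<^sup>2) - ode.\<beta> \<tau> * (Z \<tau> \<omega>)\<^sup>2) \<partial>M)
      = (\<Prod>j<Suc n. 1 / sqrt (1 + 2 * ode.\<beta> (t (Suc j)) * (ode.q (t (Suc j)) - ode.q (t j))))"
    and "\<And>j. j < Suc n \<Longrightarrow> c j \<le> lam * (\<tau> / real (Suc n)) * ode.W (t j)"
    and "\<And>j. j < Suc n \<Longrightarrow> lam * (\<tau> / real (Suc n)) * ode.W (t (Suc j)) / (1 + ode.\<kappa> / 2 * (\<tau> / real (Suc n)))\<^sup>2 \<le> c j"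
proof -
  have mono: "t i \<le> t j" if "i \<le> j" for i j
    using that \<tau> by (auto simp: t_def divide_right_mono mult_right_mono)
  have tlast: "t (Suc n) = \<tau>" "t 0 = 0" by (simp_all add: t_def del: of_nat_Suc)
  have t: "0 \<le> t j" "t j < T" if "j \<le> Suc n" for j
    using mono[of 0 j] mono[OF that] tlast \<tau> by auto
  have step: "t (Suc j) - t j = \<tau> / real (Suc n)" for j
    by (simp add: t_def field_simps del: of_nat_Suc) (simp add: algebra_simps)
  have lt: "t j < t (Suc j)" for j
    using step[of j] \<tau> by (metis diff_gt_0_iff_gt divide_pos_pos of_nat_0_less_iff zero_less_Suc)
  show cb: "c j \<le> lam * (\<tau> / real (Suc n)) * ode.W (t j)"
    "lam * (\<tau> / real (Suc n)) * ode.W (t (Suc j)) / (1 + ode.\<kappa> / 2 * (\<tau> / real (Suc n)))\<^sup>2 \<le> c j"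
    if "j < Suc n" for j
    using ode.weight_bounds[of "t j" "t (Suc j)", OF _ lt] t[of j] t[of "Suc j"] that
    unfolding c_def step by auto
  have c0: "c j \<ge> 0" if j: "j < Suc n" for j
  proof -
    have "0 \<le> lam * (\<tau> / real (Suc n)) * ode.W (t (Suc j)) / (1 + ode.\<kappa> / 2 * (\<tau> / real (Suc n)))\<^sup>2"
      using lam_pos \<tau> ode.W_pos[of "t (Suc j)"] t(2)[of "Suc j"] j by (intro divide_nonneg_nonneg mult_nonneg_nonneg) auto
    with cb(2)[OF j] show ?thesis by linarith
  qed
  have "(\<integral>\<omega>. exp (- (\<Sum>j<Suc n. c j * (Z (t j) \<omega>)\<^sup>2) - ode.\<beta> (t (Suc n)) * (Z (t (Suc n)) \<omega>)\<^sup>2) \<partial>M)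
      = (\<Prod>j<Suc n. 1 / sqrt (1 + 2 * ode.\<beta> (t (Suc j)) * (ode.q (t (Suc j)) - ode.q (t j))))"
  proof (rule wiener_integral_gaussian_chain[where g = "\<lambda>j. g (t j)" and Z = "\<lambda>j. Z (t j)" and b = "\<lambda>j. ode.\<beta> (t j)"])
    show "wiener_integral_of (g (t j)) (Z (t j))" if "j \<le> Suc n" for j
      by (intro Z_wiener_integral t that)
    show "g (t i) s * (g (t (Suc j)) s - g (t j) s) = 0" if "i \<le> j" "j < Suc n" for i j s
      using that t(1)[of i] mono by (intro g_orthogonal) auto
    show "(\<integral>s. (g (t 0) s)\<^sup>2 \<partial>lborel) = 0" unfolding tlast by (rule g_0)
    show "0 \<le> ode.\<beta> (t j)" if "j \<le> Suc n" for j
      using ode.\<beta>_pos[OF t(2)[OF that]] by simp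
    show "(\<integral>s. (g (t (Suc j)) s - g (t j) s)\<^sup>2 \<partial>lborel) = ode.q (t (Suc j)) - ode.q (t j)" if "j < Suc n" for j
      using that t[of j] t[of "Suc j"] mono by (intro g_increment) auto
    show "0 \<le> c j" if "j < Suc n" for j using that by (rule c0)
    show "c j + ode.\<beta> (t (Suc j)) / (1 + 2 * ode.\<beta> (t (Suc j)) * (ode.q (t (Suc j)) - ode.q (t j))) = ode.\<beta> (t j)"
      if "j < Suc n" for j
      by (simp add: c_def)
  qed
  thus "(\<integral>\<omega>. exp (- (\<Sum>j<Suc n. c j * (Z (t j) \<omega>)\<^sup>2) - ode.\<beta> \<tau> * (Z \<tau> \<omega>)\<^sup>2) \<partial>M)
      = (\<Prod>j<Suc n. 1 / sqrt (1 + 2 * ode.\<beta> (t (Suc j)) * (ode.q (t (Suc j)) - ode.q (t j))))"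
    unfolding tlast .
qed

lemma W_Z_square: "t < T \<Longrightarrow> ode.W t * (Z t \<omega>)\<^sup>2 = (X t \<omega>)\<^sup>2"
proof -
  assume t: "t < T"
  have "ode.W t * ((T - t) powr (- \<alpha>))\<^sup>2 = 1"
    using t square_powr[of t] by (simp add: ode.W_def flip: powr_add)
  thus ?thesis by (simp add: Z_def power_mult_distrib flip: mult.assoc)
qed

text \<open>The sum \<open>S n\<close> with the exact weights is eventually trapped between
  \<open>r n * (lam * R n)\<close> and \<open>lam * R n\<close>, where \<open>R n\<close> is a
  Riemann sum and \<open>r n\<close> tends to 1. The limit of the expectations is the limit of the
  products.\<close>

lemma laplace_up_to:
  assumes \<tau>: "0 < \<tau>" "\<tau> < T"
  shows "(\<integral>\<omega>. exp (- lam * I \<tau> \<omega> - ode.\<beta> \<tau> * (Z \<tau> \<omega>)\<^sup>2) \<partial>M) = sqrt (ode.Y \<tau> / ode.Y 0)"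
proof -
  define t where "t n j = real j * \<tau> / real (Suc n)" for n j
  define h where "h n = \<tau> / real (Suc n)" for n
  define c where "c n j = ode.\<beta> (t n j) - ode.\<beta> (t n (Suc j)) / (1 + 2 * ode.\<beta> (t n (Suc j)) * (ode.q (t n (Suc j)) - ode.q (t n j)))" for n j
  define S where "S n \<omega> = (\<Sum>j<Suc n. c n j * (Z (t n j) \<omega>)\<^sup>2)" for n \<omega>
  define R where "R n \<omega> = (\<Sum>j<Suc n. h n * (X (t n j) \<omega>)\<^sup>2)" for n \<omega>
  \<comment> \<open>A lower bound, uniform in \<open>j\<close>, for the ratio of the two weight
    bounds: for small \<open>h n\<close>, \<open>W\<close> keeps over one step at least the fraction
    \<open>(1 - h n / (T - \<tau>)) powr (2 * \<alpha>)\<close>.\<close>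
  define r where "r n = (1 - h n / (T - \<tau>)) powr (2 * \<alpha>) / (1 + ode.\<kappa> / 2 * h n)\<^sup>2" for n
  have h: "h n > 0" for n using \<tau> by (simp add: h_def)
  have hlim: "h \<longlonglongrightarrow> 0" unfolding h_def by real_asymp
  have t: "0 \<le> t n j" "t n j \<le> \<tau>" if "j \<le> Suc n" for n j
    using that \<tau> by (auto simp: t_def divide_le_eq mult.commute mult_left_mono simp del: of_nat_Suc)
  have step: "t n (Suc j) = t n j + h n" for n j
    by (simp add: t_def h_def field_simps del: of_nat_Suc) (simp add: algebra_simps)
  note dl = discrete_laplace[OF \<tau>, folded t_def h_def, folded c_def]
  have Zm: "Z s \<in> borel_measurable M" if "0 \<le> s" "s < T" for s
    unfolding Z_def using X_measurable[OF that] by measurable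
  have Sm [measurable]: "S n \<in> borel_measurable M" for n
    unfolding S_def using t \<tau>
    by (intro borel_measurable_sum borel_measurable_times borel_measurable_const borel_measurable_power Zm)
       (auto intro: le_less_trans[OF _ \<tau>(2)])
  note [measurable] = I_measurable[OF \<tau>] Zm[OF less_imp_le[OF \<tau>(1)] \<tau>(2)]
  have S_le: "S n \<omega> \<le> lam * R n \<omega>" for n \<omega>
    unfolding S_def R_def sum_distrib_left
  proof (rule sum_mono)
    fix j assume j: "j \<in> {..<Suc n}"
    have "c n j * (Z (t n j) \<omega>)\<^sup>2 \<le> lam * h n * ode.W (t n j) * (Z (t n j) \<omega>)\<^sup>2"
      using dl(2)[of j n] j by (intro mult_right_mono) auto
    also have "\<dots> = lam * (h n * (X (t n j) \<omega>)\<^sup>2)"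
      using W_Z_square[of "t n j" \<omega>] t[of j n] j \<tau> by (simp add: mult.assoc)
    finally show "c n j * (Z (t n j) \<omega>)\<^sup>2 \<le> lam * (h n * (X (t n j) \<omega>)\<^sup>2)" .
  qed
  have S_ge: "r n * (lam * R n \<omega>) \<le> S n \<omega>" if hn: "h n < T - \<tau>" for n \<omega>
    unfolding S_def R_def sum_distrib_left
  proof (rule sum_mono)
    fix j assume j: "j \<in> {..<Suc n}"
    have tj: "0 \<le> t n j" "t n j \<le> \<tau>" "t n (Suc j) \<le> \<tau>" using t[of j n] t[of "Suc j" n] j by auto
    have "1 - h n / (T - \<tau>) \<le> 1 - h n / (T - t n j)"
      using tj \<tau> h[of n] by (intro diff_left_mono divide_left_mono) auto
    also have "\<dots> = (T - t n (Suc j)) / (T - t n j)"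
      using tj \<tau> by (simp add: step field_simps)
    finally have "(1 - h n / (T - \<tau>)) powr (2 * \<alpha>) \<le> ((T - t n (Suc j)) / (T - t n j)) powr (2 * \<alpha>)"
      using hn h[of n] \<alpha>_pos \<tau> by (intro powr_mono2) (auto simp: divide_le_eq)
    also have "\<dots> = ode.W (t n (Suc j)) / ode.W (t n j)"
      using tj \<tau> by (simp add: ode.W_def powr_divide)
    finally have "(1 - h n / (T - \<tau>)) powr (2 * \<alpha>) * ode.W (t n j) \<le> ode.W (t n (Suc j))"
      using ode.W_pos[of "t n j"] tj \<tau> by (simp add: field_simps)
    hence "(lam * h n / (1 + ode.\<kappa> / 2 * h n)\<^sup>2) * ((1 - h n / (T - \<tau>)) powr (2 * \<alpha>) * ode.W (t n j)) \<le>
      (lam * h n / (1 + ode.\<kappa> / 2 * h n)\<^sup>2) * ode.W (t n (Suc j))"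
      using lam_pos h[of n] by (intro mult_left_mono) auto
    also have "\<dots> \<le> c n j" using dl(3)[of j n] j by simp
    finally have "(lam * h n / (1 + ode.\<kappa> / 2 * h n)\<^sup>2) * ((1 - h n / (T - \<tau>)) powr (2 * \<alpha>) * ode.W (t n j)) * (Z (t n j) \<omega>)\<^sup>2
      \<le> c n j * (Z (t n j) \<omega>)\<^sup>2"
      by (rule mult_right_mono) simp
    moreover have "(lam * h n / (1 + ode.\<kappa> / 2 * h n)\<^sup>2) * ((1 - h n / (T - \<tau>)) powr (2 * \<alpha>) * ode.W (t n j)) * (Z (t n j) \<omega>)\<^sup>2
      = r n * (lam * (h n * (ode.W (t n j) * (Z (t n j) \<omega>)\<^sup>2)))"
      by (simp add: r_def)
    moreover have "ode.W (t n j) * (Z (t n j) \<omega>)\<^sup>2 = (X (t n j) \<omega>)\<^sup>2"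
      using tj \<tau> by (intro W_Z_square) auto
    ultimately show "r n * (lam * (h n * (X (t n j) \<omega>)\<^sup>2)) \<le> c n j * (Z (t n j) \<omega>)\<^sup>2" by simp
  qed
  have "r \<longlonglongrightarrow> (1 - 0 / (T - \<tau>)) powr (2 * \<alpha>) / (1 + ode.\<kappa> / 2 * 0)\<^sup>2"
    unfolding r_def using \<tau> by (intro tendsto_intros hlim) auto
  hence rlim: "r \<longlonglongrightarrow> 1" by simp
  have Slim: "(\<lambda>n. S n \<omega>) \<longlonglongrightarrow> lam * I \<tau> \<omega>" if \<omega>: "\<omega> \<in> space M" for \<omega>
  proof (rule real_tendsto_sandwich[where f = "\<lambda>n. r n * (lam * R n \<omega>)" and h = "\<lambda>n. lam * R n \<omega>"])
    have "(\<lambda>n. R n \<omega>) \<longlonglongrightarrow> I \<tau> \<omega>"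
      unfolding R_def I_def h_def t_def by (rule riemann_sum_tendsto[OF \<tau>(1) continuous_square[OF \<omega> \<tau>(2)]])
    hence RL: "(\<lambda>n. lam * R n \<omega>) \<longlonglongrightarrow> lam * I \<tau> \<omega>" by (intro tendsto_intros)
    thus "(\<lambda>n. lam * R n \<omega>) \<longlonglongrightarrow> lam * I \<tau> \<omega>" .
    show "(\<lambda>n. r n * (lam * R n \<omega>)) \<longlonglongrightarrow> lam * I \<tau> \<omega>"
      using tendsto_mult[OF rlim RL] by simp
    have "eventually (\<lambda>n. h n < T - \<tau>) sequentially"
      using \<tau> by (intro order_tendstoD(2)[OF hlim]) auto
    thus "eventually (\<lambda>n. r n * (lam * R n \<omega>) \<le> S n \<omega>) sequentially"
      by eventually_elim (rule S_ge)
  qed (use S_le in auto)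
  have \<beta>: "ode.\<beta> \<tau> > 0" using \<tau> by (intro ode.\<beta>_pos)
  have "(\<lambda>n. \<integral>\<omega>. exp (- S n \<omega> - ode.\<beta> \<tau> * (Z \<tau> \<omega>)\<^sup>2) \<partial>M) \<longlonglongrightarrow>
      (\<integral>\<omega>. exp (- (lam * I \<tau> \<omega>) - ode.\<beta> \<tau> * (Z \<tau> \<omega>)\<^sup>2) \<partial>M)"
  proof (rule integral_dominated_convergence[where w = "\<lambda>_. 1"])
    show "AE \<omega> in M. (\<lambda>n. exp (- S n \<omega> - ode.\<beta> \<tau> * (Z \<tau> \<omega>)\<^sup>2)) \<longlonglongrightarrow> exp (- (lam * I \<tau> \<omega>) - ode.\<beta> \<tau> * (Z \<tau> \<omega>)\<^sup>2)"
      by (intro AE_I2 tendsto_intros Slim)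
    show "AE \<omega> in M. norm (exp (- S n \<omega> - ode.\<beta> \<tau> * (Z \<tau> \<omega>)\<^sup>2)) \<le> 1" for n
    proof (rule AE_I2)
      fix \<omega>
      have "0 \<le> c n j" if "j < Suc n" for j
      proof -
        have "0 \<le> lam * h n * ode.W (t n (Suc j)) / (1 + ode.\<kappa> / 2 * h n)\<^sup>2"
          using lam_pos h[of n] ode.W_pos[of "t n (Suc j)"] t(2)[of "Suc j" n] that \<tau>
          by (intro divide_nonneg_nonneg mult_nonneg_nonneg) auto
        thus ?thesis using dl(3)[OF that] by linarith
      qed
      hence "S n \<omega> \<ge> 0" unfolding S_def by (intro sum_nonneg mult_nonneg_nonneg) auto
      moreover have "ode.\<beta> \<tau> * (Z \<tau> \<omega>)\<^sup>2 \<ge> 0" using \<beta> by simp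
      ultimately show "norm (exp (- S n \<omega> - ode.\<beta> \<tau> * (Z \<tau> \<omega>)\<^sup>2)) \<le> 1" by simp
    qed
  qed auto
  moreover have "(\<lambda>n. \<integral>\<omega>. exp (- S n \<omega> - ode.\<beta> \<tau> * (Z \<tau> \<omega>)\<^sup>2) \<partial>M) \<longlonglongrightarrow> sqrt (ode.Y \<tau> / ode.Y 0)"
    using ode.product_tendsto[OF \<tau>, folded t_def] unfolding S_def dl(1) .
  ultimately have "(\<integral>\<omega>. exp (- (lam * I \<tau> \<omega>) - ode.\<beta> \<tau> * (Z \<tau> \<omega>)\<^sup>2) \<partial>M) = sqrt (ode.Y \<tau> / ode.Y 0)"
    by (rule LIMSEQ_unique)
  thus ?thesis by simp
qed

text \<open>The chain with a single step from 0 to \<tau>. It measures what is lost when the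
  terminal weight is dropped.\<close>

lemma expectation_exp_end:
  assumes \<tau>: "0 < \<tau>" "\<tau> < T"
  shows "(\<integral>\<omega>. exp (- ode.\<beta> \<tau> * (Z \<tau> \<omega>)\<^sup>2) \<partial>M) = 1 / sqrt (1 + 2 * ode.\<beta> \<tau> * (ode.q \<tau> - ode.q 0))"
proof -
  \<comment> \<open>The value at 0 is forced by the recursion with weight 0.\<close>
  define b where "b j = (if j = 0 then ode.\<beta> \<tau> / (1 + 2 * ode.\<beta> \<tau> * (ode.q \<tau> - ode.q 0)) else ode.\<beta> \<tau>)" for j :: nat
  define s where "s j = (if j = 0 then 0 else \<tau>)" for j :: nat
  have \<beta>: "ode.\<beta> \<tau> > 0" using \<tau> by (intro ode.\<beta>_pos)
  have q: "0 \<le> ode.q \<tau> - ode.q 0" using \<tau> by (intro ode.q_increment(1)) auto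
  have "(\<integral>\<omega>. exp (- (\<Sum>j<1. 0 * (Z (s j) \<omega>)\<^sup>2) - b 1 * (Z (s 1) \<omega>)\<^sup>2) \<partial>M) = (\<Prod>j<1. 1 / sqrt (1 + 2 * b (Suc j) * (ode.q \<tau> - ode.q 0)))"
  proof (rule wiener_integral_gaussian_chain[where g = "\<lambda>j. g (s j)" and Z = "\<lambda>j. Z (s j)"])
    show "wiener_integral_of (g (s j)) (Z (s j))" if "j \<le> 1" for j
      using \<tau> by (intro Z_wiener_integral) (auto simp: s_def)
    show "g (s i) x * (g (s (Suc j)) x - g (s j) x) = 0" if "i \<le> j" "j < 1" for i j x
      using that \<tau> by (intro g_orthogonal) (auto simp: s_def)
    show "(\<integral>x. (g (s 0) x)\<^sup>2 \<partial>lborel) = 0" using g_0 by (simp add: s_def)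
    show "0 \<le> b j" if "j \<le> 1" for j
      using \<beta> q by (auto simp: b_def intro!: divide_nonneg_nonneg add_nonneg_nonneg)
    show "(\<integral>x. (g (s (Suc j)) x - g (s j) x)\<^sup>2 \<partial>lborel) = ode.q \<tau> - ode.q 0" if "j < 1" for j
      using that \<tau> g_increment[of 0 \<tau>] by (auto simp: s_def)
  qed (auto simp: b_def)
  thus ?thesis by (simp add: b_def s_def)
qed

text \<open>As \<tau> tends to \<open>T\<close> the terminal weight disappears, although
  \<open>q\<close> itself diverges for \<open>\<alpha> \<ge> 1 / 2\<close>:
  \<open>2 * \<beta> \<tau> * (q \<tau> - q 0)\<close> is at most \<open>T * \<kappa>\<close> times
  the logarithmic derivative of \<open>kummer\<close> at a point tending to 0, where
  \<open>kummer'\<close> vanishes.\<close>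

lemma expectation_exp_J: "(\<integral>\<omega>. exp_J lam \<omega> \<partial>M) = sqrt (kummer \<alpha> 0 / kummer \<alpha> (T * sqrt (8 * lam)))"
proof -
  define E where "E m = (\<integral>\<omega>. exp (- lam * I (tau m) \<omega>) \<partial>M)" for m
  define b where "b m = 2 * ode.\<beta> (tau m) * (ode.q (tau m) - ode.q 0)" for m
  have "(\<lambda>m. E m) \<longlonglongrightarrow> (\<integral>\<omega>. exp_J lam \<omega> \<partial>M)"
    unfolding E_def
  proof (rule integral_dominated_convergence[where w = "\<lambda>_. 1"])
    show "AE \<omega> in M. (\<lambda>m. exp (- lam * I (tau m) \<omega>)) \<longlonglongrightarrow> exp_J lam \<omega>"
      by (intro AE_I2 exp_I_tendsto lam_pos)
    show "AE \<omega> in M. norm (exp (- lam * I (tau m) \<omega>)) \<le> 1" for m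
      using I_nonneg[OF _ tau(2)] lam_pos by (intro AE_I2) auto
    show "(\<lambda>\<omega>. exp (- lam * I (tau m) \<omega>)) \<in> borel_measurable M" for m
      using I_measurable[OF tau(1,2)] by measurable
  qed auto
  moreover have "(\<lambda>m. E m) \<longlonglongrightarrow> sqrt (kummer \<alpha> 0 / kummer \<alpha> (T * sqrt (8 * lam)))"
  proof -
    have tt: "(\<lambda>m. ode.\<kappa> * (T - tau m)) \<longlonglongrightarrow> 0"
      by (auto intro!: tendsto_eq_intros tau(4))
    have k: "isCont (kummer \<alpha>) 0" "isCont (kummer' \<alpha>) 0"
      using kummer_has_derivative[OF \<alpha>_pos] kummer'_has_derivative[OF \<alpha>_pos] by (auto intro: DERIV_isCont)
    have klim: "(\<lambda>m. kummer \<alpha> (ode.\<kappa> * (T - tau m))) \<longlonglongrightarrow> kummer \<alpha> 0"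
      "(\<lambda>m. kummer' \<alpha> (ode.\<kappa> * (T - tau m))) \<longlonglongrightarrow> 0"
      using isCont_tendsto_compose[OF k(1) tt] isCont_tendsto_compose[OF k(2) tt] by (auto simp: kummer'_0[OF \<alpha>_pos])
    have k0: "kummer \<alpha> 0 \<noteq> 0" using kummer_pos[OF \<alpha>_pos, of 0] by simp
    have blim: "b \<longlonglongrightarrow> 0"
    proof (rule real_tendsto_sandwich)
      let ?r = "\<lambda>m. ode.\<kappa> * kummer' \<alpha> (ode.\<kappa> * (T - tau m)) / kummer \<alpha> (ode.\<kappa> * (T - tau m))"
      show "eventually (\<lambda>m. 0 \<le> b m) sequentially"
        using tau(1,2)
        by (intro always_eventually allI, unfold b_def, intro ode.\<beta>_q_le(1)) (auto simp: less_imp_le)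
      show "eventually (\<lambda>m. b m \<le> T * ?r m) sequentially"
      proof (intro always_eventually allI)
        fix m
        have W: "ode.W (tau m) > 0" using tau by (intro ode.W_pos)
        have kp: "kummer' \<alpha> (ode.\<kappa> * (T - tau m)) > 0"
          using tau ode.\<kappa> by (intro kummer'_pos \<alpha>_pos) auto
        have "b m \<le> 2 * ode.\<beta> (tau m) * ((tau m - 0) / ode.W (tau m))"
          unfolding b_def using ode.\<beta>_pos[OF tau(2)[of m]] tau(1,2)[of m] by (intro mult_left_mono ode.q_increment(2)) auto
        also have "\<dots> = tau m * ?r m"
          using W by (simp add: ode.\<beta>_def ode.P_def ode.Y_def)
        also have "\<dots> \<le> T * ?r m"
          using tau(1,2)[of m] kp ode.\<kappa> kummer_pos[OF \<alpha>_pos, of "ode.\<kappa> * (T - tau m)"]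
          by (intro mult_right_mono divide_nonneg_nonneg mult_nonneg_nonneg) (auto simp: less_imp_le)
        finally show "b m \<le> T * ?r m" .
      qed
      have "(\<lambda>m. T * ?r m) \<longlonglongrightarrow> T * (ode.\<kappa> * 0 / kummer \<alpha> 0)"
        by (intro tendsto_intros klim k0)
      thus "(\<lambda>m. T * ?r m) \<longlonglongrightarrow> 0" by simp
    qed auto
    \<comment> \<open>For \<open>x\<close> and \<open>y\<close> in the unit interval
      \<open>0 \<le> x - x * y \<le> 1 - y\<close>, so the expectation of \<open>1 - y\<close>
      bounds the error.\<close>
    have d: "\<bar>E m - sqrt (ode.Y (tau m) / ode.Y 0)\<bar> \<le> 1 - 1 / sqrt (1 + b m)" for m
    proof -
      have \<beta>: "ode.\<beta> (tau m) > 0" using tau by (intro ode.\<beta>_pos)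
      have Zm: "Z (tau m) \<in> borel_measurable M"
        unfolding Z_def using X_measurable[of "tau m"] tau(1,2)[of m] by simp
      note [measurable] = I_measurable[OF tau(1,2)[of m]] Zm
      have b1: "integrable M f" if "f \<in> borel_measurable M" "\<And>\<omega>. \<omega> \<in> space M \<Longrightarrow> \<bar>f \<omega>\<bar> \<le> 1" for f :: "'a \<Rightarrow> real"
        using that by (intro integrable_const_bound[of _ 1]) auto
      define x where "x \<omega> = exp (- lam * I (tau m) \<omega>)" for \<omega>
      define y where "y \<omega> = exp (- ode.\<beta> (tau m) * (Z (tau m) \<omega>)\<^sup>2)" for \<omega>
      have [measurable]: "x \<in> borel_measurable M" "y \<in> borel_measurable M" unfolding x_def y_def by measurable
      have x: "0 \<le> x \<omega>" "x \<omega> \<le> 1" if "\<omega> \<in> space M" for \<omega>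
        using I_nonneg[OF that tau(2)[of m]] lam_pos by (auto simp: x_def)
      have y: "0 \<le> y \<omega>" "y \<omega> \<le> 1" for \<omega> using \<beta> by (auto simp: y_def)
      have xyi: "integrable M x" "integrable M y" "integrable M (\<lambda>\<omega>. x \<omega> * y \<omega>)"
        using x y by (auto intro!: b1 mult_le_one simp: abs_mult)
      have "(\<integral>\<omega>. x \<omega> * y \<omega> \<partial>M) = sqrt (ode.Y (tau m) / ode.Y 0)"
        using laplace_up_to[OF tau(1,2)[of m]] by (simp add: x_def y_def flip: exp_add)
      hence "E m - sqrt (ode.Y (tau m) / ode.Y 0) = (\<integral>\<omega>. x \<omega> - x \<omega> * y \<omega> \<partial>M)"
        using xyi unfolding E_def x_def[symmetric] by simp
      moreover have "0 \<le> (\<integral>\<omega>. x \<omega> - x \<omega> * y \<omega> \<partial>M)"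
        using x y by (intro Bochner_Integration.integral_nonneg) (auto simp: mult_left_le)
      moreover have "(\<integral>\<omega>. x \<omega> - x \<omega> * y \<omega> \<partial>M) \<le> (\<integral>\<omega>. 1 - y \<omega> \<partial>M)"
      proof (rule integral_mono)
        fix \<omega> assume "\<omega> \<in> space M"
        hence "x \<omega> * (1 - y \<omega>) \<le> 1 * (1 - y \<omega>)" using x y by (intro mult_right_mono) auto
        thus "x \<omega> - x \<omega> * y \<omega> \<le> 1 - y \<omega>" by (simp add: algebra_simps)
      qed (use xyi in auto)
      moreover have "(\<integral>\<omega>. 1 - y \<omega> \<partial>M) = 1 - 1 / sqrt (1 + b m)"
      proof -
        have "(\<integral>\<omega>. 1 - y \<omega> \<partial>M) = 1 - (\<integral>\<omega>. y \<omega> \<partial>M)" using xyi by (simp add: prob_space)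
        thus ?thesis unfolding y_def expectation_exp_end[OF tau(1,2)[of m]] b_def .
      qed
      ultimately show ?thesis by simp
    qed
    have "(\<lambda>m. 1 - 1 / sqrt (1 + b m)) \<longlonglongrightarrow> 1 - 1 / sqrt (1 + 0)"
      by (intro tendsto_intros blim) auto
    hence "(\<lambda>m. 1 - 1 / sqrt (1 + b m)) \<longlonglongrightarrow> 0" by simp
    hence "(\<lambda>m. E m - sqrt (ode.Y (tau m) / ode.Y 0)) \<longlonglongrightarrow> 0"
      using d by (intro Lim_null_comparison[of "\<lambda>m. E m - sqrt (ode.Y (tau m) / ode.Y 0)"]) auto
    moreover have "(\<lambda>m. sqrt (ode.Y (tau m) / ode.Y 0)) \<longlonglongrightarrow> sqrt (kummer \<alpha> 0 / ode.Y 0)"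
      unfolding ode.Y_def[of "tau _"] using ode.Y_pos[of 0] by (intro tendsto_intros klim) auto
    ultimately have "(\<lambda>m. E m - sqrt (ode.Y (tau m) / ode.Y 0) + sqrt (ode.Y (tau m) / ode.Y 0)) \<longlonglongrightarrow> 0 + sqrt (kummer \<alpha> 0 / ode.Y 0)"
      by (rule tendsto_add)
    thus ?thesis by (simp add: ode.Y_def ode.\<kappa>_def mult.commute)
  qed
  ultimately show ?thesis by (rule LIMSEQ_unique)
qed

end

section \<open>Distribution function of the path integral\<close>

definition F :: "real \<Rightarrow> real" where
  "F u = prob {\<omega> \<in> space M. J \<omega> < ennreal u}"

lemma J_less_sets [measurable]: "{\<omega> \<in> space M. J \<omega> < ennreal u} \<in> events"
  by measurable

lemma F_mono: "mono F"
  unfolding F_def by (intro monoI finite_measure_mono) (auto intro: less_le_trans ennreal_leI)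

lemma exponential_tail:
  assumes l: "l > 0" and x: "x \<ge> 0"
  shows "(\<integral>\<^sup>+u. ennreal (l * exp (- l * u)) * indicator {x<..} u \<partial>lborel) = ennreal (exp (- l * x))"
proof -
  have "(\<integral>\<^sup>+u. ennreal (l * exp (- l * u)) * indicator {x<..} u \<partial>lborel) =
     (\<integral>\<^sup>+u. ennreal (l * exp (- l * u)) * indicator {x..} u \<partial>lborel)"
  proof (rule nn_integral_cong_AE)
    have "AE u in lborel. u \<notin> {x}" by (intro AE_not_in finite_imp_null_set_lborel) auto
    thus "AE u in lborel. ennreal (l * exp (- l * u)) * indicator {x<..} u = ennreal (l * exp (- l * u)) * indicator {x..} u"
      by eventually_elim (auto simp: indicator_def)
  qed
  also have "\<dots> = ennreal (0 - (- exp (- l * x)))"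
  proof (rule nn_integral_FTC_atLeast)
    show "((\<lambda>u. - exp (- l * u)) has_real_derivative l * exp (- l * u)) (at u)" for u
      by (auto intro!: derivative_eq_intros)
    have "filterlim (\<lambda>u. - l * u) at_bot at_top"
      using l by (intro filterlim_tendsto_neg_mult_at_bot[OF tendsto_const] filterlim_ident) auto
    hence "((\<lambda>u. exp (- l * u)) \<longlongrightarrow> 0) at_top" by (rule filterlim_compose[OF exp_at_bot])
    from tendsto_minus[OF this] show "((\<lambda>u. - exp (- l * u)) \<longlongrightarrow> 0) at_top" by simp
  qed (use l in auto)
  finally show ?thesis by simp
qed

text \<open>Tonelli: integrating \<open>l * exp (- l * u)\<close> over \<open>u > J \<omega>\<close>
  gives \<open>exp (- l * J \<omega>)\<close>, and 0 on both sides if \<open>J \<omega>\<close> is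
  infinite.\<close>

lemma laplace_of_F:
  assumes l: "l > 0"
  shows "l * (\<integral>u. exp (- l * u) * F u \<partial>lborel) = (\<integral>\<omega>. exp_J l \<omega> \<partial>M)"
proof -
  let ?E = "\<lambda>u. {\<omega> \<in> space M. J \<omega> < ennreal u}"
  have [measurable]: "F \<in> borel_measurable borel" using F_mono by (rule borel_measurable_mono)
  interpret P: pair_sigma_finite lborel M ..
  have inner: "(\<integral>\<^sup>+u. ennreal (l * exp (- l * u)) * indicator (?E u) \<omega> \<partial>lborel) = ennreal (exp_J l \<omega>)"
    if \<omega>: "\<omega> \<in> space M" for \<omega>
  proof (cases "J \<omega> = \<infinity>")
    case False
    then obtain x where x: "J \<omega> = ennreal x" "x \<ge> 0" by (cases "J \<omega>") auto
    have "indicator (?E u) \<omega> = (indicator {x<..} u :: ennreal)" for u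
      using \<omega> x by (auto simp: indicator_def ennreal_less_iff)
    thus ?thesis using exponential_tail[OF l x(2)] x by (simp add: exp_J_def)
  qed (simp add: exp_J_def)
  have "ennreal (l * (\<integral>u. exp (- l * u) * F u \<partial>lborel)) = (\<integral>\<^sup>+u. ennreal (l * exp (- l * u) * F u) \<partial>lborel)"
  proof -
    have "integrable lborel (\<lambda>u. l * exp (- l * u) * F u)"
    proof (rule Bochner_Integration.integrable_bound)
      show "integrable lborel (\<lambda>u. l * (exp (- l * u) * gamma_weight 1 u))"
        using has_bochner_integral_gamma_weight[of 1 l] l by (intro integrable_mult_right) (simp add: has_bochner_integral_iff)
      have "F u = 0" if "u \<le> 0" for u using that by (simp add: F_def ennreal_neg)
      thus "AE u in lborel. norm (l * exp (- l * u) * F u) \<le> norm (l * (exp (- l * u) * gamma_weight 1 u))"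
        using l by (intro AE_I2) (auto simp: gamma_weight_def indicator_def F_def abs_mult)
    qed measurable
    from nn_integral_eq_integral[OF this] show ?thesis
      using l by (simp add: F_def mult.assoc)
  qed
  also have "\<dots> = (\<integral>\<^sup>+u. \<integral>\<^sup>+\<omega>. ennreal (l * exp (- l * u)) * indicator (?E u) \<omega> \<partial>M \<partial>lborel)"
    using l by (intro nn_integral_cong) (simp add: nn_integral_cmult_indicator F_def emeasure_eq_measure ennreal_mult')
  also have "\<dots> = (\<integral>\<^sup>+\<omega>. \<integral>\<^sup>+u. ennreal (l * exp (- l * u)) * indicator (?E u) \<omega> \<partial>lborel \<partial>M)"
  proof (rule P.Fubini'[symmetric])
    \<comment> \<open>Joint measurability: the events \<open>?E u\<close> are the sections of one
      measurable set of the product space.\<close>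
    have "(\<lambda>(u, \<omega>). ennreal (l * exp (- l * u)) * indicator {x \<in> space (lborel \<Otimes>\<^sub>M M). J (snd x) < ennreal (fst x)} (u, \<omega>))
       \<in> borel_measurable (lborel \<Otimes>\<^sub>M M)"
      by measurable
    thus "(\<lambda>(u, \<omega>). ennreal (l * exp (- l * u)) * indicator (?E u) \<omega>) \<in> borel_measurable (lborel \<Otimes>\<^sub>M M)"
      by (rule measurable_cong[THEN iffD1, rotated]) (auto simp: indicator_def space_pair_measure)
  qed
  also have "\<dots> = (\<integral>\<^sup>+\<omega>. ennreal (exp_J l \<omega>) \<partial>M)"
    by (intro nn_integral_cong inner)
  also have "\<dots> = ennreal (\<integral>\<omega>. exp_J l \<omega> \<partial>M)"
  proof (rule nn_integral_eq_integral)
    show "integrable M (exp_J l)"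
      using l by (intro integrable_const_bound[of _ 1]) (auto simp: exp_J_def)
  qed (auto simp: exp_J_def)
  finally have "ennreal (l * (\<integral>u. exp (- l * u) * F u \<partial>lborel)) = ennreal (\<integral>\<omega>. exp_J l \<omega> \<partial>M)" .
  moreover have "0 \<le> (\<integral>u. exp (- l * u) * F u \<partial>lborel)"
    by (intro Bochner_Integration.integral_nonneg) (simp add: F_def)
  moreover have "0 \<le> (\<integral>\<omega>. exp_J l \<omega> \<partial>M)"
    by (intro Bochner_Integration.integral_nonneg) (simp add: exp_J_def)
  ultimately show ?thesis using l by simp
qed

text \<open>Because the inequality is strict, the event for \<open>u\<close> is the increasing union
  of the events for \<open>S n\<close>.\<close>

lemma F_left_continuous: "continuous (at_left u) F"
  unfolding continuous_within
proof (rule tendsto_at_left_sequentially[where b = "u - 1"])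
  let ?E = "\<lambda>u. {\<omega> \<in> space M. J \<omega> < ennreal u}"
  fix S :: "nat \<Rightarrow> real"
  assume S: "\<And>n. S n < u" "incseq S" "S \<longlonglongrightarrow> u"
  have "(\<lambda>n. F (S n)) \<longlonglongrightarrow> prob (\<Union>n. ?E (S n))"
    unfolding F_def
  proof (rule finite_Lim_measure_incseq)
    show "incseq (\<lambda>n. ?E (S n))"
      using S(2) by (auto simp: incseq_def intro: less_le_trans ennreal_leI)
  qed auto
  also have "(\<Union>n. ?E (S n)) = ?E u"
  proof (intro equalityI subsetI)
    fix \<omega> assume \<omega>: "\<omega> \<in> ?E u"
    have "(\<lambda>n. ennreal (S n)) \<longlonglongrightarrow> ennreal u" using S(3) by (rule tendsto_ennrealI)
    hence "eventually (\<lambda>n. J \<omega> < ennreal (S n)) sequentially" using \<omega> by (intro order_tendstoD) auto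
    then obtain n where "J \<omega> < ennreal (S n)" by (auto simp: eventually_sequentially)
    thus "\<omega> \<in> (\<Union>n. ?E (S n))" using \<omega> by auto
  next
    fix \<omega> assume "\<omega> \<in> (\<Union>n. ?E (S n))"
    then obtain n where n: "\<omega> \<in> space M" "J \<omega> < ennreal (S n)" by auto
    from n(2) have "J \<omega> < ennreal u"
      by (rule less_le_trans) (intro ennreal_leI less_imp_le S(1))
    with n(1) show "\<omega> \<in> ?E u" by simp
  qed
  finally show "(\<lambda>n. F (S n)) \<longlonglongrightarrow> F u" unfolding F_def .
qed auto

lemma small_ball_laplace_F: "small_ball_laplace \<alpha> T F"
proof
  show "F u = 0" if "u \<le> 0" for u using that by (simp add: F_def ennreal_neg)
  show "(l * (\<integral>u. exp (- l * u) * F u \<partial>lborel))\<^sup>2 * kummer \<alpha> (T * sqrt (8 * l)) = kummer \<alpha> 0" if l: "l > 0" for l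
    unfolding laplace_of_F[OF l] expectation_exp_J[OF l]
    using kummer_pos[OF \<alpha>_pos, of 0] kummer_pos[OF \<alpha>_pos, of "T * sqrt (8 * l)"] by simp
qed (use \<alpha>_pos T_pos F_mono F_left_continuous in \<open>auto simp: F_def\<close>)

end

section \<open>From almost surely continuous to everywhere continuous paths\<close>

lemma (in alpha_wiener_bridge) continuous_modification:
  assumes "\<alpha> > 0" "T > 0"
  obtains N X' where "N \<in> null_sets M" "continuous_alpha_bridge M B \<alpha> T X'"
    "\<And>t \<omega>. \<omega> \<notin> N \<Longrightarrow> X' t \<omega> = X t \<omega>"
proof -
  from continuous_bridge_paths obtain N where
    N: "{\<omega> \<in> space M. \<not> continuous_on {0..<T} (\<lambda>t. X t \<omega>)} \<subseteq> N" "N \<in> null_sets M"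
    by (auto elim!: AE_E simp: null_sets_def)
  \<comment> \<open>The zero path is continuous and ends at 0, and the mean-square limits do not see
    a change on a null set.\<close>
  define X' where "X' t \<omega> = (if \<omega> \<in> N then 0 else X t \<omega>)" for t \<omega>
  have AEN: "AE \<omega> in M. \<omega> \<notin> N" using N(2) by (rule AE_not_in)
  have "continuous_alpha_bridge M B \<alpha> T X'"
  proof
    show cont: "continuous_on {0..<T} (\<lambda>t. X' t \<omega>)" if "\<omega> \<in> space M" for \<omega>
      using N(1) that by (cases "\<omega> \<in> N") (auto simp: X'_def)
    show "AE \<omega> in M. continuous_on {0..<T} (\<lambda>t. X' t \<omega>)" using cont by auto
    show "X' T \<omega> = 0" if "\<omega> \<in> space M" for \<omega> using end_value[OF that] by (simp add: X'_def)
    show "has_wiener_integral M B (\<lambda>s. ((T - t) / (T - s)) powr \<alpha>) 0 t (X' t)" if t: "0 \<le> t" "t < T" for t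
    proof -
      note X = integral_representation[OF t]
      have Xm: "X t \<in> borel_measurable M" using X by (simp add: has_wiener_integral_def)
      have "X' t \<in> borel_measurable M"
        unfolding X'_def using N(2) Xm by (intro measurable_If_set) auto
      moreover have "(\<integral>\<^sup>+\<omega>. ennreal ((X' t \<omega> - S \<omega>)\<^sup>2) \<partial>M) = (\<integral>\<^sup>+\<omega>. ennreal ((X t \<omega> - S \<omega>)\<^sup>2) \<partial>M)" for S
        using AEN by (intro nn_integral_cong_AE) (auto simp: X'_def)
      ultimately show ?thesis using X by (simp add: has_wiener_integral_def)
    qed
  qed (use assms in auto)
  with N(2) show ?thesis by (rule that) (simp add: X'_def)
qed

text \<open>The event for \<open>X\<close> may fail to be measurable, but it differs from the event
  for \<open>X'\<close> only inside \<open>N\<close>, all of whose subsets are null in the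
  completion.\<close>

lemma small_ball_prob_modification:
  assumes N: "N \<in> null_sets M" and eq: "\<And>t \<omega>. \<omega> \<notin> N \<Longrightarrow> X' t \<omega> = X t \<omega>"
    and meas: "{\<omega> \<in> space M. (\<integral>\<^sup>+t\<in>{0..T}. ennreal ((X' t \<omega>)\<^sup>2) \<partial>lborel) < ennreal \<epsilon>} \<in> sets M"
  shows "small_ball_prob M X T \<epsilon> = measure M {\<omega> \<in> space M. (\<integral>\<^sup>+t\<in>{0..T}. ennreal ((X' t \<omega>)\<^sup>2) \<partial>lborel) < ennreal \<epsilon>}"
proof -
  define A where "A = {\<omega> \<in> space M. (\<integral>\<^sup>+t\<in>{0..T}. ennreal ((X t \<omega>)\<^sup>2) \<partial>lborel) < ennreal \<epsilon>}"
  define A' where "A' = {\<omega> \<in> space M. (\<integral>\<^sup>+t\<in>{0..T}. ennreal ((X' t \<omega>)\<^sup>2) \<partial>lborel) < ennreal \<epsilon>}"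
  have A': "A' \<in> sets M" using meas by (simp add: A'_def)
  have AN: "A \<inter> N \<in> null_sets (completion M)"
    by (rule null_sets_completion_subset[OF _ null_sets_completionI[OF N]]) auto
  have same: "A - N = A' - N" using eq by (auto simp: A_def A'_def)
  have N': "N \<in> null_sets (completion M)" using N by (rule null_sets_completionI)
  have "A = (A' - N) \<union> (A \<inter> N)" using same by auto
  moreover have "A' - N \<in> sets (completion M)" using A' N by auto
  ultimately have "measure (completion M) A = measure (completion M) (A' - N)"
    using AN by (metis measure_Un_null_set)
  also have "\<dots> = measure (completion M) A'"
    using A' N' by (intro measure_Diff_null_set) auto
  also have "\<dots> = measure M A'" using A' by simp
  finally show ?thesis by (simp add: small_ball_prob_def A_def A'_def)
qed

theorem corollary3p8:
  fixes M :: "'a measure" and B X :: "real \<Rightarrow> 'a \<Rightarrow> real" and T \<alpha> \<nu> :: real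
  assumes "0 < T" and "0 < \<alpha>" and "\<nu> = \<alpha> - 1 / 2"
    and "alpha_wiener_bridge M B \<alpha> T X"
  shows "\<exists>c>0. \<exists>h :: real \<Rightarrow> real. h \<in> o[at_right 0](\<lambda>_. 1) \<and>
           (\<forall>\<^sub>F \<epsilon> in at_right 0.
              small_ball_prob M X T \<epsilon> =
                (c + h \<epsilon>) * \<epsilon> powr (1 / 4 - \<nu> / 2) * exp (- (T\<^sup>2 / (8 * \<epsilon>))))"
proof -
  interpret alpha_wiener_bridge M B \<alpha> T X by fact
  obtain N X' where N: "N \<in> null_sets M" and X': "continuous_alpha_bridge M B \<alpha> T X'"
    and eq: "\<And>t \<omega>. \<omega> \<notin> N \<Longrightarrow> X' t \<omega> = X t \<omega>"
    using continuous_modification[OF assms(2,1)] by blast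
  interpret C: continuous_alpha_bridge M B \<alpha> T X' by fact
  interpret L: small_ball_laplace \<alpha> T C.F by (rule C.small_ball_laplace_F)
  have F: "small_ball_prob M X T \<epsilon> = C.F \<epsilon>" for \<epsilon>
    using small_ball_prob_modification[OF N eq, where T = T and \<epsilon> = \<epsilon>] C.J_less_sets[of \<epsilon>] by (simp add: C.F_def C.J_def)
  define G where "G \<epsilon> = \<epsilon> powr ((1 - \<alpha>) / 2) * exp (- (T\<^sup>2 / (8 * \<epsilon>)))" for \<epsilon> :: real
  obtain c where c: "c > 0" "((\<lambda>\<epsilon>. C.F \<epsilon> / G \<epsilon>) \<longlongrightarrow> c) (at_right 0)"
    using L.small_ball_asymp unfolding G_def by blast
  \<comment> \<open>The error term is read off from the equation to be proved; for
    \<open>\<epsilon> > 0\<close> the factor \<open>G \<epsilon>\<close> is nonzero, so the equation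
    then holds exactly.\<close>
  define h where "h \<epsilon> = C.F \<epsilon> / G \<epsilon> - c" for \<epsilon>
  have "(h \<longlongrightarrow> 0) (at_right 0)"
    unfolding h_def using tendsto_diff[OF c(2) tendsto_const[of c]] by simp
  hence "h \<in> o[at_right 0](\<lambda>_. 1)" by (intro smalloI_tendsto) auto
  moreover have "\<forall>\<^sub>F \<epsilon> in at_right 0. small_ball_prob M X T \<epsilon> =
      (c + h \<epsilon>) * \<epsilon> powr (1 / 4 - \<nu> / 2) * exp (- (T\<^sup>2 / (8 * \<epsilon>)))"
    using eventually_at_right_less[of "0::real"]
  proof eventually_elim
    case (elim \<epsilon>)
    have e: "1 / 4 - \<nu> / 2 = (1 - \<alpha>) / 2" by (simp add: assms(3) field_simps)
    have "G \<epsilon> \<noteq> 0" using elim by (simp add: G_def)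
    hence "C.F \<epsilon> = (c + h \<epsilon>) * G \<epsilon>" by (simp add: h_def)
    thus ?case unfolding F e by (simp add: G_def mult.assoc)
  qed
  ultimately show ?thesis using c(1) by blast
qed

end
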